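(* Let $m\ge 2$ be an integer and let $f:[-1,1]^2\to\mathbb{R}$ be a continuous function such that the kernel $((x,z),(y,w))\in(S^1\times S^m)^2\mapsto f(x\cdot y,z\cdot w)$ is positive definite. For $k\in\mathbb{Z}_+$ let $J_f^k=\{l\in\mathbb{Z}_+ : a_{k,l}^{1,m}>0\}$, where $a_{k,l}^{1,m}$ are the coefficients of $f$ in its series representation (see context). The following assertions are equivalent: (i) the kernel $((x,z),(y,w))\in(S^1\times S^m)^2\mapsto f(x\cdot y,z\cdot w)$ is strictly positive definite; (ii) for each integer $\gamma\ge 0$, the sets $$\{k\in\mathbb{Z} : J_f^{|k|}\cap\{\gamma,\gamma+1,\ldots\}\cap(2\mathbb{Z}+1)\neq\varnothing\}$$ and $$\{k\in\mathbb{Z} : J_f^{|k|}\cap\{\gamma,\gamma+1,\ldots\}\cap 2\mathbb{Z}_+\neq\varnothing\}$$ both intersect every full arithmetic progression in $\mathbb{Z}$, that is, every set $n\mathbb{Z}+j$ with $n\ge1$ and $j\in\{0,1,\ldots,n-1\}$.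
   Context: $S^d$ is the unit sphere of $\mathbb{R}^{d+1}$, $\cdot$ is the usual inner product and $\mathbb{Z}_+=\{0,1,2,\ldots\}$. A kernel $K:X\times X\to\mathbb{R}$ on a nonempty set $X$ is positive definite if $K(u,v)=K(v,u)$ for all $u,v$ and $\sum_{\mu,\nu=1}^n c_\mu c_\nu K(u_\mu,u_\nu)\ge0$ for all $n\ge1$, all distinct $u_1,\ldots,u_n\in X$ and all real $c_1,\ldots,c_n$; it is strictly positive definite if moreover these inequalities are strict whenever at least one $c_\mu$ is nonzero. Polynomials: $P_0^1\equiv1$ and $P_k^1(\cos\theta)=\frac{2}{k}\cos k\theta$ for $k\ge1$; for $m\ge2$, $P_l^m$ is the Gegenbauer polynomial of degree $l$ attached to the number $(m-1)/2$, normalized by $P_l^m(1)=\binom{l+m-2}{l}$. Series representation (known fact): a continuous $f:[-1,1]^2\to\mathbb{R}$ gives a positive definite kernel $((x,z),(y,w))\mapsto f(x\cdot y,z\cdot w)$ on $S^1\times S^m$ if and only if $f(t,s)=\sum_{k,l=0}^\infty a_{k,l}^{1,m}P_k^1(t)P_l^m(s)$, $t,s\in[-1,1]$, with $a_{k,l}^{1,m}\ge0$ and $\sum_{k,l}a_{k,l}^{1,m}P_k^1(1)P_l^m(1)<\infty$; the coefficients are determined by $f$. *)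

theory Defs
  imports "HOL-Analysis.Analysis"
begin

definition pd_kernel_on :: "'a set \<Rightarrow> ('a \<Rightarrow> 'a \<Rightarrow> real) \<Rightarrow> bool" where
  "pd_kernel_on X K \<longleftrightarrow>
     (\<forall>u\<in>X. \<forall>v\<in>X. K u v = K v u) \<and>
     (\<forall>n\<ge>1. \<forall>(u :: nat \<Rightarrow> 'a) (c :: nat \<Rightarrow> real).
        u ` {1..n} \<subseteq> X \<longrightarrow> inj_on u {1..n} \<longrightarrow>
        (\<Sum>\<mu>=1..n. \<Sum>\<nu>=1..n. c \<mu> * c \<nu> * K (u \<mu>) (u \<nu>)) \<ge> 0)"

definition strictly_pd_kernel_on :: "'a set \<Rightarrow> ('a \<Rightarrow> 'a \<Rightarrow> real) \<Rightarrow> bool" where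
  "strictly_pd_kernel_on X K \<longleftrightarrow>
     pd_kernel_on X K \<and>
     (\<forall>n\<ge>1. \<forall>(u :: nat \<Rightarrow> 'a) (c :: nat \<Rightarrow> real).
        u ` {1..n} \<subseteq> X \<longrightarrow> inj_on u {1..n} \<longrightarrow> (\<exists>\<mu>\<in>{1..n}. c \<mu> \<noteq> 0) \<longrightarrow>
        (\<Sum>\<mu>=1..n. \<Sum>\<nu>=1..n. c \<mu> * c \<nu> * K (u \<mu>) (u \<nu>)) > 0)"

definition inner_kernel ::
  "(real \<times> real \<Rightarrow> real) \<Rightarrow> 'a::real_inner \<times> 'b::real_inner \<Rightarrow> 'a \<times> 'b \<Rightarrow> real" where
  "inner_kernel f = (\<lambda>(x, z) (y, w). f (x \<bullet> y, z \<bullet> w))"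

text \<open>The Gegenbauer polynomials, with parameter \<open>\<alpha>\<close>, in the standard normalization
  (generating function \<open>(1 - 2 t r + r\<^sup>2) powr (- \<alpha>)\<close>), by their three-term recurrence.\<close>

fun gegenbauer :: "real \<Rightarrow> nat \<Rightarrow> real \<Rightarrow> real" where
  "gegenbauer \<alpha> 0 t = 1"
| "gegenbauer \<alpha> (Suc 0) t = 2 * \<alpha> * t"
| "gegenbauer \<alpha> (Suc (Suc n)) t =
     (2 * (real n + 1 + \<alpha>) * t * gegenbauer \<alpha> (Suc n) t - (real n + 2 * \<alpha>) * gegenbauer \<alpha> n t)
       / (real n + 2)"

text \<open>The polynomials \<open>P\<^sub>l\<^sup>m\<close>, as functions on \<open>[-1,1]\<close> (the only arguments used).\<close>

definition sphere_poly :: "nat \<Rightarrow> nat \<Rightarrow> real \<Rightarrow> real" where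
  "sphere_poly m l t =
     (if m = 1 then (if l = 0 then 1 else 2 / real l * cos (real l * arccos t))
      else gegenbauer ((real m - 1) / 2) l t)"

lemma sphere_poly_circle:
  assumes "l \<ge> 1"
  shows "sphere_poly 1 l (cos \<theta>) = 2 / real l * cos (real l * \<theta>)"
proof -
  have "cos (arccos (cos \<theta>)) = cos \<theta>"
    by (simp add: cos_arccos)
  then obtain i where "i \<in> \<int>" and i: "arccos (cos \<theta>) = \<theta> + 2 * i * pi \<or> arccos (cos \<theta>) = - \<theta> + 2 * i * pi"
    unfolding cos_eq by blast
  from i have *: "real l * arccos (cos \<theta>) = real l * \<theta> + 2 * (real l * i) * pi \<or>
      real l * arccos (cos \<theta>) = - (real l * \<theta>) + 2 * (real l * i) * pi"
    by (elim disjE; simp only:) (simp_all add: algebra_simps)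
  have "real l * i \<in> \<int>"
    using \<open>i \<in> \<int>\<close> by simp
  with * have "cos (real l * arccos (cos \<theta>)) = cos (real l * \<theta>)"
    unfolding cos_eq by blast
  then show ?thesis
    using assms by (simp add: sphere_poly_def)
qed

lemma gegenbauer_at_1: "gegenbauer ((real p + 1) / 2) l 1 = real ((l + p) choose l)"
proof (induction "(real p + 1) / 2" l "1::real" rule: gegenbauer.induct)
  case (3 n)
  let ?B = "\<lambda>k. real ((k + p) choose k)"
  have step: "(real k + 1) * ?B (Suc k) = (real k + 1 + real p) * ?B k" for k
  proof -
    have "real (Suc k * (Suc (k + p) choose Suc k)) = real (Suc (k + p) * ((k + p) choose k))"
      by (simp only: Suc_times_binomial)
    then show ?thesis
      by (simp add: algebra_simps)
  qed
  have "(real n + 2) * ?B (Suc (Suc n)) = (real n + 2 + real p) * ?B (Suc n)"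
    using step[of "Suc n"] by (simp add: algebra_simps)
  also have "\<dots> = (2 * real n + 3 + real p) * ?B (Suc n) - (real n + 1) * ?B (Suc n)"
    by (simp add: algebra_simps)
  also have "\<dots> = (2 * real n + 3 + real p) * ?B (Suc n) - (real n + 1 + real p) * ?B n"
    by (simp only: step)
  finally have "?B (Suc (Suc n)) =
      ((2 * real n + 3 + real p) * ?B (Suc n) - (real n + 1 + real p) * ?B n) / (real n + 2)"
    by (simp add: field_simps)
  then show ?case
    using 3 by (simp add: field_simps)
qed simp_all

lemma sphere_poly_at_1:
  assumes "m \<ge> 2"
  shows "sphere_poly m l 1 = real ((l + m - 2) choose l)"
proof -
  obtain p where "m = p + 2"
    using assms by (metis add.commute le_Suc_ex)
  then show ?thesis
    using gegenbauer_at_1[of p l] by (simp add: sphere_poly_def add.commute)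
qed

text \<open>The array \<open>a\<close> is the array of coefficients of \<open>f\<close> in its series representation on
  \<open>S\<^sup>1 \<times> S\<^sup>m\<close>; such an array is determined by \<open>f\<close>.  As \<open>\<bar>P\<^sub>l\<^sup>m t\<bar> \<le> P\<^sub>l\<^sup>m 1\<close> on \<open>[-1,1]\<close>,
  the double series converge absolutely, so unordered sums lose nothing.\<close>

definition series_coeffs :: "nat \<Rightarrow> (real \<times> real \<Rightarrow> real) \<Rightarrow> (nat \<Rightarrow> nat \<Rightarrow> real) \<Rightarrow> bool" where
  "series_coeffs m f a \<longleftrightarrow>
     (\<forall>k l. a k l \<ge> 0) \<and>
     (\<lambda>(k, l). a k l * sphere_poly 1 k 1 * sphere_poly m l 1) summable_on UNIV \<and>
     (\<forall>t\<in>{-1..1}. \<forall>s\<in>{-1..1}.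
        ((\<lambda>(k, l). a k l * sphere_poly 1 k t * sphere_poly m l s) has_sum f (t, s)) UNIV)"

definition pos_indices :: "(nat \<Rightarrow> nat \<Rightarrow> real) \<Rightarrow> nat \<Rightarrow> nat set" where
  "pos_indices a k = {l. a k l > 0}"

definition meets_every_progression :: "int set \<Rightarrow> bool" where
  "meets_every_progression A \<longleftrightarrow>
     (\<forall>n\<ge>1. \<forall>j\<in>{0..n-1}. A \<inter> {n * i + j |i. True} \<noteq> {})"

end

theory Submission
  imports Defs "HOL-Probability.Probability"
begin

text \<open>
  The quadratic form of the kernel is a combination, with nonnegative coefficients \<open>a k l\<close>, of the
  forms of \<open>cos (k (\<theta> - \<theta>')) P\<^sub>l (z \<bullet> z')\<close>, which are all nonnegative. A vanishing form therefore
  vanishes for every \<open>(k, l)\<close> with \<open>a k l > 0\<close>. As \<open>P\<^sub>l (s) / P\<^sub>l (1) \<rightarrow> 0\<close> for \<open>\<bar>s\<bar> < 1\<close>, for large \<open>l\<close> the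
  matrix \<open>P\<^sub>l (z \<bullet> z')\<close>, taken over the antipodal classes of the points, is strictly diagonally
  dominant, so for each class and each parity of \<open>l\<close> an exponential sum
  \<open>\<Sum> \<plusminus> c\<^sub>\<mu> exp (\<i> k \<theta>\<^sub>\<mu>)\<close> vanishes exactly at all \<open>k\<close> in a set meeting every progression.
  Such a sum is identically zero: its values lie in a finitely generated domain, a nonzero value
  stays a unit in some finite quotient ring, and there the sum is periodic in \<open>k\<close>.
  (This replaces the Skolem--Mahler--Lech theorem.)

  Conversely, if \<open>n\<int> + j\<close> is missed for degrees \<open>l \<ge> \<gamma>\<close> of one parity, the product of the \<open>n\<close>-th roots of
  unity, weighted by \<open>cos (2\<pi>jp/n)\<close>, with equidistant points of a great circle, weighted by a cosine
  of frequency \<open>\<ge> \<gamma>\<close> of that parity, gives a vanishing form.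
\<close>

section \<open>Exponential sums\<close>

text \<open>The coefficients and bases of the exponential sums are arbitrary complex numbers,
  possibly transcendental, so finite quotients must first be built. This goes by adjoining one
  element at a time, and the property carried along asks only for a nonzero finite ring, not for a
  field. Both parities enter because a single degree cannot tell \<open>z\<close> from
  \<open>- z\<close>: each class gives one sum per parity, with signs for odd degrees, and the two
  sums together separate the antipodes. The two analytic inputs, nonnegativity of the forms and
  decay of the normalized polynomials, come from one rotation invariant probability measure on the
  sphere. Its moment recursion is integration by parts against the Gegenbauer weight; with the
  differential equation it yields orthogonality, norms and a reproducing formula that turns each
  form into a mean of squares, so no basis of spherical harmonics is chosen. In the converse the
  cosine weight works because on a great circle a zonal polynomial of degree \<open>l\<close> is a
  cosine sum with frequencies at most \<open>l\<close> and of its parity.\<close>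

definition subring_set :: "'a::comm_ring_1 set \<Rightarrow> bool" where
  "subring_set A \<longleftrightarrow> 1 \<in> A \<and> (\<forall>x\<in>A. \<forall>y\<in>A. x - y \<in> A \<and> x * y \<in> A)"

text \<open>Rings and ideals are subsets of one ambient type, because the induction enlarges a ring
  by elements of a fixed domain and every ring on the way must live there.\<close>

definition ideal_of :: "'a::comm_ring_1 set \<Rightarrow> 'a set \<Rightarrow> bool" where
  "ideal_of A I \<longleftrightarrow> I \<subseteq> A \<and> 0 \<in> I \<and> (\<forall>x\<in>I. \<forall>y\<in>I. x - y \<in> I) \<and> (\<forall>a\<in>A. \<forall>x\<in>I. a * x \<in> I)"

text \<open>Finiteness of the quotient ring, expressed by representatives so that no quotient type
  is formed.\<close>

definition finite_index :: "'a::comm_ring_1 set \<Rightarrow> 'a set \<Rightarrow> bool" where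
  "finite_index A I \<longleftrightarrow> (\<exists>F. finite F \<and> F \<subseteq> A \<and> (\<forall>x\<in>A. \<exists>r\<in>F. x - r \<in> I))"

definition polys_over :: "'a::comm_ring_1 set \<Rightarrow> 'a poly set" where
  "polys_over A = {p. \<forall>i. coeff p i \<in> A}"

definition simple_ext :: "'a::comm_ring_1 set \<Rightarrow> 'a \<Rightarrow> 'a set" where
  "simple_ext A t = (\<lambda>p. poly p t) ` polys_over A"

text \<open>Every nonzero \<open>b\<close> becomes a unit in some finite quotient other than the
  zero ring. Finitely generated domains even allow fields as quotients; leaving \<open>I\<close>
  arbitrary lets the induction write down its ideals by generators.\<close>

definition finite_specializations :: "'a::comm_ring_1 set \<Rightarrow> bool" where
  "finite_specializations A \<longleftrightarrow> (\<forall>b\<in>A. b \<noteq> 0 \<longrightarrow>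
     (\<exists>I. ideal_of A I \<and> finite_index A I \<and> 1 \<notin> I \<and> (\<exists>c\<in>A. b * c - 1 \<in> I)))"

lemma subring_setD:
  assumes "subring_set A"
  shows "1 \<in> A" "0 \<in> A" "\<And>x y. x \<in> A \<Longrightarrow> y \<in> A \<Longrightarrow> x - y \<in> A"
    "\<And>x y. x \<in> A \<Longrightarrow> y \<in> A \<Longrightarrow> x * y \<in> A" "\<And>x. x \<in> A \<Longrightarrow> - x \<in> A"
    "\<And>x y. x \<in> A \<Longrightarrow> y \<in> A \<Longrightarrow> x + y \<in> A"
proof -
  show one: "1 \<in> A" and diff: "\<And>x y. x \<in> A \<Longrightarrow> y \<in> A \<Longrightarrow> x - y \<in> A"
    and "\<And>x y. x \<in> A \<Longrightarrow> y \<in> A \<Longrightarrow> x * y \<in> A"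
    using assms by (auto simp: subring_set_def)
  show zero: "0 \<in> A" using diff[OF one one] by simp
  show neg: "- x \<in> A" if "x \<in> A" for x using diff[OF zero that] by simp
  show "x + y \<in> A" if "x \<in> A" "y \<in> A" for x y using diff[OF that(1) neg[OF that(2)]] by simp
qed

lemma ideal_ofD:
  assumes "ideal_of A I"
  shows "\<And>x. x \<in> I \<Longrightarrow> x \<in> A" "0 \<in> I" "\<And>x y. x \<in> I \<Longrightarrow> y \<in> I \<Longrightarrow> x - y \<in> I"
    "\<And>a x. a \<in> A \<Longrightarrow> x \<in> I \<Longrightarrow> a * x \<in> I" "\<And>a x. a \<in> A \<Longrightarrow> x \<in> I \<Longrightarrow> x * a \<in> I"
    "\<And>x. x \<in> I \<Longrightarrow> - x \<in> I" "\<And>x y. x \<in> I \<Longrightarrow> y \<in> I \<Longrightarrow> x + y \<in> I"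
proof -
  show "\<And>x. x \<in> I \<Longrightarrow> x \<in> A" and zero: "0 \<in> I" and diff: "\<And>x y. x \<in> I \<Longrightarrow> y \<in> I \<Longrightarrow> x - y \<in> I"
    and "\<And>a x. a \<in> A \<Longrightarrow> x \<in> I \<Longrightarrow> a * x \<in> I" and "\<And>a x. a \<in> A \<Longrightarrow> x \<in> I \<Longrightarrow> x * a \<in> I"
    using assms by (auto simp: ideal_of_def mult.commute)
  show neg: "- x \<in> I" if "x \<in> I" for x using diff[OF zero that] by simp
  show "x + y \<in> I" if "x \<in> I" "y \<in> I" for x y using diff[OF that(1) neg[OF that(2)]] by simp
qed

lemma ideal_of_sum:
  assumes "ideal_of A I" "\<And>i. i \<in> S \<Longrightarrow> f i \<in> I"
  shows "sum f S \<in> I"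
  using assms(2) by (induction S rule: infinite_finite_induct) (auto intro: ideal_ofD[OF assms(1)])

lemma ideal_of_self: "subring_set A \<Longrightarrow> ideal_of A A"
  by (auto simp: ideal_of_def intro: subring_setD)

lemmas subring_sum = ideal_of_sum[OF ideal_of_self]

lemma subring_power: "subring_set A \<Longrightarrow> x \<in> A \<Longrightarrow> x ^ n \<in> A"
  by (induction n) (auto intro: subring_setD)

section \<open>Polynomials over subrings and ideals, and division\<close>

lemma polys_over_mult:
  assumes "subring_set A" "ideal_of A I" "p \<in> polys_over A" "q \<in> polys_over I"
  shows "p * q \<in> polys_over I"
  using assms by (auto simp: polys_over_def coeff_mult intro!: ideal_of_sum[OF assms(2)] ideal_ofD(4)[OF assms(2)])

text \<open>Phrased for ideals so that a ring, taken as an ideal of itself, inherits the same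
  closure facts for its polynomials.\<close>

lemma polys_over_ideal:
  assumes "ideal_of A I"
  shows "0 \<in> polys_over I" "\<And>p q. p \<in> polys_over I \<Longrightarrow> q \<in> polys_over I \<Longrightarrow> p - q \<in> polys_over I"
    "\<And>p q. p \<in> polys_over I \<Longrightarrow> q \<in> polys_over I \<Longrightarrow> p + q \<in> polys_over I"
    "\<And>p. p \<in> polys_over I \<Longrightarrow> - p \<in> polys_over I"
    "\<And>a n. a \<in> I \<Longrightarrow> monom a n \<in> polys_over I"
    "\<And>a p. a \<in> I \<Longrightarrow> p \<in> polys_over I \<Longrightarrow> pCons a p \<in> polys_over I"
    "\<And>a p. a \<in> A \<Longrightarrow> p \<in> polys_over I \<Longrightarrow> smult a p \<in> polys_over I"
  by (auto simp: polys_over_def coeff_pCons intro: ideal_ofD[OF assms] split: nat.split)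

lemmas polys_over_subring = polys_over_ideal[OF ideal_of_self]

lemma polys_over_mono: "A \<subseteq> B \<Longrightarrow> polys_over A \<subseteq> polys_over B"
  by (auto simp: polys_over_def)

lemma subring_simple_ext:
  assumes "subring_set A"
  shows "subring_set (simple_ext A t)"
  unfolding subring_set_def
proof (intro conjI ballI)
  have "[:1:] \<in> polys_over A"
    by (intro polys_over_subring assms subring_setD)
  then show "1 \<in> simple_ext A t" unfolding simple_ext_def by force
next
  fix x y assume "x \<in> simple_ext A t" "y \<in> simple_ext A t"
  then obtain p q where pq: "p \<in> polys_over A" "q \<in> polys_over A" "x = poly p t" "y = poly q t"
    by (auto simp: simple_ext_def)
  have "x - y = poly (p - q) t" "x * y = poly (p * q) t" using pq by simp_all
  moreover have "p - q \<in> polys_over A" "p * q \<in> polys_over A"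
    using pq polys_over_subring(2)[OF assms] polys_over_mult[OF assms ideal_of_self[OF assms]] by auto
  ultimately show "x - y \<in> simple_ext A t" "x * y \<in> simple_ext A t"
    unfolding simple_ext_def by (metis imageI)+
qed

lemma simple_ext_supset:
  assumes "subring_set A"
  shows "A \<subseteq> simple_ext A t" "t \<in> simple_ext A t"
proof -
  have "[:a:] \<in> polys_over A" if "a \<in> A" for a
    using that by (intro polys_over_subring assms)
  then show "A \<subseteq> simple_ext A t" by (force simp: simple_ext_def)
  have "[:0, 1:] \<in> polys_over A" by (intro polys_over_subring assms subring_setD)
  then show "t \<in> simple_ext A t" by (force simp: simple_ext_def)
qed

text \<open>Modulo \<open>I\<close> the leading coefficient of \<open>h\<close> has the inverse
  \<open>e\<close>, so \<open>h\<close> divides like a monic polynomial.\<close>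

lemma division_mod_ideal:
  fixes h :: "'a::comm_ring_1 poly"
  assumes A: "subring_set A" and I: "ideal_of A I" and h: "h \<in> polys_over A" and n: "degree h \<ge> 1"
    and e: "e \<in> A" "lead_coeff h * e - 1 \<in> I" and r: "r \<in> polys_over A"
  shows "\<exists>q\<in>polys_over A. \<exists>s\<in>polys_over A. degree s < degree h \<and> r - h * q - s \<in> polys_over I"
proof -
  have "\<forall>r\<in>polys_over A. degree r < N \<longrightarrow>
     (\<exists>q\<in>polys_over A. \<exists>s\<in>polys_over A. degree s < degree h \<and> r - h * q - s \<in> polys_over I)" for N
  proof (induction N)
    case (Suc N)
    show ?case
    proof (intro ballI impI)
      fix r assume r: "r \<in> polys_over A" "degree r < Suc N"
      show "\<exists>q\<in>polys_over A. \<exists>s\<in>polys_over A. degree s < degree h \<and> r - h * q - s \<in> polys_over I"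
      proof (cases "degree r < degree h")
        case True
        then show ?thesis using r polys_over_subring(1)[OF A] polys_over_ideal(1)[OF I]
          by (intro bexI[of _ 0] bexI[of _ r]) auto
      next
        case False
        define d where "d = degree r"
        have d: "degree h \<le> d" "1 \<le> d" using False n by (auto simp: d_def)
        define q0 where "q0 = monom (e * coeff r d) (d - degree h)"
        have q0: "q0 \<in> polys_over A" unfolding q0_def
          using r e by (intro polys_over_subring A subring_setD) (auto simp: polys_over_def)
        have hq0: "h * q0 \<in> polys_over A"
          using polys_over_mult[OF A ideal_of_self[OF A]] h q0 by blast
        define r1 where "r1 = r - h * q0"
        have r1: "r1 \<in> polys_over A" unfolding r1_def by (intro polys_over_subring A r hq0)
        have "degree q0 \<le> d - degree h" by (simp add: q0_def degree_monom_le)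
        then have "degree (h * q0) \<le> d" using degree_mult_le[of h q0] d by linarith
        then have deg1: "degree r1 \<le> d" unfolding r1_def by (intro degree_diff_le) (auto simp: d_def)
        have "coeff (h * q0) d = lead_coeff h * (e * coeff r d)"
          using d coeff_monom_mult[of "e * coeff r d" "d - degree h" h d]
          by (simp add: q0_def mult.commute)
        then have "coeff r1 d = - ((lead_coeff h * e - 1) * coeff r d)"
          by (simp add: r1_def algebra_simps)
        then have c1: "coeff r1 d \<in> I"
          using r e by (auto intro!: ideal_ofD(5,6)[OF I] simp: polys_over_def)
        \<comment> \<open>Subtracting \<open>h * q0\<close> only moves the top coefficient into
          \<open>I\<close>. Removing that monomial by hand lowers the degree and changes the result
          by a polynomial over \<open>I\<close>.\<close>
        define r2 where "r2 = r1 - monom (coeff r1 d) d"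
        have r2: "r2 \<in> polys_over A" unfolding r2_def
          using c1 ideal_ofD(1)[OF I] by (intro polys_over_subring A r1)
        have "coeff r2 i = 0" if "i \<ge> d" for i
          using that deg1 coeff_eq_0[of r1 i] by (cases "i = d") (auto simp: r2_def)
        then have "degree r2 < d" using d by (metis degree_0 leading_coeff_0_iff linorder_not_less less_le_trans zero_less_one)
        then have "degree r2 < N" using r by (simp add: d_def)
        with Suc r2 obtain q s where qs: "q \<in> polys_over A" "s \<in> polys_over A" "degree s < degree h"
          "r2 - h * q - s \<in> polys_over I" by blast
        have "r - h * (q0 + q) - s = (r2 - h * q - s) + monom (coeff r1 d) d"
          by (simp add: r2_def r1_def algebra_simps)
        then have "r - h * (q0 + q) - s \<in> polys_over I"
          using qs c1 by (simp only:) (intro polys_over_ideal(3,5)[OF I])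
        moreover have "q0 + q \<in> polys_over A" by (intro polys_over_subring A q0 qs)
        ultimately show ?thesis using qs by blast
      qed
    qed
  qed simp
  then show ?thesis using r by blast
qed

text \<open>Powers of the leading coefficient stand in for its inverse, one factor per reduction
  step. The alternative \<open>s = 0\<close> covers a constant \<open>h\<close>.\<close>

lemma pseudo_division_over:
  fixes h :: "'a::comm_ring_1 poly"
  assumes A: "subring_set A" and h: "h \<in> polys_over A" "h \<noteq> 0" and r: "r \<in> polys_over A"
  shows "\<exists>N. \<exists>q\<in>polys_over A. \<exists>s\<in>polys_over A. (s = 0 \<or> degree s < degree h) \<and>
     smult (lead_coeff h ^ N) r = h * q + s"
proof -
  have "\<forall>r\<in>polys_over A. (r = 0 \<or> degree r < M) \<longrightarrow>
     (\<exists>N. \<exists>q\<in>polys_over A. \<exists>s\<in>polys_over A. (s = 0 \<or> degree s < degree h) \<and>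
        smult (lead_coeff h ^ N) r = h * q + s)" for M
  proof (induction M)
    case 0
    then show ?case using polys_over_subring(1)[OF A]
      by (auto intro!: bexI[of _ 0])
  next
    case (Suc M)
    show ?case
    proof (intro ballI impI)
      fix r assume r: "r \<in> polys_over A" "r = 0 \<or> degree r < Suc M"
      show "\<exists>N. \<exists>q\<in>polys_over A. \<exists>s\<in>polys_over A. (s = 0 \<or> degree s < degree h) \<and>
        smult (lead_coeff h ^ N) r = h * q + s"
      proof (cases "r = 0 \<or> degree r < degree h")
        case True
        then show ?thesis using r polys_over_subring(1)[OF A]
          by (intro exI[of _ 0] bexI[of _ 0] bexI[of _ r]) auto
      next
        case False
        define d where "d = degree r"
        have d: "degree h \<le> d" using False by (auto simp: d_def)
        define q0 where "q0 = monom (coeff r d) (d - degree h)"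
        have q0: "q0 \<in> polys_over A" unfolding q0_def
          using r by (intro polys_over_subring A subring_setD) (auto simp: polys_over_def)
        have hq0: "h * q0 \<in> polys_over A"
          using polys_over_mult[OF A ideal_of_self[OF A]] h q0 by blast
        have lh: "lead_coeff h \<in> A" using h by (auto simp: polys_over_def)
        define r1 where "r1 = smult (lead_coeff h) r - h * q0"
        have r1: "r1 \<in> polys_over A" unfolding r1_def by (intro polys_over_subring A r hq0 lh)
        have "degree q0 \<le> d - degree h" by (simp add: q0_def degree_monom_le)
        then have "degree (h * q0) \<le> d" using degree_mult_le[of h q0] d by linarith
        then have deg1: "degree r1 \<le> d" unfolding r1_def
          using degree_smult_le[of "lead_coeff h" r] by (intro degree_diff_le) (auto simp: d_def)
        have "coeff (h * q0) d = lead_coeff h * coeff r d"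
          using d coeff_monom_mult[of "coeff r d" "d - degree h" h d]
          by (simp add: q0_def mult.commute)
        then have "coeff r1 d = 0" by (simp add: r1_def)
        then have "r1 = 0 \<or> degree r1 < d"
          using deg1 by (metis leading_coeff_0_iff le_neq_implies_less)
        then have "r1 = 0 \<or> degree r1 < M" using r False by (auto simp: d_def)
        with Suc r1 obtain N q s where qs: "q \<in> polys_over A" "s \<in> polys_over A" "s = 0 \<or> degree s < degree h"
          "smult (lead_coeff h ^ N) r1 = h * q + s" by blast
        have "smult (lead_coeff h ^ Suc N) r = h * (q + smult (lead_coeff h ^ N) q0) + s"
          using qs(4) by (simp add: r1_def algebra_simps smult_diff_right)
        moreover have "q + smult (lead_coeff h ^ N) q0 \<in> polys_over A"
          by (intro polys_over_subring A q0 qs subring_power lh)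
        ultimately show ?thesis using qs by blast
      qed
    qed
  qed
  then show ?thesis using r by blast
qed

text \<open>Modulo \<open>I\<close>, a nonzero multiple of a polynomial of positive degree with
  invertible leading coefficient has positive degree as well. This later keeps 1 out of the extended
  ideal.\<close>

lemma constant_multiple_mod_ideal:
  fixes h :: "'a::comm_ring_1 poly"
  assumes A: "subring_set A" and I: "ideal_of A I" and h: "h \<in> polys_over A" and n: "degree h \<ge> 1"
    and e: "e \<in> A" "lead_coeff h * e - 1 \<in> I" and q: "q \<in> polys_over A"
    and w: "[:w:] - h * q \<in> polys_over I"
  shows "w \<in> I"
proof -
  have "q \<in> polys_over I"
  proof (rule ccontr)
    assume "q \<notin> polys_over I"
    define D where "D = {i. coeff q i \<notin> I}"
    have D: "D \<noteq> {}" using \<open>q \<notin> polys_over I\<close> by (auto simp: D_def polys_over_def)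
    have "D \<subseteq> {..degree q}" using ideal_ofD(2)[OF I] by (auto simp: D_def) (metis coeff_eq_0 not_le)
    then have fin: "finite D" using finite_subset by blast
    define d where "d = Max D"
    have dD: "d \<in> D" and dmax: "\<And>i. i > d \<Longrightarrow> coeff q i \<in> I"
      using Max_in[OF fin D] Max_ge[OF fin] by (force simp: d_def D_def)+
    \<comment> \<open>In this degree every product other than
      \<open>lead_coeff h * coeff q d\<close> contains a coefficient of \<open>q\<close> beyond
      \<open>d\<close>, which lies in \<open>I\<close>, or a coefficient of \<open>h\<close> beyond
      its degree.\<close>
    have "coeff (h * q) (degree h + d) =
       (\<Sum>i\<in>{..degree h + d} - {degree h}. coeff h i * coeff q (degree h + d - i)) + lead_coeff h * coeff q d"
      unfolding coeff_mult by (subst sum.remove[of _ "degree h"]) auto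
    moreover have "(\<Sum>i\<in>{..degree h + d} - {degree h}. coeff h i * coeff q (degree h + d - i)) \<in> I"
    proof (rule ideal_of_sum[OF I])
      fix i assume i: "i \<in> {..degree h + d} - {degree h}"
      show "coeff h i * coeff q (degree h + d - i) \<in> I"
      proof (cases "i < degree h")
        case True
        then show ?thesis using h by (intro ideal_ofD(4)[OF I] dmax) (auto simp: polys_over_def)
      next
        case False
        then show ?thesis using i ideal_ofD(2)[OF I] by (simp add: coeff_eq_0)
      qed
    qed
    moreover have "coeff (h * q) (degree h + d) \<in> I"
    proof -
      have "coeff ([:w:] - h * q) (degree h + d) \<in> I" using w by (auto simp: polys_over_def)
      then have "- coeff (h * q) (degree h + d) \<in> I" using n by (simp add: coeff_pCons split: nat.splits)
      then show ?thesis using ideal_ofD(6)[OF I] by fastforce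
    qed
    ultimately have "lead_coeff h * coeff q d \<in> I" using ideal_ofD(3)[OF I]
      by (metis add_diff_cancel_left')
    then have "e * (lead_coeff h * coeff q d) \<in> I" by (rule ideal_ofD(4)[OF I e(1)])
    moreover have "(lead_coeff h * e - 1) * coeff q d \<in> I"
      using e q by (intro ideal_ofD(5)[OF I]) (auto simp: polys_over_def)
    ultimately have "e * (lead_coeff h * coeff q d) - (lead_coeff h * e - 1) * coeff q d \<in> I"
      by (rule ideal_ofD(3)[OF I])
    then have "coeff q d \<in> I" by (simp add: algebra_simps)
    then show False using dD by (simp add: D_def)
  qed
  then have "[:w:] \<in> polys_over I"
    using polys_over_ideal(3)[OF I w polys_over_mult[OF A I h \<open>q \<in> polys_over I\<close>]] by simp
  then have "coeff [:w:] 0 \<in> I" unfolding polys_over_def by blast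
  then show ?thesis by simp
qed

text \<open>The quotient by the ideal generated by \<open>I\<close> and the value of
  \<open>h\<close> is modelled on (A/I)[X]/(h), finite because \<open>h\<close> is monic up to a
  unit. Condition \<open>ker\<close> says that the relations satisfied by \<open>t\<close> follow
  from \<open>h\<close> up to a factor invertible modulo \<open>I\<close>, which prevents collapse.
  It holds for a transcendental \<open>t\<close>, which satisfies no nonzero relation, and for an
  algebraic \<open>t\<close> with \<open>h\<close> of minimal degree.\<close>

lemma ideal_extension:
  fixes h :: "'a::comm_ring_1 poly"
  assumes A: "subring_set A" and I: "ideal_of A I" "finite_index A I" "1 \<notin> I"
    and h: "h \<in> polys_over A" and n: "degree h \<ge> 1"
    and e: "e \<in> A" "lead_coeff h * e - 1 \<in> I"
    and ker: "\<And>r. r \<in> polys_over A \<Longrightarrow> poly r t = 0 \<Longrightarrow>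
      \<exists>w\<in>A. (\<exists>w'\<in>A. w * w' - 1 \<in> I) \<and> (\<exists>q\<in>polys_over A. smult w r = h * q)"
  shows "\<exists>J. ideal_of (simple_ext A t) J \<and> finite_index (simple_ext A t) J \<and> 1 \<notin> J \<and> I \<subseteq> J \<and> poly h t \<in> J"
proof -
  define J where "J = {poly (r + h * q) t | r q. r \<in> polys_over I \<and> q \<in> polys_over A}"
  have IA: "polys_over I \<subseteq> polys_over A" using ideal_ofD(1)[OF I(1)] by (intro polys_over_mono) auto
  note over = polys_over_subring[OF A] polys_over_ideal[OF I(1)]
  note mult = polys_over_mult[OF A I(1)] polys_over_mult[OF A ideal_of_self[OF A]]
  have JI: "poly (r + h * q) t \<in> J" if "r \<in> polys_over I" "q \<in> polys_over A" for r q
    using that by (auto simp: J_def)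
  have "ideal_of (simple_ext A t) J"
    unfolding ideal_of_def
  proof (intro conjI ballI subsetI)
    fix x assume "x \<in> J"
    then obtain r q where "r \<in> polys_over I" "q \<in> polys_over A" "x = poly (r + h * q) t"
      by (auto simp: J_def)
    moreover from this have "r + h * q \<in> polys_over A" using IA mult(2)[OF h] by (intro over) auto
    ultimately show "x \<in> simple_ext A t" unfolding simple_ext_def by (metis imageI)
  next
    show "0 \<in> J" using JI[of 0 0] over(1) polys_over_ideal(1)[OF I(1)] by simp
  next
    fix x y assume "x \<in> J" "y \<in> J"
    then obtain r q r' q' where *: "r \<in> polys_over I" "q \<in> polys_over A" "x = poly (r + h * q) t"
      "r' \<in> polys_over I" "q' \<in> polys_over A" "y = poly (r' + h * q') t"
      by (auto simp: J_def)
    have "x - y = poly ((r - r') + h * (q - q')) t" using * by (simp add: algebra_simps)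
    then show "x - y \<in> J" using * by (simp only:) (intro JI over)
  next
    fix a x assume "a \<in> simple_ext A t" "x \<in> J"
    then obtain r q p where *: "r \<in> polys_over I" "q \<in> polys_over A" "x = poly (r + h * q) t"
      "p \<in> polys_over A" "a = poly p t" by (auto simp: J_def simple_ext_def)
    have "a * x = poly (p * r + h * (p * q)) t" using * by (simp add: algebra_simps)
    then show "a * x \<in> J" using * by (simp only:) (intro JI mult)
  qed
  moreover have "finite_index (simple_ext A t) J"
  proof -
    obtain F where F: "finite F" "F \<subseteq> A" "\<And>x. x \<in> A \<Longrightarrow> \<exists>r\<in>F. x - r \<in> I"
      using I(2) by (auto simp: finite_index_def)
    obtain \<rho> where \<rho>: "\<And>x. x \<in> A \<Longrightarrow> \<rho> x \<in> F \<and> x - \<rho> x \<in> I" using F(3) by metis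
    \<comment> \<open>Remainders modulo \<open>h\<close> with coefficients replaced by
      representatives: finitely many lists of length \<open>degree h\<close>.\<close>
    define G where "G = (\<lambda>xs. poly (Poly xs) t) ` {xs. set xs \<subseteq> F \<and> length xs = degree h}"
    have "finite G" unfolding G_def using finite_lists_length_eq[OF F(1)] by blast
    moreover have "G \<subseteq> simple_ext A t"
    proof -
      have "Poly xs \<in> polys_over A" if "set xs \<subseteq> F" for xs
        using that F(2) subring_setD(2)[OF A] nth_mem
        by (fastforce simp: polys_over_def nth_default_def)
      then show ?thesis by (auto simp: G_def simple_ext_def)
    qed
    moreover have "\<exists>r\<in>G. x - r \<in> J" if x: "x \<in> simple_ext A t" for x
    proof -
      obtain p where p: "p \<in> polys_over A" "x = poly p t" using x unfolding simple_ext_def by blast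
      obtain q s where qs: "q \<in> polys_over A" "s \<in> polys_over A" "degree s < degree h"
        "p - h * q - s \<in> polys_over I"
        using division_mod_ideal[OF A I(1) h n e p(1)] by blast
      define xs where "xs = map (\<lambda>i. \<rho> (coeff s i)) [0..<degree h]"
      have "\<rho> (coeff s i) \<in> F" for i using qs(2) \<rho> by (auto simp: polys_over_def)
      then have xs: "set xs \<subseteq> F" "length xs = degree h" by (auto simp: xs_def)
      have "s - Poly xs \<in> polys_over I"
      proof -
        have "coeff s i - coeff (Poly xs) i \<in> I" for i
        proof (cases "i < degree h")
          case True
          then show ?thesis using qs(2) \<rho> by (auto simp: polys_over_def xs_def nth_default_def)
        next
          case False
          then show ?thesis using qs(3) ideal_ofD(2)[OF I(1)] xs by (auto simp: nth_default_def coeff_eq_0)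
        qed
        then show ?thesis by (simp add: polys_over_def)
      qed
      then have "(p - h * q - s) + (s - Poly xs) \<in> polys_over I"
        using qs by (intro polys_over_ideal(3)[OF I(1)])
      from JI[OF this qs(1)] have "x - poly (Poly xs) t \<in> J" using p by simp
      then show ?thesis using xs by (auto simp: G_def)
    qed
    ultimately show ?thesis unfolding finite_index_def by blast
  qed
  moreover have "1 \<notin> J"
  proof
    assume "1 \<in> J"
    then obtain r q where rq: "r \<in> polys_over I" "q \<in> polys_over A" "1 = poly (r + h * q) t"
      by (auto simp: J_def)
    have "[:1:] - (r + h * q) \<in> polys_over A"
      using IA rq(1) mult(2)[OF h rq(2)] subring_setD(1)[OF A] by (intro over) auto
    moreover have "poly ([:1:] - (r + h * q)) t = 0" using rq by simp
    ultimately obtain w w' q' where w: "w \<in> A" "w' \<in> A" "w * w' - 1 \<in> I" "q' \<in> polys_over A"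
      "smult w ([:1:] - (r + h * q)) = h * q'" using ker by meson
    \<comment> \<open>The relation from \<open>ker\<close> makes the constant \<open>w\<close> a
      multiple of \<open>h\<close> modulo \<open>I\<close>. This forces \<open>w \<in> I\<close>,
      although \<open>w\<close> is invertible there.\<close>
    have "[:w:] - h * (q' + smult w q) = smult w r"
      using w(5) by (simp add: algebra_simps smult_diff_right smult_add_right)
    then have "[:w:] - h * (q' + smult w q) \<in> polys_over I" using w(1) rq by (simp only:) (intro over)
    moreover have "q' + smult w q \<in> polys_over A" using w rq by (intro over)
    ultimately have "w \<in> I" using constant_multiple_mod_ideal[OF A I(1) h n e] by blast
    then have "w * w' - (w * w' - 1) \<in> I"
      using ideal_ofD(3)[OF I(1) ideal_ofD(5)[OF I(1) w(2)] w(3)] by blast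
    then show False using I(3) by simp
  qed
  moreover have "I \<subseteq> J"
  proof
    fix x assume "x \<in> I"
    then have "poly ([:x:] + h * 0) t \<in> J" by (intro JI over)
    then show "x \<in> J" by simp
  qed
  moreover have "poly (0 + h * [:1:]) t \<in> J" using subring_setD(1)[OF A] by (intro JI over)
  then have "poly h t \<in> J" by simp
  ultimately show ?thesis by blast
qed

text \<open>A Euclidean argument in place of a norm: among the polynomials whose value at
  \<open>t\<close> is a nonzero multiple of \<open>b\<close>, one of least degree is constant.
  Dividing it by \<open>h\<close> shows that its degree is below that of \<open>h\<close>; dividing
  \<open>h\<close> by it leaves remainder 0, and the cofactor inherits the root \<open>t\<close>, so
  by minimality of \<open>h\<close> it takes up the whole degree.\<close>

lemma algebraic_multiple_in_base:
  fixes h :: "'a::idom poly"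
  assumes A: "subring_set A" and h: "h \<in> polys_over A" "h \<noteq> 0" "poly h t = 0"
    and hmin: "\<And>p. p \<in> polys_over A \<Longrightarrow> p \<noteq> 0 \<Longrightarrow> poly p t = 0 \<Longrightarrow> degree h \<le> degree p"
    and b: "b \<in> simple_ext A t" "b \<noteq> 0"
  shows "\<exists>e\<in>A. e \<noteq> 0 \<and> (\<exists>u\<in>simple_ext A t. e = u * b)"
proof -
  define S where "S = {s \<in> polys_over A. poly s t \<noteq> 0 \<and> (\<exists>u\<in>simple_ext A t. poly s t = u * b)}"
  note B = subring_simple_ext[OF A, of t]
  obtain \<beta> where "\<beta> \<in> polys_over A" "b = poly \<beta> t" using b by (auto simp: simple_ext_def)
  then have "\<beta> \<in> S" using b subring_setD(1)[OF B] by (auto simp: S_def intro!: bexI[of _ 1])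
  then obtain s where s: "s \<in> S" and smin: "\<And>s'. s' \<in> S \<Longrightarrow> degree s \<le> degree s'"
    using exists_least_iff[of "\<lambda>n. \<exists>s\<in>S. degree s = n"] by (metis not_less)
  have sA: "s \<in> polys_over A" and st: "poly s t \<noteq> 0" using s by (auto simp: S_def)
  obtain u where u: "u \<in> simple_ext A t" "poly s t = u * b" using s by (auto simp: S_def)
  have lead: "lead_coeff p ^ N \<in> A" if "p \<in> polys_over A" for p N
    using that by (intro subring_power A) (auto simp: polys_over_def)
  have "degree s < degree h"
  proof -
    obtain N q r where r: "q \<in> polys_over A" "r \<in> polys_over A" "r = 0 \<or> degree r < degree h"
      "smult (lead_coeff h ^ N) s = h * q + r"
      using pseudo_division_over[OF A h(1,2) sA] by blast
    have "poly (smult (lead_coeff h ^ N) s) t = poly r t" using r(4) h(3) by simp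
    then have rt: "poly r t = lead_coeff h ^ N * poly s t" by simp
    then have nz: "poly r t \<noteq> 0" using h st by simp
    moreover have "poly r t = (lead_coeff h ^ N * u) * b" using rt u by simp
    moreover have "lead_coeff h ^ N * u \<in> simple_ext A t"
      using u lead[OF h(1)] simple_ext_supset(1)[OF A] by (intro subring_setD(4)[OF B]) auto
    ultimately have "r \<in> S" using r by (auto simp: S_def)
    then show ?thesis using smin[of r] r(3) nz by force
  qed
  have "degree s = 0"
  proof (rule ccontr)
    assume pos: "degree s \<noteq> 0"
    then have s0: "s \<noteq> 0" by auto
    obtain N q r where r: "q \<in> polys_over A" "r \<in> polys_over A" "r = 0 \<or> degree r < degree s"
      "smult (lead_coeff s ^ N) h = s * q + r"
      using pseudo_division_over[OF A sA s0 h(1)] by blast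
    have "poly (smult (lead_coeff s ^ N) h) t = poly (s * q + r) t" using r(4) by simp
    then have "poly s t * poly q t + poly r t = 0" using h(3) by simp
    then have rt: "poly r t = - poly q t * u * b" using u by (simp add: eq_neg_iff_add_eq_0 algebra_simps)
    have "poly r t = 0"
    proof (rule ccontr)
      assume nz: "poly r t \<noteq> 0"
      have "- poly q t * u \<in> simple_ext A t" using r(1) u
        by (intro subring_setD[OF B]) (auto simp: simple_ext_def)
      then have "r \<in> S" using nz rt r(2) unfolding S_def by blast
      then show False using smin[of r] r(3) nz by force
    qed
    then have "r = 0" using hmin[OF r(2)] r(3) \<open>degree s < degree h\<close> by force
    then have qh: "smult (lead_coeff s ^ N) h = s * q" using r(4) by simp
    then have q0: "q \<noteq> 0" using h(2) s0 by auto
    have "poly (s * q) t = 0" using h(3) by (simp flip: qh)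
    then have "poly q t = 0" using st by simp
    then have "degree h \<le> degree q" using hmin r(1) q0 by blast
    moreover have "degree h = degree (s * q)" using s0 by (simp flip: qh)
    ultimately show False using pos s0 q0 by (simp add: degree_mult_eq)
  qed
  then obtain e where "s = [:e:]" by (meson degree_eq_zeroE)
  then have "e \<in> A" "e = poly s t" using sA by (auto simp: polys_over_def split: nat.splits dest: spec[of _ 0])
  then show ?thesis using st u by metis
qed

text \<open>For transcendental \<open>t\<close>, the leading coefficient of the polynomial
  representing \<open>b\<close> is made invertible. For algebraic \<open>t\<close>, \<open>b\<close>
  divides a nonzero element of the base ring, and that element is made invertible.\<close>

lemma finite_specializations_simple_ext:
  fixes A :: "'a::idom set"
  assumes A: "subring_set A" and Q: "finite_specializations A"
  shows "finite_specializations (simple_ext A t)"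
  unfolding finite_specializations_def
proof (intro ballI impI)
  fix b assume b: "b \<in> simple_ext A t" "b \<noteq> 0"
  note B = subring_simple_ext[OF A, of t]
  note AB = simple_ext_supset[OF A, of t]
  show "\<exists>J. ideal_of (simple_ext A t) J \<and> finite_index (simple_ext A t) J \<and> 1 \<notin> J \<and>
     (\<exists>c\<in>simple_ext A t. b * c - 1 \<in> J)"
  proof (cases "\<exists>p\<in>polys_over A. p \<noteq> 0 \<and> poly p t = 0")
    case False
    obtain \<beta> where \<beta>: "\<beta> \<in> polys_over A" "b = poly \<beta> t" using b by (auto simp: simple_ext_def)
    have "\<beta> \<noteq> 0" using \<beta> b by auto
    moreover have "lead_coeff \<beta> \<in> A" using \<beta> by (auto simp: polys_over_def)
    ultimately obtain I e where I: "ideal_of A I" "finite_index A I" "1 \<notin> I" "e \<in> A" "lead_coeff \<beta> * e - 1 \<in> I"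
      using Q unfolding finite_specializations_def by (metis leading_coeff_0_iff)
    \<comment> \<open>modulo \<open>h = 1 + X \<beta>\<close>, \<open>- t\<close> becomes an inverse of \<open>b\<close>\<close>
    define h where "h = pCons 1 \<beta>"
    have "h \<in> polys_over A" unfolding h_def using \<beta> subring_setD(1)[OF A] by (intro polys_over_subring A)
    moreover have "degree h \<ge> 1" "lead_coeff h = lead_coeff \<beta>" using \<open>\<beta> \<noteq> 0\<close> by (auto simp: h_def)
    moreover have "\<exists>w\<in>A. (\<exists>w'\<in>A. w * w' - 1 \<in> I) \<and> (\<exists>q\<in>polys_over A. smult w r = h * q)"
      if "r \<in> polys_over A" "poly r t = 0" for r
      using that False subring_setD(1)[OF A] ideal_ofD(2)[OF I(1)] polys_over_subring(1)[OF A]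
      by (intro bexI[of _ 1] conjI bexI[of _ 1] bexI[of _ 0]) auto
    ultimately obtain J where J: "ideal_of (simple_ext A t) J" "finite_index (simple_ext A t) J" "1 \<notin> J" "poly h t \<in> J"
      using ideal_extension[OF A I(1-3), of h e t] I(4,5) by auto
    have "b * (- t) - 1 = - poly h t" using \<beta> by (simp add: h_def)
    then have "b * (- t) - 1 \<in> J" using ideal_ofD(6)[OF J(1) J(4)] by simp
    moreover have "- t \<in> simple_ext A t" using AB(2) by (intro subring_setD[OF B])
    ultimately show ?thesis using J by blast
  next
    case True
    then obtain h where h: "h \<in> polys_over A" "h \<noteq> 0" "poly h t = 0"
      and hmin: "\<And>p. p \<in> polys_over A \<Longrightarrow> p \<noteq> 0 \<Longrightarrow> poly p t = 0 \<Longrightarrow> degree h \<le> degree p"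
      using exists_least_iff[of "\<lambda>n. \<exists>p\<in>polys_over A. p \<noteq> 0 \<and> poly p t = 0 \<and> degree p = n"]
      by (metis not_less)
    obtain e u where e: "e \<in> A" "e \<noteq> 0" "u \<in> simple_ext A t" "e = u * b"
      using algebraic_multiple_in_base[OF A h hmin b] by blast
    have lh: "lead_coeff h \<in> A" using h by (auto simp: polys_over_def)
    \<comment> \<open>Inverting the product serves twice: a unit \<open>lead_coeff h\<close> keeps
      the extension finite, and a unit \<open>e = u * b\<close> makes \<open>b\<close>
      invertible.\<close>
    have "lead_coeff h * e \<in> A" "lead_coeff h * e \<noteq> 0" using lh e h by (auto intro: subring_setD[OF A])
    then obtain I c where I: "ideal_of A I" "finite_index A I" "1 \<notin> I" "c \<in> A" "lead_coeff h * e * c - 1 \<in> I"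
      using Q unfolding finite_specializations_def by meson
    have ec: "e * c \<in> A" "lead_coeff h * (e * c) - 1 \<in> I" using I e(1) subring_setD(4)[OF A] by (simp_all only: mult.assoc)
    have "degree h \<ge> 1"
    proof (rule ccontr)
      assume "\<not> 1 \<le> degree h"
      then obtain x where "h = [:x:]" by (metis degree_eq_zeroE less_one not_less)
      then show False using h by auto
    qed
    \<comment> \<open>Pseudo-division by \<open>h\<close> multiplies by such powers; as units modulo
      \<open>I\<close> they are the factors \<open>w\<close> of the kernel condition.\<close>
    have unit_power: "\<exists>w'\<in>A. lead_coeff h ^ N * w' - 1 \<in> I" for N
    proof (induction N)
      case 0
      then show ?case using subring_setD(1)[OF A] ideal_ofD(2)[OF I(1)] by (auto intro!: bexI[of _ 1])
    next
      case (Suc N)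
      then obtain w' where w': "w' \<in> A" "lead_coeff h ^ N * w' - 1 \<in> I" by blast
      have "lead_coeff h * (e * c) * (lead_coeff h ^ N * w' - 1) + (lead_coeff h * (e * c) - 1) \<in> I"
        using ideal_ofD(7)[OF I(1) ideal_ofD(4)[OF I(1) subring_setD(4)[OF A lh ec(1)] w'(2)] ec(2)] .
      then have "lead_coeff h ^ Suc N * (w' * (e * c)) - 1 \<in> I" by (simp add: algebra_simps)
      then show ?case using w' ec subring_setD(4)[OF A] by blast
    qed
    have "\<exists>w\<in>A. (\<exists>w'\<in>A. w * w' - 1 \<in> I) \<and> (\<exists>q\<in>polys_over A. smult w r = h * q)"
      if r: "r \<in> polys_over A" "poly r t = 0" for r
    proof -
      obtain N q s where s: "q \<in> polys_over A" "s \<in> polys_over A" "s = 0 \<or> degree s < degree h"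
        "smult (lead_coeff h ^ N) r = h * q + s"
        using pseudo_division_over[OF A h(1,2) r(1)] by blast
      have "poly (smult (lead_coeff h ^ N) r) t = poly (h * q + s) t" using s(4) by simp
      then have "poly s t = 0" using h r by simp
      then have "s = 0" using s hmin[OF s(2)] by force
      then show ?thesis using s unit_power[of N] subring_power[OF A lh] by auto
    qed
    with ideal_extension[OF A I(1-3) h(1) \<open>degree h \<ge> 1\<close> ec] obtain J where
      J: "ideal_of (simple_ext A t) J" "finite_index (simple_ext A t) J" "1 \<notin> J" "I \<subseteq> J"
      by blast
    have "b * (u * (lead_coeff h * c)) - 1 = lead_coeff h * e * c - 1" using e by (simp add: algebra_simps)
    then have "b * (u * (lead_coeff h * c)) - 1 \<in> J" using I(5) J(4) by (simp only:) blast
    moreover have "u * (lead_coeff h * c) \<in> simple_ext A t"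
      using e lh I AB by (intro subring_setD[OF B]) auto
    ultimately show ?thesis using J by blast
  qed
qed

lemma finite_specializations_Ints: "finite_specializations (\<int> :: 'a::{comm_ring_1,ring_char_0} set)"
  unfolding finite_specializations_def
proof (intro ballI impI)
  fix b :: 'a assume "b \<in> \<int>" "b \<noteq> 0"
  then obtain z where z: "b = of_int z" "z \<noteq> 0" by (auto elim: Ints_cases)
  \<comment> \<open>Modulo \<open>\<bar>z\<bar> + 1\<close> the integer \<open>z\<close> is
    congruent to \<open>- sgn z\<close>, that is, to 1 or -1, so this explicit modulus makes it a
    unit.\<close>
  define N where "N = \<bar>z\<bar> + 1"
  have N: "N \<ge> 2" using z by (auto simp: N_def)
  define I :: "'a set" where "I = of_int ` {i. N dvd i}"
  have mem: "of_int i \<in> I \<longleftrightarrow> N dvd i" for i by (auto simp: I_def)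
  have "ideal_of \<int> I"
    unfolding ideal_of_def
  proof (intro conjI ballI)
    show "I \<subseteq> \<int>" by (auto simp: I_def)
    show "0 \<in> I" using mem[of 0] by simp
    fix x assume x: "x \<in> I"
    then obtain i where i: "x = of_int i" "N dvd i" by (auto simp: I_def)
    show "x - y \<in> I" if "y \<in> I" for y
    proof -
      obtain j where "y = of_int j" "N dvd j" using \<open>y \<in> I\<close> by (auto simp: I_def)
      then show ?thesis using i mem[of "i - j"] by simp
    qed
    show "a * x \<in> I" if a: "a \<in> \<int>" for a
    proof -
      obtain j where "a = of_int j" using a unfolding Ints_def by blast
      then show ?thesis using i mem[of "j * i"] by simp
    qed
  qed
  moreover have "finite_index \<int> I"
    unfolding finite_index_def
  proof (intro exI conjI ballI)
    show "finite (of_int ` {0..<N} :: 'a set)" by simp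
    show "(of_int ` {0..<N} :: 'a set) \<subseteq> \<int>" by auto
    fix x :: 'a assume "x \<in> \<int>"
    then obtain i where i: "x = of_int i" by (auto elim: Ints_cases)
    have "x - of_int (i mod N) \<in> I" using mem[of "i - i mod N"] i by simp
    then show "\<exists>r\<in>of_int ` {0..<N}. x - r \<in> I" using N by auto
  qed
  moreover have "1 \<notin> I" using mem[of 1] N by auto
  moreover have "b * of_int (- sgn z) - 1 \<in> I"
  proof -
    have "z * (- sgn z) - 1 = - N" by (simp add: N_def abs_sgn)
    then have "N dvd z * (- sgn z) - 1" by simp
    then show ?thesis using mem[of "z * (- sgn z) - 1"] z by simp
  qed
  ultimately show "\<exists>I. ideal_of \<int> I \<and> finite_index \<int> I \<and> 1 \<notin> I \<and> (\<exists>c\<in>\<int>. b * c - 1 \<in> I)"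
    by (metis Ints_of_int)
qed

section \<open>Finitely generated domains and values of exponential sums\<close>

lemma finite_specializations_exists:
  fixes T :: "'a::{idom,ring_char_0} set"
  assumes "finite T"
  shows "\<exists>A. subring_set A \<and> T \<subseteq> A \<and> finite_specializations A"
  using assms
proof induction
  case empty
  then show ?case using finite_specializations_Ints by (intro exI[of _ \<int>]) (auto simp: subring_set_def)
next
  case (insert t T)
  then obtain A where "subring_set A" "T \<subseteq> A" "finite_specializations A" by blast
  then show ?case
    using subring_simple_ext simple_ext_supset[of A t] finite_specializations_simple_ext
    by (intro exI[of _ "simple_ext A t"]) auto
qed

text \<open>Pigeonhole: two powers of \<open>z\<close> share a representative, and
  \<open>inverse z \<in> A\<close> allows the smaller one to be cancelled.\<close>

lemma unit_power_mod_finite_index: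
  fixes z :: "'a::field"
  assumes A: "subring_set A" and I: "ideal_of A I" "finite_index A I"
    and z: "z \<in> A" "inverse z \<in> A" "z \<noteq> 0"
  shows "\<exists>n\<ge>1::nat. z ^ n - 1 \<in> I"
proof -
  obtain F where F: "finite F" "F \<subseteq> A" "\<And>x. x \<in> A \<Longrightarrow> \<exists>r\<in>F. x - r \<in> I"
    using I(2) by (auto simp: finite_index_def)
  obtain \<rho> where \<rho>: "\<And>x. x \<in> A \<Longrightarrow> \<rho> x \<in> F \<and> x - \<rho> x \<in> I" using F(3) by metis
  have zA: "z ^ k \<in> A" for k using subring_power[OF A z(1)] .
  have "\<not> inj (\<lambda>k::nat. \<rho> (z ^ k))"
    using F(1) \<rho>[OF zA] finite_imageD infinite_UNIV_nat by (metis finite_subset image_subset_iff)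
  then obtain i j where ij: "\<rho> (z ^ i) = \<rho> (z ^ j)" "i < j"
    unfolding inj_def by (metis linorder_neqE_nat)
  have "(z ^ j - \<rho> (z ^ j)) - (z ^ i - \<rho> (z ^ i)) \<in> I"
    using \<rho>[OF zA[of j]] \<rho>[OF zA[of i]] ideal_ofD(3)[OF I(1)] by blast
  then have "inverse z ^ i * (z ^ j - z ^ i) \<in> I"
    using ij subring_power[OF A z(2)] by (intro ideal_ofD(4)[OF I(1)]) auto
  moreover have "inverse z ^ i * (z ^ j - z ^ i) = z ^ (j - i) - 1"
    using ij z(3) by (simp add: power_diff right_diff_distrib field_simps)
  ultimately show ?thesis using ij by (intro exI[of _ "j - i"]) auto
qed

lemma unit_power_int_mod_ideal:
  fixes z :: "'a::field"
  assumes A: "subring_set A" and I: "ideal_of A I"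
    and z: "z \<in> A" "inverse z \<in> A" "z \<noteq> 0" and n: "z ^ n - 1 \<in> I"
  shows "z powi (int n * j) - 1 \<in> I"
proof -
  have pow: "w ^ k - 1 \<in> I" if "w \<in> A" "w - 1 \<in> I" for w k
  proof (induction k)
    case (Suc k)
    have "w * (w ^ k - 1) + (w - 1) \<in> I" using that Suc by (intro ideal_ofD(4,7)[OF I])
    then show ?case by (simp add: algebra_simps)
  qed (use ideal_ofD(2)[OF I] in simp)
  have inv: "inverse z ^ n - 1 \<in> I"
  proof -
    have "- (inverse z ^ n * (z ^ n - 1)) \<in> I"
      using n subring_power[OF A z(2)] by (intro ideal_ofD(4,6)[OF I]) auto
    moreover have "- (inverse z ^ n * (z ^ n - 1)) = inverse z ^ n - 1"
      using z(3) by (simp add: field_simps)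
    ultimately show ?thesis by simp
  qed
  show ?thesis
  proof (cases "j \<ge> 0")
    case True
    then obtain k where "j = int k" by (metis nonneg_int_cases)
    then have "z powi (int n * j) = (z ^ n) ^ k"
      by (simp add: power_mult flip: of_nat_mult)
    then show ?thesis using pow[of "z ^ n" k] n subring_power[OF A z(1)] by simp
  next
    case False
    then obtain k where "j = - int k" by (metis int_cases2 le_minus_iff neg_0_le_iff_le of_nat_0_le_iff)
    then have "z powi (int n * j) = (inverse z ^ n) ^ k"
      by (simp add: power_int_minus power_inverse power_mult flip: of_nat_mult)
    then show ?thesis using pow[of "inverse z ^ n" k] inv subring_power[OF A z(2)] by simp
  qed
qed

theorem exponential_sum_nonzero_on_progression:
  fixes c \<zeta> :: "'i \<Rightarrow> 'a::field_char_0"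
  assumes S: "finite S" and \<zeta>: "\<And>i. i \<in> S \<Longrightarrow> \<zeta> i \<noteq> 0"
    and nz: "(\<Sum>i\<in>S. c i * \<zeta> i powi k) \<noteq> 0"
  shows "\<exists>n\<ge>1::nat. \<forall>j. (\<Sum>i\<in>S. c i * \<zeta> i powi (k + int n * j)) \<noteq> 0"
proof -
  \<comment> \<open>The inverses belong to the generators because exponents run over all integers
    and because powers are cancelled modulo \<open>I\<close>.\<close>
  define T where "T = c ` S \<union> \<zeta> ` S \<union> (inverse \<circ> \<zeta>) ` S"
  have "finite T" using S by (simp add: T_def)
  then obtain A where A: "subring_set A" "T \<subseteq> A" "finite_specializations A"
    using finite_specializations_exists by blast
  have mem: "c i \<in> A" "\<zeta> i \<in> A" "inverse (\<zeta> i) \<in> A" if "i \<in> S" for i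
    using that A(2) by (auto simp: T_def)
  have powi: "\<zeta> i powi m \<in> A" if "i \<in> S" for i m
    using mem[OF that] by (auto simp: power_int_def intro: subring_power[OF A(1)])
  define b where "b = (\<Sum>i\<in>S. c i * \<zeta> i powi k)"
  have "b \<in> A" unfolding b_def using mem powi by (intro subring_sum A(1) subring_setD(4)[OF A(1)])
  with nz obtain I e where I: "ideal_of A I" "finite_index A I" "1 \<notin> I" "e \<in> A" "b * e - 1 \<in> I"
    using A(3) unfolding finite_specializations_def b_def[symmetric] by blast
  have "\<exists>n\<ge>1. \<zeta> i ^ n - 1 \<in> I" if "i \<in> S" for i
    using unit_power_mod_finite_index[OF A(1) I(1,2)] mem[OF that] \<zeta>[OF that] by blast
  then obtain \<nu> where \<nu>: "\<And>i. i \<in> S \<Longrightarrow> \<nu> i \<ge> 1 \<and> \<zeta> i ^ \<nu> i - 1 \<in> I" by metis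
  \<comment> \<open>A common period of the powers of all \<open>\<zeta> i\<close> modulo
    \<open>I\<close>.\<close>
  define n where "n = prod \<nu> S"
  have "n \<ge> 1" unfolding n_def using \<nu> by (metis One_nat_def Suc_leI less_eq_Suc_le prod_pos)
  moreover have "(\<Sum>i\<in>S. c i * \<zeta> i powi (k + int n * j)) \<noteq> 0" for j
  proof
    assume z: "(\<Sum>i\<in>S. c i * \<zeta> i powi (k + int n * j)) = 0"
    \<comment> \<open>The sum at \<open>k + int n * j\<close> agrees with \<open>b\<close> modulo
      \<open>I\<close>; if it were zero, the unit \<open>b\<close> would lie in
      \<open>I\<close>.\<close>
    have "(\<Sum>i\<in>S. c i * \<zeta> i powi k * (\<zeta> i powi (int n * j) - 1)) \<in> I"
    proof (rule ideal_of_sum[OF I(1)])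
      fix i assume i: "i \<in> S"
      have "\<nu> i dvd n" unfolding n_def using i S by (rule dvd_prodI[rotated])
      then obtain r where r: "n = \<nu> i * r" by blast
      have "\<zeta> i powi (int (\<nu> i) * (int r * j)) - 1 \<in> I"
        using unit_power_int_mod_ideal[OF A(1) I(1) mem(2,3)[OF i] \<zeta>[OF i]] \<nu>[OF i] by blast
      then have "\<zeta> i powi (int n * j) - 1 \<in> I" using r by (simp add: mult.assoc)
      moreover have "c i * \<zeta> i powi k \<in> A" using mem[OF i] powi[OF i] by (intro subring_setD(4)[OF A(1)])
      ultimately show "c i * \<zeta> i powi k * (\<zeta> i powi (int n * j) - 1) \<in> I"
        by (intro ideal_ofD(4)[OF I(1)])
    qed
    also have "(\<Sum>i\<in>S. c i * \<zeta> i powi k * (\<zeta> i powi (int n * j) - 1)) = - b"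
      using z \<zeta> by (simp add: b_def right_diff_distrib sum_subtractf power_int_add mult.assoc)
    finally have "- b * e + (b * e - 1) \<in> I" using I by (intro ideal_ofD(5,7)[OF I(1)])
    then have "- 1 \<in> I" by simp
    then show False using I(3) ideal_ofD(6)[OF I(1)] by fastforce
  qed
  ultimately show ?thesis by blast
qed

section \<open>The rotation invariant measure on the sphere\<close>

lemma nn_integral_lborel_translate:
  fixes c :: "'a::euclidean_space"
  assumes [measurable]: "F \<in> borel_measurable borel"
  shows "(\<integral>\<^sup>+x. F (c + x) \<partial>lborel) = (\<integral>\<^sup>+x. F x \<partial>lborel)"
proof -
  have "(\<integral>\<^sup>+x. F x \<partial>lborel) = (\<integral>\<^sup>+x. F x \<partial>distr lborel borel ((+) c))" by (simp add: lborel_distr_plus)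
  also have "\<dots> = (\<integral>\<^sup>+x. F (c + x) \<partial>lborel)" by (subst nn_integral_distr) auto
  finally show ?thesis by simp
qed

lemma emeasure_lborel_ball_pos: "r > 0 \<Longrightarrow> emeasure lborel (ball (x :: 'a::euclidean_space) r) \<noteq> 0"
  using content_ball_pos[of r x] by (auto simp: measure_def)

text \<open>Uniqueness of Haar measure: compute the Lebesgue integral of
  \<open>A (f x + y) B (y)\<close> over \<open>(x, y)\<close>, with \<open>B\<close> the unit ball, in both orders.\<close>

lemma emeasure_lborel_vimage_orthogonal:
  fixes f :: "'a::euclidean_space \<Rightarrow> 'a"
  assumes f: "orthogonal_transformation f" and A[measurable]: "A \<in> sets borel"
  shows "emeasure lborel (f -` A) = emeasure lborel A"
proof -
  have "continuous_on UNIV f"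
    using f by (simp add: linear_continuous_on orthogonal_transformation_linear linear_linear)
  then have [measurable]: "f \<in> borel_measurable borel" by (rule borel_measurable_continuous_onI)
  obtain g where g: "\<And>y. f (g y) = y"
    using orthogonal_transformation_surj[OF f] by (metis surjD)
  have add: "f (x + y) = f x + f y" for x y
    using f by (simp add: linear_add orthogonal_transformation_linear)
  have diff: "f (x - y) = f x - f y" for x y
    using f by (simp add: linear_diff orthogonal_transformation_linear)
  have fA[measurable]: "f -` A \<in> sets borel" using measurable_sets[of f borel borel A] by simp
  define B where "B = ball (0::'a) 1"
  have [measurable]: "B \<in> sets borel" by (simp add: B_def)
  \<comment> \<open>Shifting by a preimage \<open>g y\<close> turns \<open>y - f x\<close> into
    \<open>- f x\<close>, and \<open>f\<close> preserves the norm, so the integral is the volume of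
    the ball for every \<open>y\<close>.\<close>
  have ball: "(\<integral>\<^sup>+x. indicator B (y - f x) \<partial>lborel) = emeasure lborel B" for y
  proof -
    have "norm (y - f (g y + x)) = norm x" for x
      using orthogonal_transformation_norm[OF f, of x] by (simp add: add g)
    then have "(\<integral>\<^sup>+x. indicator B (y - f (g y + x)) \<partial>lborel) = (\<integral>\<^sup>+x. indicator B x \<partial>lborel)"
      by (simp add: indicator_def B_def)
    moreover have "(\<lambda>x. indicator B (y - f x) :: ennreal) \<in> borel_measurable borel"
      by measurable
    ultimately show ?thesis using nn_integral_lborel_translate[of "\<lambda>x. indicator B (y - f x)" "g y"] by simp
  qed
  let ?F = "\<lambda>x y. indicator A (f x + y) * indicator B y :: ennreal"
  have "emeasure lborel (f -` A) * emeasure lborel B = (\<integral>\<^sup>+y. (\<integral>\<^sup>+x. indicator (f -` A) x \<partial>lborel) * indicator B y \<partial>lborel)"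
    by (simp add: nn_integral_cmult_indicator)
  also have "\<dots> = (\<integral>\<^sup>+y. (\<integral>\<^sup>+x. indicator (f -` A) (g y + x) \<partial>lborel) * indicator B y \<partial>lborel)"
    by (subst nn_integral_lborel_translate) auto
  also have "\<dots> = (\<integral>\<^sup>+y. (\<integral>\<^sup>+x. ?F x y \<partial>lborel) \<partial>lborel)"
    by (subst nn_integral_multc) (auto simp: indicator_def add g add.commute)
  also have "\<dots> = (\<integral>\<^sup>+x. (\<integral>\<^sup>+y. ?F x y \<partial>lborel) \<partial>lborel)"
    by (intro lborel_pair.Fubini') measurable
  also have "\<dots> = (\<integral>\<^sup>+x. (\<integral>\<^sup>+y. ?F x (- f x + y) \<partial>lborel) \<partial>lborel)"
    by (subst nn_integral_lborel_translate) auto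
  also have "\<dots> = (\<integral>\<^sup>+x. (\<integral>\<^sup>+y. indicator A y * indicator B (y - f x) \<partial>lborel) \<partial>lborel)"
    by simp
  also have "\<dots> = (\<integral>\<^sup>+y. (\<integral>\<^sup>+x. indicator A y * indicator B (y - f x) \<partial>lborel) \<partial>lborel)"
    by (intro lborel_pair.Fubini'[symmetric]) measurable
  also have "\<dots> = (\<integral>\<^sup>+y. indicator A y * emeasure lborel B \<partial>lborel)"
    by (subst nn_integral_cmult) (auto simp: ball)
  also have "\<dots> = emeasure lborel A * emeasure lborel B"
    by (simp add: nn_integral_multc)
  finally show ?thesis
    using emeasure_lborel_ball_pos[of 1 "0::'a"] emeasure_lborel_ball_finite[of "0::'a" 1]
    by (metis B_def ennreal_mult_cancel_left mult.commute less_irrefl infinity_ennreal_def zero_less_one)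
qed

lemma distr_lborel_ball_orthogonal:
  fixes f :: "real^'n \<Rightarrow> real^'n"
  assumes f: "orthogonal_transformation f"
  shows "distr (uniform_measure lborel (ball 0 1)) borel f = uniform_measure lborel (ball 0 1)"
proof -
  let ?U = "uniform_measure lborel (ball (0 :: real^'n) 1)"
  have cont: "continuous_on UNIV f"
    using f by (simp add: linear_continuous_on orthogonal_transformation_linear linear_linear)
  then have meas[measurable]: "f \<in> borel_measurable borel" by (rule borel_measurable_continuous_onI)
  show ?thesis
  proof (rule measure_eqI)
    fix A assume "A \<in> sets (distr ?U borel f)"
    then have A[measurable]: "A \<in> sets borel" by simp
    have "emeasure (distr ?U borel f) A = emeasure ?U (f -` A)"
      by (simp add: emeasure_distr)
    also have "\<dots> = emeasure lborel (ball 0 1 \<inter> f -` A) / emeasure lborel (ball (0 :: real^'n) 1)"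
      using measurable_sets[OF meas A] by simp
    also have "ball 0 1 \<inter> f -` A = f -` (ball 0 1 \<inter> A)"
      using orthogonal_transformation_norm[OF f] by auto
    also have "emeasure lborel (f -` (ball 0 1 \<inter> A)) = emeasure lborel (ball 0 1 \<inter> A)"
      by (intro emeasure_lborel_vimage_orthogonal f) auto
    finally show "emeasure (distr ?U borel f) A = emeasure ?U A" by simp
  qed simp
qed

text \<open>Radial projection of the uniform distribution on the ball. As \<open>sgn\<close>
  commutes with orthogonal maps, invariance carries over; the origin, where \<open>sgn\<close> is 0,
  is a null set.\<close>

definition sphere_measure :: "(real^'n) measure" where
  "sphere_measure = distr (uniform_measure lborel (ball 0 1)) borel sgn"

lemma prob_space_uniform_ball: "prob_space (uniform_measure lborel (ball (0 :: real^'n) 1))"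
  using emeasure_lborel_ball_pos[of 1 "0 :: real^'n"] emeasure_lborel_ball_finite[of "0 :: real^'n" 1]
  by (intro prob_space_uniform_measure) auto

lemma prob_space_sphere_measure: "prob_space (sphere_measure :: (real^'n) measure)"
  unfolding sphere_measure_def by (intro prob_space.prob_space_distr prob_space_uniform_ball) simp

lemma sets_sphere_measure[measurable_cong, simp]: "sets sphere_measure = sets borel"
  by (simp add: sphere_measure_def)

lemma measure_sphere_measure_UNIV[simp]: "measure (sphere_measure :: (real^'n) measure) UNIV = 1"
  using prob_space.prob_space[OF prob_space_sphere_measure, where 'n1 = 'n] by (simp add: sphere_measure_def)

lemma space_sphere_measure[simp]: "space sphere_measure = UNIV"
  by (simp add: sphere_measure_def)

lemma distr_sphere_measure_orthogonal:
  fixes f :: "real^'n \<Rightarrow> real^'n"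
  assumes f: "orthogonal_transformation f"
  shows "distr sphere_measure borel f = sphere_measure"
proof -
  have "continuous_on UNIV f"
    using f by (simp add: linear_continuous_on orthogonal_transformation_linear linear_linear)
  then have [measurable]: "f \<in> borel_measurable borel" by (rule borel_measurable_continuous_onI)
  have "sgn (f z) = f (sgn z)" for z
    using f by (simp add: sgn_div_norm orthogonal_transformation_norm linear_scale orthogonal_transformation_linear)
  then have "f \<circ> sgn = sgn \<circ> f" by auto
  then have "distr sphere_measure borel f = distr (distr (uniform_measure lborel (ball 0 1)) borel f) borel sgn"
    unfolding sphere_measure_def by (simp add: distr_distr)
  then show ?thesis by (simp add: distr_lborel_ball_orthogonal[OF f] sphere_measure_def)
qed

lemma integrable_sphere_measure:
  fixes F :: "real^'n \<Rightarrow> real"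
  assumes F: "continuous_on UNIV F"
  shows "integrable sphere_measure F"
proof -
  interpret prob_space "sphere_measure :: (real^'n) measure" by (rule prob_space_sphere_measure)
  have [measurable]: "F \<in> borel_measurable borel" using F by (rule borel_measurable_continuous_onI)
  \<comment> \<open>The closed ball rather than the sphere, since \<open>sgn 0 = 0\<close>.\<close>
  have "compact (F ` cball 0 1)" using F continuous_on_subset by (intro compact_continuous_image) auto
  then obtain B where B: "\<And>z. norm z \<le> 1 \<Longrightarrow> norm (F z) \<le> B"
    by (force dest!: compact_imp_bounded simp: bounded_iff)
  have "AE z in sphere_measure. norm (F z) \<le> B"
    unfolding sphere_measure_def by (subst AE_distr_iff) (auto intro!: AE_I2 B[unfolded real_norm_def] simp: norm_sgn)
  then show ?thesis by (intro integrable_const_bound) auto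
qed

lemma AE_sphere_measure_norm: "AE z in (sphere_measure :: (real^'n) measure). norm z = 1"
proof -
  have "AE z in lborel. z \<noteq> (0 :: real^'n)"
    by (rule AE_lborel_singleton)
  then have "AE z in uniform_measure lborel (ball 0 1). z \<noteq> (0 :: real^'n)"
    using emeasure_lborel_ball_pos[of 1 "0 :: real^'n"] emeasure_lborel_ball_finite[of "0 :: real^'n" 1]
    by (subst AE_uniform_measure) auto
  then show ?thesis
    unfolding sphere_measure_def by (subst AE_distr_iff) (auto simp: norm_sgn)
qed

abbreviation mean :: "(real^'n \<Rightarrow> real) \<Rightarrow> real" where
  "mean F \<equiv> integral\<^sup>L sphere_measure F"

lemma mean_orthogonal:
  fixes f :: "real^'n \<Rightarrow> real^'n"
  assumes "orthogonal_transformation f" "continuous_on UNIV F"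
  shows "mean (\<lambda>z. F (f z)) = mean F"
proof -
  have "continuous_on UNIV f"
    using assms by (simp add: linear_continuous_on orthogonal_transformation_linear linear_linear)
  then have "f \<in> borel_measurable borel" "F \<in> borel_measurable borel"
    using assms by (auto intro: borel_measurable_continuous_onI)
  then have "integral\<^sup>L (distr sphere_measure borel f) F = mean (\<lambda>z. F (f z))"
    by (intro integral_distr) auto
  then show ?thesis by (simp add: distr_sphere_measure_orthogonal[OF assms(1)])
qed

section \<open>Moments of linear forms on the sphere\<close>

lemma mean_inner_orthogonal:
  fixes x y :: "real^'n"
  assumes "norm x = 1" "norm y = 1" "continuous_on UNIV \<phi>"
  shows "mean (\<lambda>z. \<phi> (x \<bullet> z)) = mean (\<lambda>z. \<phi> (y \<bullet> z))"
proof -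
  obtain f where f: "orthogonal_transformation f" "f x = y"
    using orthogonal_transformation_exists[of x y] assms by auto
  have "mean (\<lambda>z. \<phi> (y \<bullet> z)) = mean (\<lambda>z. \<phi> (y \<bullet> f z))"
    using assms by (intro mean_orthogonal[OF f(1), symmetric] continuous_intros continuous_on_compose2[OF assms(3)]) auto
  also have "(\<lambda>z. \<phi> (y \<bullet> f z)) = (\<lambda>z. \<phi> (x \<bullet> z))"
    using f by (auto simp: orthogonal_transformation_def)
  finally show ?thesis by simp
qed

text \<open>\<open>undefined\<close> merely names some coordinate; by rotation invariance every unit
  vector in place of that axis gives the same value.\<close>

definition moment :: "'n::finite itself \<Rightarrow> nat \<Rightarrow> real" where
  "moment _ n = mean (\<lambda>z :: real^'n. (z $ undefined) ^ n)"

lemma mean_inner_power: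
  fixes x :: "real^'n"
  shows "mean (\<lambda>z. (x \<bullet> z) ^ n) = moment TYPE('n) n * norm x ^ n"
proof (cases "x = 0")
  case True
  then show ?thesis
    by (cases n) (auto simp: moment_def)
next
  case False
  have "(x \<bullet> z) ^ n = norm x ^ n * ((x /\<^sub>R norm x) \<bullet> z) ^ n" for z
    using False by (simp add: power_mult_distrib power_inverse)
  then have "mean (\<lambda>z. (x \<bullet> z) ^ n) = norm x ^ n * mean (\<lambda>z. ((x /\<^sub>R norm x) \<bullet> z) ^ n)"
    by simp
  also have "mean (\<lambda>z. ((x /\<^sub>R norm x) \<bullet> z) ^ n) = mean (\<lambda>z :: real^'n. (axis undefined 1 \<bullet> z) ^ n)"
    using False by (intro mean_inner_orthogonal[where \<phi> = "\<lambda>t. t ^ n"] continuous_intros) (auto simp: norm_axis_1)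
  also have "\<dots> = moment TYPE('n) n"
    by (simp add: moment_def inner_axis')
  finally show ?thesis by simp
qed

lemma moment_0: "moment TYPE('n::finite) 0 = 1"
  by (simp add: moment_def)

lemma moment_odd:
  assumes "odd n"
  shows "moment TYPE('n::finite) n = 0"
proof -
  have "mean (\<lambda>z :: real^'n. (- axis undefined 1 \<bullet> z) ^ n) = mean (\<lambda>z :: real^'n. (axis undefined 1 \<bullet> z) ^ n)"
    by (simp only: mean_inner_power norm_minus_cancel)
  then show ?thesis using assms by (simp add: moment_def inner_axis')
qed

text \<open>Compare the coefficients of \<open>\<tau>\<close> in \<open>mean (\<lambda>z. ((x + \<tau> y) \<bullet> z) ^ n) = moment n * norm (x + \<tau> y) ^ n\<close>.\<close>

lemma mean_inner_powers:
  fixes x y :: "real^'n"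
  assumes x: "norm x = 1" and y: "norm y = 1" and b: "b \<le> n"
  shows "real (n choose b) * mean (\<lambda>z. (x \<bullet> z) ^ (n - b) * (y \<bullet> z) ^ b) =
    moment TYPE('n) n * coeff ([:1, 2 * (x \<bullet> y), 1:] ^ (n div 2)) b"
proof -
  define e where "e i = mean (\<lambda>z. (x \<bullet> z) ^ (n - i) * (y \<bullet> z) ^ i)" for i
  define P where "P = (\<Sum>i\<le>n. monom (real (n choose i) * e i) i)"
  have "poly P \<tau> = poly (smult (moment TYPE('n) n) ([:1, 2 * (x \<bullet> y), 1:] ^ (n div 2))) \<tau>" for \<tau>
  proof -
    have "poly P \<tau> = (\<Sum>i\<le>n. mean (\<lambda>z. real (n choose i) * \<tau> ^ i * ((x \<bullet> z) ^ (n - i) * (y \<bullet> z) ^ i)))"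
      by (simp add: P_def poly_sum poly_monom e_def mult.commute mult.left_commute)
    also have "\<dots> = mean (\<lambda>z. \<Sum>i\<le>n. real (n choose i) * \<tau> ^ i * ((x \<bullet> z) ^ (n - i) * (y \<bullet> z) ^ i))"
      by (intro Bochner_Integration.integral_sum[symmetric] integrable_sphere_measure continuous_intros)
    also have "\<dots> = mean (\<lambda>z. ((x + \<tau> *\<^sub>R y) \<bullet> z) ^ n)"
    proof (rule Bochner_Integration.integral_cong[OF refl])
      fix z
      have "(x + \<tau> *\<^sub>R y) \<bullet> z = \<tau> * (y \<bullet> z) + x \<bullet> z" by (simp add: inner_add_left)
      then show "(\<Sum>i\<le>n. real (n choose i) * \<tau> ^ i * ((x \<bullet> z) ^ (n - i) * (y \<bullet> z) ^ i)) = ((x + \<tau> *\<^sub>R y) \<bullet> z) ^ n"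
        by (simp only: binomial_ring power_mult_distrib mult_ac of_nat_id)
    qed
    also have "\<dots> = moment TYPE('n) n * norm (x + \<tau> *\<^sub>R y) ^ n" by (rule mean_inner_power)
    also have "\<dots> = moment TYPE('n) n * poly ([:1, 2 * (x \<bullet> y), 1:] ^ (n div 2)) \<tau>"
    \<comment> \<open>For odd \<open>n\<close> the moment vanishes, so the rounding in
      \<open>n div 2\<close> is harmless.\<close>
    proof (cases "even n")
      case True
      have "norm (x + \<tau> *\<^sub>R y) ^ n = ((norm (x + \<tau> *\<^sub>R y))\<^sup>2) ^ (n div 2)"
        using True by (simp flip: power_mult)
      also have "(norm (x + \<tau> *\<^sub>R y))\<^sup>2 = poly [:1, 2 * (x \<bullet> y), 1:] \<tau>"
      proof -
        have "x \<bullet> x = 1" "y \<bullet> y = 1" using x y by (auto simp: norm_eq_1)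
        then show ?thesis
          unfolding power2_norm_eq_inner by (simp add: inner_add inner_commute algebra_simps)
      qed
      finally show ?thesis by (simp add: poly_power)
    qed (simp add: moment_odd)
    finally show ?thesis by simp
  qed
  then have "P = smult (moment TYPE('n) n) ([:1, 2 * (x \<bullet> y), 1:] ^ (n div 2))"
    by (simp flip: poly_eq_poly_eq_iff add: fun_eq_iff)
  then have "coeff P b = moment TYPE('n) n * coeff ([:1, 2 * (x \<bullet> y), 1:] ^ (n div 2)) b" by simp
  moreover have "coeff P b = real (n choose b) * e b"
    using b by (simp add: P_def coeff_sum if_distrib[of "coeff _"] sum.delta cong: if_cong)
  ultimately show ?thesis by (simp add: e_def)
qed

lemma coeff_quadratic_power:
  fixes t :: "'a::comm_ring_1"
  shows "coeff ([:1, t, 1:] ^ Suc N) b = coeff ([:1, t, 1:] ^ N) b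
     + (if b \<ge> 1 then t * coeff ([:1, t, 1:] ^ N) (b - 1) else 0)
     + (if b \<ge> 2 then coeff ([:1, t, 1:] ^ N) (b - 2) else 0)"
  by (auto simp: coeff_pCons algebra_simps numeral_2_eq_2 split: nat.splits)

text \<open>Each factor \<open>t\<close> comes with one factor of the variable, so the degree in
  \<open>t\<close> is at most \<open>b\<close> however large \<open>N\<close> is.\<close>

lemma coeff_quadratic_power_poly:
  "\<exists>H :: 'a::comm_ring_1 poly. degree H \<le> b \<and> (\<forall>t. coeff ([:1, 2 * t, 1:] ^ N) b = poly H t)"
proof (induction N arbitrary: b)
  case 0
  show ?case by (intro exI[of _ "[:if b = 0 then 1 else 0:]"]) (auto simp: coeff_eq_0)
next
  case (Suc N)
  obtain H where H: "\<And>b. degree (H b) \<le> b" "\<And>b t. coeff ([:1, 2 * t, 1:] ^ N) b = poly (H b) (t :: 'a)"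
    using Suc by metis
  define K where "K = H b + (if b \<ge> 1 then [:0, 2:] * H (b - 1) else 0) + (if b \<ge> 2 then H (b - 2) else 0)"
  have "degree ([:0, 2:] * H (b - 1)) \<le> b" if "b \<ge> 1"
    using that H(1)[of "b - 1"] degree_mult_le[of "[:0, 2:]" "H (b - 1)"] by (auto split: if_splits)
  then have "degree K \<le> b" unfolding K_def using H(1)[of b] H(1)[of "b - 2"]
    by (intro degree_add_le) (auto intro: order_trans)
  moreover have "coeff ([:1, 2 * t, 1:] ^ Suc N) b = poly K t" for t
    unfolding coeff_quadratic_power H(2) by (simp add: K_def algebra_simps)
  ultimately show ?case by blast
qed

lemma mean_inner_powers_poly:
  "\<exists>H. degree H \<le> b \<and> (\<forall>x y :: real^'n. norm x = 1 \<longrightarrow> norm y = 1 \<longrightarrow>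
      mean (\<lambda>z. (x \<bullet> z) ^ a * (y \<bullet> z) ^ b) = poly H (x \<bullet> y))"
proof -
  obtain H :: "real poly" where H: "degree H \<le> b" "\<And>t. coeff ([:1, 2 * t, 1:] ^ ((a + b) div 2)) b = poly H t"
    using coeff_quadratic_power_poly by metis
  have "mean (\<lambda>z. (x \<bullet> z) ^ a * (y \<bullet> z) ^ b) =
      poly (smult (moment TYPE('n) (a + b) / real (a + b choose b)) H) (x \<bullet> y)"
    if "norm x = 1" "norm y = 1" for x y :: "real^'n"
  proof -
    have "real (a + b choose b) * mean (\<lambda>z. (x \<bullet> z) ^ a * (y \<bullet> z) ^ b) = moment TYPE('n) (a + b) * poly H (x \<bullet> y)"
      using mean_inner_powers[OF that, of b "a + b"] unfolding H(2) by simp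
    moreover have "real (a + b choose b) \<noteq> 0" by simp
    ultimately have "mean (\<lambda>z. (x \<bullet> z) ^ a * (y \<bullet> z) ^ b) = moment TYPE('n) (a + b) * poly H (x \<bullet> y) / real (a + b choose b)"
      by (metis nonzero_mult_div_cancel_left)
    then show ?thesis by simp
  qed
  note mean = this
  show ?thesis
  proof (intro exI conjI allI impI)
    show "degree (smult (moment TYPE('n) (a + b) / real (a + b choose b)) H) \<le> b"
      by (rule order_trans[OF degree_smult_le H(1)])
  qed (rule mean)
qed

lemma continuous_on_poly_compose [continuous_intros]:
  fixes p :: "'a::real_normed_field poly"
  shows "continuous_on A f \<Longrightarrow> continuous_on A (\<lambda>x. poly p (f x))"
  by (rule continuous_on_compose2[OF continuous_at_imp_continuous_on[of UNIV "poly p"]]) auto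

text \<open>The bound involves only the second factor. As the factors may be exchanged, a
  convolution of polynomials of different degrees has at most the smaller degree, which the
  reproducing formula relies on.\<close>

lemma mean_poly_inner:
  "\<exists>H. degree H \<le> degree q \<and> (\<forall>x y :: real^'n. norm x = 1 \<longrightarrow> norm y = 1 \<longrightarrow>
      mean (\<lambda>z. poly p (x \<bullet> z) * poly q (y \<bullet> z)) = poly H (x \<bullet> y))"
proof -
  have "\<exists>H. \<forall>a b. degree (H a b) \<le> b \<and> (\<forall>x y :: real^'n. norm x = 1 \<longrightarrow> norm y = 1 \<longrightarrow>
      mean (\<lambda>z. (x \<bullet> z) ^ a * (y \<bullet> z) ^ b) = poly (H a b) (x \<bullet> y))"
    by (rule choice, rule allI, rule choice, rule allI, rule mean_inner_powers_poly)
  then obtain H where H: "\<And>a b. degree (H a b) \<le> b"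
    "\<And>a b x y. norm x = 1 \<Longrightarrow> norm y = 1 \<Longrightarrow>
       mean (\<lambda>z :: real^'n. (x \<bullet> z) ^ a * (y \<bullet> z) ^ b) = poly (H a b) (x \<bullet> y)"
    by blast
  define K where "K = (\<Sum>a\<le>degree p. \<Sum>b\<le>degree q. smult (coeff p a * coeff q b) (H a b))"
  have "degree K \<le> degree q"
    unfolding K_def using H(1) by (intro degree_sum_le) (auto intro!: order_trans[OF degree_smult_le] intro: order_trans)
  moreover have "mean (\<lambda>z. poly p (x \<bullet> z) * poly q (y \<bullet> z)) = poly K (x \<bullet> y)"
    if "norm x = 1" "norm y = 1" for x y :: "real^'n"
  proof -
    have "mean (\<lambda>z. poly p (x \<bullet> z) * poly q (y \<bullet> z)) =
      mean (\<lambda>z. \<Sum>a\<le>degree p. \<Sum>b\<le>degree q. coeff p a * coeff q b * ((x \<bullet> z) ^ a * (y \<bullet> z) ^ b))"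
      by (simp add: poly_altdef sum_product ac_simps)
    also have "\<dots> = (\<Sum>a\<le>degree p. \<Sum>b\<le>degree q. mean (\<lambda>z. coeff p a * coeff q b * ((x \<bullet> z) ^ a * (y \<bullet> z) ^ b)))"
      by (subst Bochner_Integration.integral_sum, (intro integrable_sphere_measure continuous_intros)[1],
          subst Bochner_Integration.integral_sum, (intro integrable_sphere_measure continuous_intros)[1]) simp
    also have "\<dots> = poly K (x \<bullet> y)"
      using that by (simp add: K_def poly_sum H(2))
    finally show ?thesis .
  qed
  ultimately show ?thesis by blast
qed

lemma coeff_two_quadratic_power: "coeff ([:1, 0, 1:] ^ N) 2 = (of_nat N :: 'a::comm_ring_1)"
proof (induction N)
  case (Suc N)
  have "coeff ([:1, 0, 1:] ^ N) 0 = (1 :: 'a)" by (induction N) simp_all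
  then show ?case using Suc by (simp only: coeff_quadratic_power) simp
qed (simp add: coeff_eq_0)

text \<open>For orthogonal unit vectors the quadratic becomes 1 + \<tau>^2, and its coefficient at
  \<tau>^2 expresses this mixed moment through a pure one.\<close>

lemma mean_power_times_square:
  fixes x y :: "real^'n"
  assumes "norm x = 1" "norm y = 1" "x \<bullet> y = 0"
  shows "real (Suc n) * mean (\<lambda>z. (x \<bullet> z) ^ n * (y \<bullet> z)\<^sup>2) = moment TYPE('n) (n + 2)"
proof -
  let ?M = "mean (\<lambda>z. (x \<bullet> z) ^ n * (y \<bullet> z)\<^sup>2)"
  have *: "real (n + 2 choose 2) * ?M = moment TYPE('n) (n + 2) * real ((n + 2) div 2)"
    using mean_inner_powers[OF assms(1,2), of 2 "n + 2"]
    by (simp only: assms(3) mult_zero_right coeff_two_quadratic_power) simp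
  have c: "real (n + 2 choose 2) = (real n + 2) * (real n + 1) / 2"
    by (simp add: choose_two real_of_nat_div algebra_simps)
  show ?thesis
  proof (cases "even n")
    case True
    then have "real ((n + 2) div 2) = (real n + 2) / 2" by (simp add: real_of_nat_div)
    then have "(real n + 2) * (real n + 1) / 2 * ?M = moment TYPE('n) (n + 2) * ((real n + 2) / 2)"
      using * c by (simp only:)
    then have "(real n + 2) * ((real n + 1) * ?M) = (real n + 2) * moment TYPE('n) (n + 2)" by simp
    then show ?thesis by (simp add: add.commute)
  next
    case False
    then have "real (n + 2 choose 2) * ?M = 0" using * by (simp add: moment_odd)
    then have "?M = 0" using c by (auto simp: field_simps)
    then show ?thesis using False by (simp add: moment_odd)
  qed
qed

section \<open>Means of zonal polynomials\<close>

definition zonal_mean :: "'n::finite itself \<Rightarrow> real poly \<Rightarrow> real" where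
  "zonal_mean _ p = mean (\<lambda>z :: real^'n. poly p (z $ undefined))"

lemma mean_poly:
  fixes x :: "real^'n"
  assumes "norm x = 1"
  shows "mean (\<lambda>z. poly p (x \<bullet> z)) = zonal_mean TYPE('n) p"
proof -
  have "mean (\<lambda>z. poly p (x \<bullet> z)) = mean (\<lambda>z :: real^'n. poly p (axis undefined 1 \<bullet> z))"
    using assms by (intro mean_inner_orthogonal[where \<phi> = "poly p"] continuous_intros) (auto simp: norm_axis_1)
  then show ?thesis by (simp add: zonal_mean_def inner_axis')
qed

lemma zonal_mean_add: "zonal_mean TYPE('n::finite) (p + q) = zonal_mean TYPE('n) p + zonal_mean TYPE('n) q"
  and zonal_mean_diff: "zonal_mean TYPE('n::finite) (p - q) = zonal_mean TYPE('n) p - zonal_mean TYPE('n) q"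
  and zonal_mean_smult: "zonal_mean TYPE('n::finite) (smult c p) = c * zonal_mean TYPE('n) p"
proof -
  have "integrable sphere_measure (\<lambda>z :: real^'n. poly p (z $ undefined))" for p
    by (intro integrable_sphere_measure continuous_intros)
  then show "zonal_mean TYPE('n::finite) (p + q) = zonal_mean TYPE('n) p + zonal_mean TYPE('n) q"
    and "zonal_mean TYPE('n::finite) (p - q) = zonal_mean TYPE('n) p - zonal_mean TYPE('n) q"
    and "zonal_mean TYPE('n::finite) (smult c p) = c * zonal_mean TYPE('n) p"
    by (simp_all add: zonal_mean_def)
qed

lemma zonal_mean_sum: "zonal_mean TYPE('n::finite) (sum f S) = (\<Sum>i\<in>S. zonal_mean TYPE('n) (f i))"
proof (induction S rule: infinite_finite_induct)
  case (insert x F)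
  then show ?case by (simp add: zonal_mean_add)
qed (simp_all add: zonal_mean_def)

lemma zonal_mean_monom: "zonal_mean TYPE('n::finite) (monom c n) = c * moment TYPE('n) n"
  by (simp add: zonal_mean_def poly_monom moment_def)

lemma zonal_mean_one: "zonal_mean TYPE('n::finite) 1 = 1"
  using zonal_mean_monom[where 'n = 'n, of 1 0] by (simp add: moment_0 flip: monom_eq_1)

text \<open>Sum the mixed moments over the remaining coordinates: on the sphere their squares add up
  to 1 minus the square of the distinguished one.\<close>

lemma moment_recursion:
  "real (Suc n) * (moment TYPE('n::finite) n - moment TYPE('n) (n + 2)) = (real CARD('n) - 1) * moment TYPE('n) (n + 2)"
proof -
  let ?k = "undefined :: 'n"
  have "(real CARD('n) - 1) * moment TYPE('n) (n + 2) = (\<Sum>j\<in>UNIV - {?k}. moment TYPE('n) (n + 2))"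
    by (simp add: card_Diff_singleton of_nat_diff Suc_leI)
  also have "\<dots> = (\<Sum>j\<in>UNIV - {?k}. real (Suc n) * mean (\<lambda>z. (z $ ?k) ^ n * (z $ j)\<^sup>2))"
  proof (intro sum.cong refl)
    fix j assume "j \<in> UNIV - {?k}"
    then have "axis ?k (1 :: real) \<bullet> axis j 1 = 0" by (simp add: inner_axis_axis)
    from mean_power_times_square[OF norm_axis_1 norm_axis_1 this, of n]
    show "moment TYPE('n) (n + 2) = real (Suc n) * mean (\<lambda>z. (z $ ?k) ^ n * (z $ j)\<^sup>2)"
      by (simp add: inner_axis')
  qed
  also have "\<dots> = real (Suc n) * mean (\<lambda>z. \<Sum>j\<in>UNIV - {?k}. (z $ ?k) ^ n * (z $ j)\<^sup>2)"
    by (subst Bochner_Integration.integral_sum)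
      (auto simp: sum_distrib_left intro!: integrable_sphere_measure continuous_intros)
  also have "mean (\<lambda>z. \<Sum>j\<in>UNIV - {?k}. (z $ ?k) ^ n * (z $ j)\<^sup>2) = mean (\<lambda>z. (z $ ?k) ^ n - (z $ ?k) ^ (n + 2))"
  proof (rule integral_cong_AE)
    have "(\<Sum>j\<in>UNIV - {?k}. (z $ ?k) ^ n * (z $ j)\<^sup>2) = (z $ ?k) ^ n - (z $ ?k) ^ (n + 2)" if "norm z = 1" for z :: "real^'n"
    proof -
      have "(\<Sum>j\<in>UNIV. (z $ j)\<^sup>2) = 1"
        using that by (simp add: norm_eq_1 inner_vec_def power2_eq_square)
      then have S: "(\<Sum>j\<in>UNIV - {?k}. (z $ j)\<^sup>2) = 1 - (z $ ?k)\<^sup>2"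
        by (subst (asm) sum.remove[of _ ?k]) auto
      show ?thesis unfolding sum_distrib_left[symmetric] S by (simp add: algebra_simps power_add power2_eq_square)
    qed
    then show "AE z in sphere_measure. (\<Sum>j\<in>UNIV - {?k}. (z $ ?k) ^ n * (z $ j)\<^sup>2) = (z $ ?k) ^ n - (z $ ?k) ^ (n + 2)"
      using AE_sphere_measure_norm by (auto elim: eventually_mono)
  qed measurable
  also have "\<dots> = moment TYPE('n) n - moment TYPE('n) (n + 2)"
    unfolding moment_def by (intro Bochner_Integration.integral_diff integrable_sphere_measure continuous_intros)
  finally show ?thesis by simp
qed

text \<open>Integration by parts against the density of one coordinate on the sphere, which for d =
  \<open>CARD('n)\<close> at least 2 is proportional to (1 - t^2) to the power (d - 3)/2. The
  density is never computed: on monomials the identity is the moment recursion.\<close>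

lemma zonal_mean_pearson:
  "zonal_mean TYPE('n::finite) ([:1, 0, -1:] * pderiv p) = (real CARD('n) - 1) * zonal_mean TYPE('n) ([:0, 1:] * p)"
proof -
  have mono: "zonal_mean TYPE('n) ([:1, 0, -1:] * pderiv (monom c n)) = (real CARD('n) - 1) * zonal_mean TYPE('n) ([:0, 1:] * monom c n)" for c n
  proof (cases n)
    case 0
    then show ?thesis using zonal_mean_monom[where 'n = 'n, of 0 0] zonal_mean_monom[where 'n = 'n, of c 1]
      by (simp add: pderiv_monom moment_odd monom_Suc)
  next
    case (Suc k)
    have "[:1, 0, -1:] * pderiv (monom c n) = monom (real n * c) k - monom (real n * c) (k + 2)"
    proof -
      have "pderiv (monom c n) = monom (real n * c) k" using Suc by (simp add: pderiv_monom mult.commute)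
      then show ?thesis by (simp only:) (simp add: monom_Suc numeral_2_eq_2)
    qed
    moreover have "[:0, 1:] * monom c n = monom c (k + 2)" using Suc by (simp add: monom_Suc)
    ultimately show ?thesis using arg_cong[OF moment_recursion[where 'n = 'n, of k], of "\<lambda>x. c * x"] Suc
      by (simp only: zonal_mean_diff zonal_mean_monom) (simp add: algebra_simps)
  qed
  have pderiv_sum: "pderiv (sum f S) = (\<Sum>i\<in>S. pderiv (f i))" for f :: "nat \<Rightarrow> real poly" and S
    by (induction S rule: infinite_finite_induct) (auto simp: pderiv_add)
  have "zonal_mean TYPE('n) ([:1, 0, -1:] * pderiv (\<Sum>i\<le>degree p. monom (coeff p i) i)) =
      (real CARD('n) - 1) * zonal_mean TYPE('n) ([:0, 1:] * (\<Sum>i\<le>degree p. monom (coeff p i) i))"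
    by (simp only: pderiv_sum sum_distrib_left zonal_mean_sum mono)
  then show ?thesis by (simp only: poly_as_sum_of_monoms)
qed

section \<open>Gegenbauer polynomials\<close>

fun gegenbauer_poly :: "real \<Rightarrow> nat \<Rightarrow> real poly" where
  "gegenbauer_poly \<alpha> 0 = 1"
| "gegenbauer_poly \<alpha> (Suc 0) = [:0, 2 * \<alpha>:]"
| "gegenbauer_poly \<alpha> (Suc (Suc n)) = smult (1 / (real n + 2))
     (smult (2 * (real n + 1 + \<alpha>)) ([:0, 1:] * gegenbauer_poly \<alpha> (Suc n)) -
      smult (real n + 2 * \<alpha>) (gegenbauer_poly \<alpha> n))"

lemma poly_gegenbauer_poly: "poly (gegenbauer_poly \<alpha> n) t = gegenbauer \<alpha> n t"
  by (induction \<alpha> n rule: gegenbauer_poly.induct) (simp_all add: mult.assoc)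

lemma gegenbauer_poly_recurrence:
  "(real n + 2) * poly (gegenbauer_poly \<alpha> (Suc (Suc n))) t =
   2 * (real n + 1 + \<alpha>) * t * poly (gegenbauer_poly \<alpha> (Suc n)) t - (real n + 2 * \<alpha>) * poly (gegenbauer_poly \<alpha> n) t"
  by (simp add: field_simps)

lemma smult_gegenbauer_poly_Suc_Suc:
  "smult (real n + 2) (gegenbauer_poly \<alpha> (Suc (Suc n))) =
   smult (2 * (real n + 1 + \<alpha>)) ([:0, 1:] * gegenbauer_poly \<alpha> (Suc n)) - smult (real n + 2 * \<alpha>) (gegenbauer_poly \<alpha> n)"
  by simp

lemma degree_gegenbauer_poly_le: "degree (gegenbauer_poly \<alpha> n) \<le> n"
proof (induction \<alpha> n rule: gegenbauer_poly.induct)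
  case (3 \<alpha> n)
  have "degree ([:0, 1:] * gegenbauer_poly \<alpha> (Suc n)) \<le> Suc (Suc n)"
    using degree_mult_le[of "[:0, 1:]" "gegenbauer_poly \<alpha> (Suc n)"] 3 by simp
  then show ?case using 3
    by (auto intro!: order_trans[OF degree_smult_le] degree_diff_le simp del: mult_pCons_left)
qed auto

lemma coeff_gegenbauer_poly:
  assumes "\<alpha> > 0"
  shows "coeff (gegenbauer_poly \<alpha> n) n > 0"
  using assms
proof (induction \<alpha> n rule: gegenbauer_poly.induct)
  case (3 \<alpha> n)
  have "coeff (gegenbauer_poly \<alpha> n) (Suc (Suc n)) = 0"
    using degree_gegenbauer_poly_le[of \<alpha> n] by (intro coeff_eq_0) auto
  then show ?case using 3 by simp
qed auto

lemma gegenbauer_poly_uminus: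
  "poly (gegenbauer_poly \<alpha> n) (- t) = (- 1) ^ n * poly (gegenbauer_poly \<alpha> n) t"
proof (induction \<alpha> n rule: gegenbauer_poly.induct)
  case (3 \<alpha> n)
  then show ?case by (simp add: algebra_simps)
qed auto

text \<open>A joint induction: the differentiated recurrence and the old second relation give the
  new first one, from which, with both old relations, the new second one follows.\<close>

lemma gegenbauer_poly_deriv_relations:
  shows "poly (pderiv (gegenbauer_poly \<alpha> (Suc n))) t =
     t * poly (pderiv (gegenbauer_poly \<alpha> n)) t + (real n + 2 * \<alpha>) * poly (gegenbauer_poly \<alpha> n) t" (is ?A)
    and "(real n + 1) * poly (gegenbauer_poly \<alpha> (Suc n)) t =
     t * poly (pderiv (gegenbauer_poly \<alpha> (Suc n))) t - poly (pderiv (gegenbauer_poly \<alpha> n)) t" (is ?B)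
proof -
  let ?C = "\<lambda>k. poly (gegenbauer_poly \<alpha> k) t" and ?D = "\<lambda>k. poly (pderiv (gegenbauer_poly \<alpha> k)) t"
  have "?A \<and> ?B"
  proof (induction n)
    case (Suc n)
    define c d e where "c = ?C n" "d = ?C (Suc n)" "e = ?C (Suc (Suc n))"
    define c' d' e' where "c' = ?D n" "d' = ?D (Suc n)" "e' = ?D (Suc (Suc n))"
    note defs = this \<open>c = ?C n\<close> \<open>d = ?C (Suc n)\<close> \<open>e = ?C (Suc (Suc n))\<close>
    have IH: "d' = t * c' + (real n + 2 * \<alpha>) * c" "(real n + 1) * d = t * d' - c'"
      using Suc by (simp_all only: defs)
    have recC: "(real n + 2) * e = 2 * (real n + 1 + \<alpha>) * t * d - (real n + 2 * \<alpha>) * c"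
      using gegenbauer_poly_recurrence[of n \<alpha> t] by (simp only: defs)
    have "(real n + 2) * e' = 2 * (real n + 1 + \<alpha>) * (d + t * d') - (real n + 2 * \<alpha>) * c'"
      using arg_cong[OF smult_gegenbauer_poly_Suc_Suc, of "\<lambda>p. poly (pderiv p) t" n \<alpha>]
      by (simp add: defs pderiv_smult pderiv_diff pderiv_mult pderiv_pCons distrib_left mult_ac del: gegenbauer_poly.simps)
    then have "(real n + 2) * e' = (real n + 2) * (t * d' + (real n + 1 + 2 * \<alpha>) * d)"
      using IH(2) by algebra
    then have A: "e' = t * d' + (real n + 1 + 2 * \<alpha>) * d" by simp
    moreover have "(real n + 2) * e = t * e' - d'" using recC A IH by algebra
    ultimately show ?case by (simp add: defs algebra_simps del: gegenbauer_poly.simps)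
  qed (simp add: pderiv_pCons)
  then show ?A ?B by blast+
qed

text \<open>The two derivative relations combine to a formula for (1 - t^2) C' in terms of two
  consecutive degrees. Differentiating it and eliminating the derivative of the lower degree gives
  the Gegenbauer equation.\<close>

lemma gegenbauer_poly_ode:
  "[:1, 0, -1:] * pderiv (pderiv (gegenbauer_poly \<alpha> n)) =
     smult (2 * \<alpha> + 1) ([:0, 1:] * pderiv (gegenbauer_poly \<alpha> n)) - smult (real n * (real n + 2 * \<alpha>)) (gegenbauer_poly \<alpha> n)"
proof (cases n)
  case (Suc k)
  have "[:1, 0, -1:] * pderiv (gegenbauer_poly \<alpha> (Suc k)) =
      smult (real k + 2 * \<alpha>) (gegenbauer_poly \<alpha> k) - smult (real k + 1) ([:0, 1:] * gegenbauer_poly \<alpha> (Suc k))"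
    (is "?l = ?r")
  proof -
    have "poly ?l t = poly ?r t" for t
      using gegenbauer_poly_deriv_relations[where \<alpha> = \<alpha> and n = k and t = t]
      by (simp add: algebra_simps del: gegenbauer_poly.simps) algebra
    then show ?thesis by (simp flip: poly_eq_poly_eq_iff add: fun_eq_iff)
  qed
  then have "pderiv ?l = pderiv ?r" by simp
  then have eq: "poly (pderiv ?l) t = poly (pderiv ?r) t" for t by simp
  show ?thesis (is "?L = ?R")
  proof -
    have "poly ?L t = poly ?R t" for t
    proof -
      define c d c' d' d'' where "c = poly (gegenbauer_poly \<alpha> k) t" "d = poly (gegenbauer_poly \<alpha> (Suc k)) t"
        "c' = poly (pderiv (gegenbauer_poly \<alpha> k)) t" "d' = poly (pderiv (gegenbauer_poly \<alpha> (Suc k))) t"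
        "d'' = poly (pderiv (pderiv (gegenbauer_poly \<alpha> (Suc k)))) t"
      note defs = this
      have 1: "(1 - t * t) * d'' - 2 * t * d' = (real k + 2 * \<alpha>) * c' - (real k + 1) * (d + t * d')"
        using eq[of t] unfolding pderiv_mult pderiv_diff pderiv_smult
        by (simp add: defs pderiv_pCons algebra_simps del: gegenbauer_poly.simps)
      have 2: "(real k + 1) * d = t * d' - c'"
        using gegenbauer_poly_deriv_relations(2)[where \<alpha> = \<alpha> and n = k and t = t] by (simp only: defs)
      have "(1 - t * t) * d'' = (2 * \<alpha> + 1) * t * d' - (real k + 1) * (real k + 1 + 2 * \<alpha>) * d"
        using 1 2 by algebra
      then show ?thesis unfolding Suc by (simp add: defs algebra_simps del: gegenbauer_poly.simps)
    qed
    then show ?thesis by (simp flip: poly_eq_poly_eq_iff add: fun_eq_iff)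
  qed
qed simp

text \<open>\<open>E\<close> is the Sonine function of the Gegenbauer equation: substituting the
  equation for (1 - t^2) C'' leaves the derivative 4 \<alpha> t C'^2 / \<lambda> with \<lambda> = n
  (n + 2 \<alpha>), which is nonnegative for t \<ge> 0.\<close>

lemma gegenbauer_poly_energy_mono:
  assumes "\<alpha> > 0" "n \<ge> 1" "0 \<le> s" "s \<le> t"
  defines "E \<equiv> gegenbauer_poly \<alpha> n * gegenbauer_poly \<alpha> n +
    smult (1 / (real n * (real n + 2 * \<alpha>))) ([:1, 0, -1:] * (pderiv (gegenbauer_poly \<alpha> n) * pderiv (gegenbauer_poly \<alpha> n)))"
  shows "poly E s \<le> poly E t"
proof (rule DERIV_nonneg_imp_nondecreasing[OF assms(4)])
  fix x assume x: "s \<le> x" "x \<le> t"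
  define ev where "ev = real n * (real n + 2 * \<alpha>)"
  have ev: "ev > 0" using assms by (simp add: ev_def)
  define c c' c'' where "c = poly (gegenbauer_poly \<alpha> n) x" "c' = poly (pderiv (gegenbauer_poly \<alpha> n)) x"
    "c'' = poly (pderiv (pderiv (gegenbauer_poly \<alpha> n))) x"
  note defs = this
  have "poly ([:1, 0, -1:] * pderiv (pderiv (gegenbauer_poly \<alpha> n))) x =
     poly (smult (2 * \<alpha> + 1) ([:0, 1:] * pderiv (gegenbauer_poly \<alpha> n)) - smult ev (gegenbauer_poly \<alpha> n)) x"
    by (simp only: gegenbauer_poly_ode ev_def)
  then have ode: "(1 - x * x) * c'' = (2 * \<alpha> + 1) * x * c' - ev * c"
    by (simp add: defs algebra_simps)
  have "poly (pderiv E) x = 2 * c * c' + 1 / ev * (2 * c' * ((1 - x * x) * c'') - 2 * x * c' * c')"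
    unfolding E_def ev_def[symmetric] pderiv_add pderiv_smult pderiv_mult
    by (simp add: defs pderiv_pCons algebra_simps)
  also have "\<dots> = 4 * \<alpha> * x * c' * c' / ev"
    using ev unfolding ode by (simp add: field_simps)
  also have "\<dots> \<ge> 0" using ev assms x by (auto intro!: divide_nonneg_pos mult_nonneg_nonneg simp: mult.assoc)
  finally show "\<exists>y. (poly E has_real_derivative y) (at x) \<and> 0 \<le> y"
    using poly_DERIV by blast
qed

text \<open>At 1 the derivative relations give consecutive values the ratio (n + 2 \<alpha>) / (n +
  1), which is at least 1.\<close>

lemma gegenbauer_poly_pos: "\<alpha> > 0 \<Longrightarrow> 2 * \<alpha> \<ge> 1 \<Longrightarrow> poly (gegenbauer_poly \<alpha> n) 1 \<ge> 1"
proof -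
  assume \<alpha>: "\<alpha> > 0" "2 * \<alpha> \<ge> 1"
  have step: "(real n + 1) * poly (gegenbauer_poly \<alpha> (Suc n)) 1 = (real n + 2 * \<alpha>) * poly (gegenbauer_poly \<alpha> n) 1" for n
    using gegenbauer_poly_deriv_relations[where \<alpha> = \<alpha> and n = n and t = 1] by simp
  show ?thesis
  proof (induction n)
    case (Suc n)
    have "(real n + 1) * 1 \<le> (real n + 2 * \<alpha>) * poly (gegenbauer_poly \<alpha> n) 1"
      using Suc \<alpha> by (intro mult_mono) auto
    then show ?case unfolding step[symmetric] by simp
  qed simp
qed

section \<open>Cosine expansions of Gegenbauer polynomials\<close>

inductive cosine_sum :: "nat \<Rightarrow> (real \<Rightarrow> real) \<Rightarrow> bool" for n where
  zero: "cosine_sum n (\<lambda>\<phi>. 0)"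
| add: "cosine_sum n g \<Longrightarrow> r \<le> n \<Longrightarrow> even (n - r) \<Longrightarrow> cosine_sum n (\<lambda>\<phi>. g \<phi> + c * cos (real r * \<phi>))"

lemma cosine_sum_add:
  assumes "cosine_sum n g" "cosine_sum n h"
  shows "cosine_sum n (\<lambda>\<phi>. h \<phi> + g \<phi>)"
  using assms(1)
proof induction
  case (add g r c)
  have "cosine_sum n (\<lambda>\<phi>. (h \<phi> + g \<phi>) + c * cos (real r * \<phi>))"
    using add by (intro cosine_sum.add)
  then show ?case by (simp add: add.assoc)
qed (use assms(2) in simp)

lemma cosine_sum_cmult:
  assumes "cosine_sum n g"
  shows "cosine_sum n (\<lambda>\<phi>. k * g \<phi>)"
  using assms
proof induction
  case (add g r c)
  have "cosine_sum n (\<lambda>\<phi>. k * g \<phi> + (k * c) * cos (real r * \<phi>))"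
    using add by (intro cosine_sum.add)
  then show ?case by (simp add: algebra_simps)
qed (simp add: cosine_sum.zero)

lemma cosine_sum_Suc_Suc:
  assumes "cosine_sum n g"
  shows "cosine_sum (Suc (Suc n)) g"
  using assms
proof induction
  case (add g r c)
  then show ?case by (intro cosine_sum.add) (auto simp: Suc_diff_le)
qed (rule cosine_sum.zero)

lemma cosine_sum_cos_mult:
  assumes "cosine_sum n g"
  shows "cosine_sum (Suc n) (\<lambda>\<phi>. cos \<phi> * g \<phi>)"
  using assms
proof induction
  case (add g r c)
  \<comment> \<open>The frequency -1 arising from \<open>r = 0\<close> is folded to 1, which
    respects both the parity and the bound.\<close>
  define r' where "r' = (if r = 0 then 1 else r - 1)"
  have r': "r' \<le> Suc n" "even (Suc n - r')"
    using add.hyps by (auto simp: r'_def Suc_diff_le)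
  have cos_r': "cos (real r' * \<phi>) = cos (real r * \<phi> - \<phi>)" for \<phi>
    by (cases r) (auto simp: r'_def algebra_simps)
  have "cosine_sum (Suc n) (\<lambda>\<phi>. (cos \<phi> * g \<phi> + c / 2 * cos (real (Suc r) * \<phi>)) + c / 2 * cos (real r' * \<phi>))"
    using add r' by (intro cosine_sum.add) (auto simp: Suc_diff_le)
  moreover have "(cos \<phi> * g \<phi> + c / 2 * cos (real (Suc r) * \<phi>)) + c / 2 * cos (real r' * \<phi>) =
      cos \<phi> * (g \<phi> + c * cos (real r * \<phi>))" for \<phi>
    unfolding cos_r' by (simp add: algebra_simps cos_add cos_diff)
  ultimately show ?case by simp
qed (simp add: cosine_sum.zero)

text \<open>Multiplication by cos shifts every frequency by one, and the recurrence links a degree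
  to the one lower by two, so the parity survives. Bound and parity together decide which cosine
  weights annihilate a degree.\<close>

lemma cosine_sum_gegenbauer_poly: "cosine_sum n (\<lambda>\<phi>. poly (gegenbauer_poly \<alpha> n) (cos \<phi>))"
proof (induction \<alpha> n rule: gegenbauer_poly.induct)
  case (1 \<alpha>)
  show ?case using cosine_sum.add[OF cosine_sum.zero, of 0 0 1] by simp
next
  case (2 \<alpha>)
  show ?case using cosine_sum.add[OF cosine_sum.zero, of 1 1 "2 * \<alpha>"] by (simp add: mult_ac)
next
  case (3 \<alpha> n)
  have "cosine_sum (Suc (Suc n)) (\<lambda>\<phi>. 1 / (real n + 2) * (2 * (real n + 1 + \<alpha>) * (cos \<phi> * poly (gegenbauer_poly \<alpha> (Suc n)) (cos \<phi>))
     + - (real n + 2 * \<alpha>) * poly (gegenbauer_poly \<alpha> n) (cos \<phi>)))"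
    by (intro cosine_sum_cmult cosine_sum_add cosine_sum_cos_mult[OF 3(1)] cosine_sum_Suc_Suc 3)
  then show ?case by (simp add: algebra_simps)
qed

section \<open>Orthogonality and the reproducing formula\<close>

lemma zonal_mean_gegenbauer_orthogonal:
  assumes \<alpha>: "2 * \<alpha> = real CARD('n::finite) - 2" "\<alpha> > 0" and kl: "k \<noteq> l"
  shows "zonal_mean TYPE('n) (gegenbauer_poly \<alpha> k * gegenbauer_poly \<alpha> l) = 0"
proof -
  define C where "C = gegenbauer_poly \<alpha>"
  define ev where "ev n = real n * (real n + 2 * \<alpha>)" for n
  define w :: "real poly" where "w = [:1, 0, -1:]"
  have ode: "w * pderiv (pderiv (C n)) = smult (2 * \<alpha> + 1) ([:0, 1:] * pderiv (C n)) - smult (ev n) (C n)" for n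
    unfolding C_def ev_def w_def by (rule gegenbauer_poly_ode)
  \<comment> \<open>The Wronskian. The Pearson identity for it is self-adjointness of the
    differential operator and leaves the difference of the eigenvalues times the mean of the
    product.\<close>
  define q where "q = C k * pderiv (C l) - C l * pderiv (C k)"
  have "w * pderiv q = C k * (w * pderiv (pderiv (C l))) - C l * (w * pderiv (pderiv (C k)))"
    by (simp add: q_def pderiv_diff pderiv_mult algebra_simps)
  also have "\<dots> = smult (2 * \<alpha> + 1) ([:0, 1:] * q) + smult (ev k - ev l) (C k * C l)"
    unfolding ode q_def by (simp add: algebra_simps smult_diff_right smult_diff_left smult_add_left)
  finally have "zonal_mean TYPE('n) (w * pderiv q) = (2 * \<alpha> + 1) * zonal_mean TYPE('n) ([:0, 1:] * q) + (ev k - ev l) * zonal_mean TYPE('n) (C k * C l)"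
    by (simp only: zonal_mean_add zonal_mean_smult)
  moreover have "zonal_mean TYPE('n) (w * pderiv q) = (2 * \<alpha> + 1) * zonal_mean TYPE('n) ([:0, 1:] * q)"
    unfolding w_def zonal_mean_pearson using \<alpha> by simp
  moreover have "ev k \<noteq> ev l"
  proof -
    have "ev a < ev b" if "a < b" for a b
      using that \<alpha>(2) unfolding ev_def by (intro mult_strict_mono) auto
    then show ?thesis using kl by (metis less_irrefl linorder_neqE_nat)
  qed
  ultimately show ?thesis by (simp add: C_def)
qed

text \<open>The cross mean \<open>g\<close> is evaluated twice, by the recurrences for degrees
  \<open>l + 1\<close> and \<open>l + 2\<close>. Comparison shows that
  \<open>(real l + \<alpha>) * h l\<close> and the value at 1 grow by the same factor.\<close>

lemma zonal_mean_gegenbauer_square: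
  assumes \<alpha>: "2 * \<alpha> = real CARD('n::finite) - 2" "\<alpha> > 0"
  shows "(real l + \<alpha>) * zonal_mean TYPE('n) (gegenbauer_poly \<alpha> l * gegenbauer_poly \<alpha> l) = \<alpha> * poly (gegenbauer_poly \<alpha> l) 1"
proof (induction l)
  case 0
  show ?case by (simp add: zonal_mean_one)
next
  case (Suc l)
  define C where "C = gegenbauer_poly \<alpha>"
  define h where "h n = zonal_mean TYPE('n) (C n * C n)" for n
  define g where "g = zonal_mean TYPE('n) ([:0, 1:] * C l * C (Suc l))"
  have orth: "zonal_mean TYPE('n) (C a * C b) = 0" if "a \<noteq> b" for a b
    unfolding C_def using that by (rule zonal_mean_gegenbauer_orthogonal[OF \<alpha>])
  have rec: "smult (real n + 2) (C (Suc (Suc n))) = smult (2 * (real n + 1 + \<alpha>)) ([:0, 1:] * C (Suc n)) - smult (real n + 2 * \<alpha>) (C n)" for n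
    unfolding C_def by (rule smult_gegenbauer_poly_Suc_Suc)
  have 1: "(real l + 1) * h (Suc l) = 2 * (real l + \<alpha>) * g"
  \<comment> \<open>The recurrence for degree \<open>Suc l\<close> refers to two predecessors, so
    \<open>l = 0\<close> is read off from the explicit linear polynomial.\<close>
  proof (cases l)
    case 0
    have "C (Suc 0) * C (Suc 0) = smult (2 * \<alpha>) ([:0, 1:] * C 0 * C (Suc 0))" by (simp add: C_def)
    then show ?thesis unfolding h_def g_def 0 by (simp only: zonal_mean_smult) simp
  next
    case (Suc k)
    have "smult (real k + 2) (C (Suc l) * C (Suc l)) = smult (real k + 2) (C (Suc (Suc k))) * C (Suc l)"
      unfolding Suc by simp
    also have "\<dots> = smult (2 * (real k + 1 + \<alpha>)) ([:0, 1:] * C l * C (Suc l)) - smult (real k + 2 * \<alpha>) (C k * C (Suc l))"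
      unfolding rec Suc by (simp add: algebra_simps)
    finally have "zonal_mean TYPE('n) (smult (real k + 2) (C (Suc l) * C (Suc l))) =
       zonal_mean TYPE('n) (smult (2 * (real k + 1 + \<alpha>)) ([:0, 1:] * C l * C (Suc l)) - smult (real k + 2 * \<alpha>) (C k * C (Suc l)))" by simp
    then show ?thesis using Suc by (simp only: zonal_mean_diff zonal_mean_smult orth g_def h_def) (simp add: add.commute orth)
  qed
  have "smult (real l + 2) (C (Suc (Suc l)) * C l) = smult (real l + 2) (C (Suc (Suc l))) * C l" by simp
  also have "\<dots> = smult (2 * (real l + 1 + \<alpha>)) ([:0, 1:] * C l * C (Suc l)) - smult (real l + 2 * \<alpha>) (C l * C l)"
    unfolding rec by (simp add: algebra_simps)
  finally have "zonal_mean TYPE('n) (smult (real l + 2) (C (Suc (Suc l)) * C l)) =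
     zonal_mean TYPE('n) (smult (2 * (real l + 1 + \<alpha>)) ([:0, 1:] * C l * C (Suc l)) - smult (real l + 2 * \<alpha>) (C l * C l))" by simp
  then have 2: "2 * (real l + 1 + \<alpha>) * g = (real l + 2 * \<alpha>) * h l"
    by (simp only: zonal_mean_diff zonal_mean_smult g_def h_def) (simp add: orth)
  have 3: "(real l + 1) * poly (C (Suc l)) 1 = (real l + 2 * \<alpha>) * poly (C l) 1"
    unfolding C_def using gegenbauer_poly_deriv_relations[where \<alpha> = \<alpha> and n = l and t = 1]
    by (simp del: gegenbauer_poly.simps)
  have 4: "(real l + \<alpha>) * h l = \<alpha> * poly (C l) 1" using Suc by (simp add: h_def C_def)
  have "(real l + 1) * ((real l + 1 + \<alpha>) * h (Suc l)) = (real l + 1) * (\<alpha> * poly (C (Suc l)) 1)"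
    using 1 2 3 4 by algebra
  then have "(real l + 1 + \<alpha>) * h (Suc l) = \<alpha> * poly (C (Suc l)) 1" by simp
  then show ?case by (simp add: h_def C_def add.commute)
qed

lemma zonal_mean_gegenbauer_square_pos:
  assumes \<alpha>: "2 * \<alpha> = real CARD('n::finite) - 2" "2 * \<alpha> \<ge> 1"
  shows "zonal_mean TYPE('n) (gegenbauer_poly \<alpha> l * gegenbauer_poly \<alpha> l) > 0"
proof -
  have "0 < \<alpha> * poly (gegenbauer_poly \<alpha> l) 1" using gegenbauer_poly_pos[of \<alpha> l] \<alpha> by simp
  then have "0 < (real l + \<alpha>) * zonal_mean TYPE('n) (gegenbauer_poly \<alpha> l * gegenbauer_poly \<alpha> l)"
    using zonal_mean_gegenbauer_square[of \<alpha> l, where 'n = 'n] \<alpha> by simp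
  then show ?thesis using \<alpha> by (simp add: zero_less_mult_iff)
qed

lemma gegenbauer_expansion:
  assumes "\<alpha> > 0" "degree H \<le> d"
  shows "\<exists>b. H = (\<Sum>j\<le>d. smult (b j) (gegenbauer_poly \<alpha> j))"
  using assms(2)
proof (induction d arbitrary: H)
  case 0
  then obtain c where "H = [:c:]" using degree_eq_zeroE by blast
  then show ?case by (intro exI[of _ "\<lambda>_. c"]) simp
next
  case (Suc d)
  let ?C = "gegenbauer_poly \<alpha> (Suc d)"
  define c where "c = coeff H (Suc d) / coeff ?C (Suc d)"
  have nz: "coeff ?C (Suc d) \<noteq> 0" using coeff_gegenbauer_poly[OF assms(1), of "Suc d"] by simp
  have "coeff (H - smult c ?C) i = 0" if "i > d" for i
  proof (cases "i = Suc d")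
    case True
    then show ?thesis using nz by (simp add: c_def)
  next
    case False
    then have "i > Suc d" using that by simp
    then show ?thesis using Suc.prems degree_gegenbauer_poly_le[of \<alpha> "Suc d"] by (simp add: coeff_eq_0 del: gegenbauer_poly.simps)
  qed
  then have "degree (H - smult c ?C) \<le> d" by (intro degree_le) auto
  then obtain b where b: "H - smult c ?C = (\<Sum>j\<le>d. smult (b j) (gegenbauer_poly \<alpha> j))" using Suc.IH by blast
  have "H = (\<Sum>j\<le>Suc d. smult ((b(Suc d := c)) j) (gegenbauer_poly \<alpha> j))"
    using b by (simp add: algebra_simps del: gegenbauer_poly.simps)
  then show ?case by blast
qed

lemma zonal_mean_gegenbauer_low_degree:
  assumes \<alpha>: "2 * \<alpha> = real CARD('n::finite) - 2" "\<alpha> > 0" and H: "degree H < l"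
  shows "zonal_mean TYPE('n) (H * gegenbauer_poly \<alpha> l) = 0"
proof -
  obtain b where b: "H = (\<Sum>j\<le>degree H. smult (b j) (gegenbauer_poly \<alpha> j))"
    using gegenbauer_expansion[OF \<alpha>(2) order_refl] by blast
  have "H * gegenbauer_poly \<alpha> l = (\<Sum>j\<le>degree H. smult (b j) (gegenbauer_poly \<alpha> j * gegenbauer_poly \<alpha> l))"
    by (subst b) (simp add: sum_distrib_right)
  then have "zonal_mean TYPE('n) (H * gegenbauer_poly \<alpha> l) = (\<Sum>j\<le>degree H. b j * zonal_mean TYPE('n) (gegenbauer_poly \<alpha> j * gegenbauer_poly \<alpha> l))"
    by (simp only: zonal_mean_sum zonal_mean_smult)
  also have "\<dots> = 0" using H by (intro sum.neutral) (auto simp: zonal_mean_gegenbauer_orthogonal[OF \<alpha>])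
  finally show ?thesis .
qed

lemma borel_measurable_pair_sphere_measure:
  fixes F :: "real^'n \<Rightarrow> real^'n \<Rightarrow> real"
  assumes F: "continuous_on UNIV (\<lambda>p. F (fst p) (snd p))"
  shows "case_prod F \<in> borel_measurable (sphere_measure \<Otimes>\<^sub>M sphere_measure)"
proof -
  have "sets (sphere_measure \<Otimes>\<^sub>M sphere_measure) = sets (borel :: ((real^'n) \<times> (real^'n)) measure)"
    unfolding borel_prod[symmetric] by (intro sets_pair_measure_cong sets_sphere_measure)
  moreover have "case_prod F \<in> borel_measurable borel"
    using borel_measurable_continuous_onI[OF F] by (simp add: case_prod_beta')
  ultimately show ?thesis by (subst measurable_cong_sets[OF _ refl])
qed

lemma borel_measurable_mean:
  fixes F :: "real^'n \<Rightarrow> real^'n \<Rightarrow> real"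
  assumes "continuous_on UNIV (\<lambda>p. F (fst p) (snd p))"
  shows "(\<lambda>y. mean (F y)) \<in> borel_measurable sphere_measure"
proof -
  interpret prob_space "sphere_measure :: (real^'n) measure" by (rule prob_space_sphere_measure)
  show ?thesis using assms by (intro borel_measurable_lebesgue_integral borel_measurable_pair_sphere_measure)
qed

lemma mean_Fubini:
  fixes F :: "real^'n \<Rightarrow> real^'n \<Rightarrow> real"
  assumes F: "continuous_on UNIV (\<lambda>p. F (fst p) (snd p))"
  shows "mean (\<lambda>y. mean (\<lambda>z. F y z)) = mean (\<lambda>z. mean (\<lambda>y. F y z))"
proof -
  let ?S = "sphere_measure :: (real^'n) measure"
  interpret S: prob_space ?S by (rule prob_space_sphere_measure)
  interpret P: pair_prob_space ?S ?S ..
  note meas = borel_measurable_pair_sphere_measure[OF F]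
  have "compact ((\<lambda>p. F (fst p) (snd p)) ` (cball 0 1 \<times> cball 0 1))"
    using F by (intro compact_continuous_image compact_Times) (auto intro: continuous_on_subset)
  then obtain B where B: "\<And>y z. norm y \<le> 1 \<Longrightarrow> norm z \<le> 1 \<Longrightarrow> norm (F y z) \<le> B"
    by (force dest!: compact_imp_bounded simp: bounded_iff)
  have "AE p in ?S \<Otimes>\<^sub>M ?S. norm (case_prod F p) \<le> B"
  proof (rule P.AE_pair_measure)
    show "{p \<in> space (?S \<Otimes>\<^sub>M ?S). norm (case_prod F p) \<le> B} \<in> sets (?S \<Otimes>\<^sub>M ?S)"
      using meas by measurable
    show "AE y in ?S. AE z in ?S. norm (case_prod F (y, z)) \<le> B"
      using AE_sphere_measure_norm
    proof eventually_elim
      case (elim y)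
      show ?case using AE_sphere_measure_norm by eventually_elim (use elim B in simp)
    qed
  qed
  then have "integrable (?S \<Otimes>\<^sub>M ?S) (case_prod F)"
    using meas by (intro P.integrable_const_bound)
  then show ?thesis by (rule P.Fubini_integral[symmetric])
qed

text \<open>The convolution is a zonal polynomial of degree at most \<open>l\<close>. Its component along a Gegenbauer
  polynomial of degree \<open>j < l\<close> vanishes: by Fubini it is the mean of the degree \<open>l\<close> polynomial times a
  zonal polynomial of degree at most \<open>j\<close>.\<close>

theorem mean_gegenbauer_convolution:
  fixes x y :: "real^'n"
  assumes \<alpha>: "2 * \<alpha> = real CARD('n) - 2" "2 * \<alpha> \<ge> 1" and x: "norm x = 1" and y: "norm y = 1"
  shows "mean (\<lambda>z. poly (gegenbauer_poly \<alpha> l) (x \<bullet> z) * poly (gegenbauer_poly \<alpha> l) (y \<bullet> z)) =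
     \<alpha> / (real l + \<alpha>) * poly (gegenbauer_poly \<alpha> l) (x \<bullet> y)"
proof -
  define C where "C = gegenbauer_poly \<alpha>"
  have pos: "\<alpha> > 0" using \<alpha> by simp
  have deg: "degree (C j) \<le> j" for j unfolding C_def by (rule degree_gegenbauer_poly_le)
  obtain H where H: "degree H \<le> degree (C l)" "\<And>x y :: real^'n. norm x = 1 \<Longrightarrow> norm y = 1 \<Longrightarrow>
      mean (\<lambda>z. poly (C l) (x \<bullet> z) * poly (C l) (y \<bullet> z)) = poly H (x \<bullet> y)"
    using mean_poly_inner[where p = "C l" and q = "C l"] by blast
  have "degree H \<le> l" using H(1) deg order_trans by blast
  then obtain b where b: "H = (\<Sum>j\<le>l. smult (b j) (C j))"
    using gegenbauer_expansion[OF pos] unfolding C_def by blast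
  have "b j = 0" if j: "j < l" for j
  proof -
    obtain K where K: "degree K \<le> degree (C j)" "\<And>x y :: real^'n. norm x = 1 \<Longrightarrow> norm y = 1 \<Longrightarrow>
        mean (\<lambda>z. poly (C l) (x \<bullet> z) * poly (C j) (y \<bullet> z)) = poly K (x \<bullet> y)"
      using mean_poly_inner[where p = "C l" and q = "C j"] by blast
    have "zonal_mean TYPE('n) (H * C j) = mean (\<lambda>w. poly (H * C j) (x \<bullet> w))" by (rule mean_poly[OF x, symmetric])
    also have "\<dots> = mean (\<lambda>w. mean (\<lambda>z. poly (C l) (x \<bullet> z) * poly (C l) (w \<bullet> z) * poly (C j) (x \<bullet> w)))"
    proof (rule integral_cong_AE)
      show "AE w in sphere_measure. poly (H * C j) (x \<bullet> w) =
          mean (\<lambda>z. poly (C l) (x \<bullet> z) * poly (C l) (w \<bullet> z) * poly (C j) (x \<bullet> w))"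
        using AE_sphere_measure_norm by eventually_elim (simp add: H(2)[OF x])
      show "(\<lambda>w. mean (\<lambda>z. poly (C l) (x \<bullet> z) * poly (C l) (w \<bullet> z) * poly (C j) (x \<bullet> w))) \<in> borel_measurable sphere_measure"
        by (intro borel_measurable_mean continuous_intros)
    qed (intro borel_measurable_integrable integrable_sphere_measure continuous_intros)
    also have "\<dots> = mean (\<lambda>z. mean (\<lambda>w. poly (C l) (x \<bullet> z) * poly (C l) (w \<bullet> z) * poly (C j) (x \<bullet> w)))"
      by (intro mean_Fubini continuous_intros)
    also have "\<dots> = mean (\<lambda>z. poly (K * C l) (x \<bullet> z))"
    proof (rule integral_cong_AE)
      show "AE z in sphere_measure. mean (\<lambda>w. poly (C l) (x \<bullet> z) * poly (C l) (w \<bullet> z) * poly (C j) (x \<bullet> w)) =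
         poly (K * C l) (x \<bullet> z)"
        using AE_sphere_measure_norm
      proof eventually_elim
        case (elim z)
        have "mean (\<lambda>w. poly (C l) (x \<bullet> z) * poly (C l) (w \<bullet> z) * poly (C j) (x \<bullet> w)) =
           poly (C l) (x \<bullet> z) * mean (\<lambda>w. poly (C l) (z \<bullet> w) * poly (C j) (x \<bullet> w))"
          by (simp add: mult.assoc inner_commute)
        then show ?case using K(2)[OF elim x] by (simp add: inner_commute)
      qed
    next
      show "(\<lambda>z. mean (\<lambda>w. poly (C l) (x \<bullet> z) * poly (C l) (w \<bullet> z) * poly (C j) (x \<bullet> w))) \<in> borel_measurable sphere_measure"
        by (intro borel_measurable_mean continuous_intros)
    qed (intro borel_measurable_integrable integrable_sphere_measure continuous_intros)
    also have "\<dots> = zonal_mean TYPE('n) (K * C l)" by (rule mean_poly[OF x])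
    also have "\<dots> = 0" unfolding C_def
    proof (rule zonal_mean_gegenbauer_low_degree[OF \<alpha>(1) pos])
      show "degree K < l" using K(1) deg[of j] j by simp
    qed
    finally have "0 = zonal_mean TYPE('n) (\<Sum>i\<le>l. smult (b i) (C i * C j))" unfolding b by (simp add: sum_distrib_right)
    also have "\<dots> = (\<Sum>i\<le>l. b i * zonal_mean TYPE('n) (C i * C j))" by (simp only: zonal_mean_sum zonal_mean_smult)
    also have "\<dots> = (\<Sum>i\<le>l. if i = j then b j * zonal_mean TYPE('n) (C j * C j) else 0)"
      unfolding C_def by (intro sum.cong refl) (auto simp: zonal_mean_gegenbauer_orthogonal[OF \<alpha>(1) pos])
    also have "\<dots> = b j * zonal_mean TYPE('n) (C j * C j)" using j by simp
    finally show ?thesis using zonal_mean_gegenbauer_square_pos[OF \<alpha>, of j] unfolding C_def by simp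
  qed
  then have "H = smult (b l) (C l)" unfolding b
    by (subst sum.remove[of _ l]) (auto intro!: sum.neutral)
  then have conv: "mean (\<lambda>z. poly (C l) (x \<bullet> z) * poly (C l) (y \<bullet> z)) = b l * poly (C l) (x \<bullet> y)"
    if "norm x = 1" "norm y = 1" for x y :: "real^'n" using H(2)[OF that] by simp
  \<comment> \<open>Setting \<open>y = x\<close> determines the remaining constant, since the mean
    square is known.\<close>
  have "zonal_mean TYPE('n) (C l * C l) = b l * poly (C l) 1"
    using conv[OF x x] mean_poly[OF x, of "C l * C l"] x by (simp add: norm_eq_1)
  then have "((real l + \<alpha>) * b l - \<alpha>) * poly (C l) 1 = 0"
    using zonal_mean_gegenbauer_square[OF \<alpha>(1) pos, of l] unfolding C_def by (simp add: algebra_simps)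
  moreover have "poly (C l) 1 > 0" using gegenbauer_poly_pos[OF pos \<alpha>(2), of l] unfolding C_def by simp
  ultimately have "(real l + \<alpha>) * b l - \<alpha> = 0" by (metis less_irrefl mult_eq_0_iff)
  then have "b l = \<alpha> / (real l + \<alpha>)" using pos by (simp add: field_simps)
  then show ?thesis using conv[OF x y] by (simp add: C_def)
qed

text \<open>By the reproducing formula, the form times \<alpha> / (l + \<alpha>) is the mean over
  \<open>z\<close> of a square.\<close>

theorem gegenbauer_positive_definite:
  fixes x :: "'i \<Rightarrow> real^'n"
  assumes \<alpha>: "2 * \<alpha> = real CARD('n) - 2" "2 * \<alpha> \<ge> 1" and x: "\<And>i. i \<in> I \<Longrightarrow> norm (x i) = 1"
  shows "(\<Sum>i\<in>I. \<Sum>j\<in>I. c i * c j * poly (gegenbauer_poly \<alpha> l) (x i \<bullet> x j)) \<ge> 0"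
proof -
  let ?C = "poly (gegenbauer_poly \<alpha> l)"
  have pos: "\<alpha> / (real l + \<alpha>) > 0" using \<alpha> by simp
  have "\<alpha> / (real l + \<alpha>) * (\<Sum>i\<in>I. \<Sum>j\<in>I. c i * c j * ?C (x i \<bullet> x j)) =
     (\<Sum>i\<in>I. \<Sum>j\<in>I. c i * c j * (\<alpha> / (real l + \<alpha>) * ?C (x i \<bullet> x j)))"
    by (simp only: sum_distrib_left mult_ac)
  also have "\<dots> = (\<Sum>i\<in>I. \<Sum>j\<in>I. mean (\<lambda>z. c i * c j * (?C (x i \<bullet> z) * ?C (x j \<bullet> z))))"
    using mean_gegenbauer_convolution[OF \<alpha> x x] by (intro sum.cong refl) simp
  also have "\<dots> = mean (\<lambda>z. \<Sum>i\<in>I. \<Sum>j\<in>I. c i * c j * (?C (x i \<bullet> z) * ?C (x j \<bullet> z)))"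
    by (subst Bochner_Integration.integral_sum, (intro integrable_sphere_measure continuous_intros)[1],
        subst Bochner_Integration.integral_sum, (intro integrable_sphere_measure continuous_intros)[1]) simp
  also have "\<dots> = mean (\<lambda>z. (\<Sum>i\<in>I. c i * ?C (x i \<bullet> z))\<^sup>2)"
    by (simp add: power2_eq_square sum_product mult_ac)
  also have "\<dots> \<ge> 0" by (intro integral_nonneg_AE) auto
  finally show ?thesis using pos unfolding zero_le_mult_iff by linarith
qed

section \<open>Decay of the normalized Gegenbauer polynomials\<close>

lemma measure_cap_pos:
  assumes "s < 1"
  shows "measure (sphere_measure :: (real^'n) measure) {z. z $ k > s} > 0"
proof -
  let ?B = "ball (0 :: real^'n) 1"
  interpret prob_space "sphere_measure :: (real^'n) measure" by (rule prob_space_sphere_measure)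
  \<comment> \<open>An open cone inside the ball that projects into the cap; the condition
    \<open>z $ k > 0\<close> keeps it away from the origin.\<close>
  define V where "V = {z :: real^'n. z $ k > s * norm z \<and> z $ k > 0} \<inter> ?B"
  have "open V" unfolding V_def by (intro open_Int open_Collect_conj open_Collect_less continuous_intros) auto
  moreover have "(1 / 2) *\<^sub>R axis k 1 \<in> V" using assms by (simp add: V_def)
  ultimately obtain e where e: "e > 0" "ball ((1 / 2) *\<^sub>R axis k 1) e \<subseteq> V"
    by (meson open_contains_ball)
  have "s < sgn z $ k" if "s * norm z < z $ k" "0 < z $ k" for z :: "real^'n"
  proof -
    have "norm z > 0" using that(2) by auto
    then have "s < z $ k / norm z" using that(1) by (simp add: pos_less_divide_eq)
    then show ?thesis by (simp add: sgn_div_norm divide_inverse mult.commute)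
  qed
  then have "V \<subseteq> ?B \<inter> sgn -` {z. z $ k > s}" by (auto simp: V_def)
  moreover have meas: "{z :: real^'n. z $ k > s} \<in> sets borel" by measurable
  moreover have meas': "sgn -` {z :: real^'n. z $ k > s} \<in> sets borel"
    using measurable_sets[OF borel_measurable_sgn meas] by simp
  ultimately have "emeasure lborel (ball ((1 / 2) *\<^sub>R axis k 1 :: real^'n) e) \<le> emeasure lborel (?B \<inter> sgn -` {z. z $ k > s})"
    using e by (intro emeasure_mono) auto
  then have "emeasure lborel (?B \<inter> sgn -` {z. z $ k > s}) \<noteq> 0"
    using emeasure_lborel_ball_pos[OF e(1), of "(1 / 2) *\<^sub>R axis k 1 :: real^'n"] by auto
  then have "emeasure (sphere_measure :: (real^'n) measure) {z. z $ k > s} \<noteq> 0"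
    unfolding sphere_measure_def using meas meas' emeasure_lborel_ball_finite[of "0 :: real^'n" 1]
    by (simp add: emeasure_distr ennreal_divide_eq_0_iff less_top)
  then show ?thesis by (metis emeasure_eq_measure ennreal_0 measure_nonneg less_le)
qed

text \<open>With \<open>\<lambda> = l (l + 2 \<alpha>)\<close>, the energy \<open>C\<^sup>2 + (1 - t\<^sup>2) C'\<^sup>2 / \<lambda>\<close> increases on \<open>[0, 1]\<close>, so its value at \<open>\<bar>s\<bar>\<close>
  bounds it from below on a cap; its mean is twice that of \<open>C\<^sup>2\<close>.\<close>

lemma gegenbauer_square_bound:
  assumes \<alpha>: "2 * \<alpha> = real CARD('n::finite) - 2" "2 * \<alpha> \<ge> 1" and s: "\<bar>s\<bar> < 1" and l: "l \<ge> 1"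
  shows "(poly (gegenbauer_poly \<alpha> l) s)\<^sup>2 * measure (sphere_measure :: (real^'n) measure) {z. z $ undefined > \<bar>s\<bar>}
     \<le> 2 * \<alpha> / (real l + \<alpha>) * poly (gegenbauer_poly \<alpha> l) 1"
proof -
  interpret prob_space "sphere_measure :: (real^'n) measure" by (rule prob_space_sphere_measure)
  have pos: "\<alpha> > 0" using \<alpha> by simp
  define C where "C = gegenbauer_poly \<alpha> l"
  define ev where "ev = real l * (real l + 2 * \<alpha>)"
  define w :: "real poly" where "w = [:1, 0, -1:]"
  define E where "E = C * C + smult (1 / ev) (w * (pderiv C * pderiv C))"
  have ev: "ev > 0" using pos l by (simp add: ev_def)
  have ode: "w * pderiv (pderiv C) = smult (2 * \<alpha> + 1) ([:0, 1:] * pderiv C) - smult ev C"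
    unfolding C_def ev_def w_def by (rule gegenbauer_poly_ode)
  \<comment> \<open>The Pearson identity for \<open>C * pderiv C\<close>, combined with the
    differential equation, equates the mean of (1 - t^2) C'^2 with \<open>ev\<close> times the mean
    of C^2.\<close>
  have "zonal_mean TYPE('n) (w * pderiv (C * pderiv C)) = (2 * \<alpha> + 1) * zonal_mean TYPE('n) ([:0, 1:] * (C * pderiv C))"
    unfolding w_def zonal_mean_pearson using \<alpha> by simp
  moreover have "w * pderiv (C * pderiv C) = w * (pderiv C * pderiv C) + C * (w * pderiv (pderiv C))"
    by (simp add: pderiv_mult algebra_simps)
  moreover have "\<dots> = w * (pderiv C * pderiv C) + smult (2 * \<alpha> + 1) ([:0, 1:] * (C * pderiv C)) - smult ev (C * C)"
    unfolding ode by (simp add: algebra_simps)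
  ultimately have "zonal_mean TYPE('n) (w * (pderiv C * pderiv C) + smult (2 * \<alpha> + 1) ([:0, 1:] * (C * pderiv C)) - smult ev (C * C)) =
      (2 * \<alpha> + 1) * zonal_mean TYPE('n) ([:0, 1:] * (C * pderiv C))"
    by simp
  then have "zonal_mean TYPE('n) (w * (pderiv C * pderiv C)) = ev * zonal_mean TYPE('n) (C * C)"
    by (simp only: zonal_mean_add zonal_mean_diff zonal_mean_smult)
  then have LE: "zonal_mean TYPE('n) E = 2 * zonal_mean TYPE('n) (C * C)"
    using ev by (simp add: E_def zonal_mean_add zonal_mean_smult)
  have "\<bar>poly C s\<bar> = \<bar>poly C \<bar>s\<bar>\<bar>"
    using gegenbauer_poly_uminus[of \<alpha> l s] by (cases "s \<ge> 0") (auto simp: C_def abs_mult power_abs[symmetric])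
  then have "(poly C s)\<^sup>2 = (poly C \<bar>s\<bar>)\<^sup>2" by (metis power2_abs)
  moreover have E_ge: "(poly C t)\<^sup>2 \<le> poly E t" if "\<bar>t\<bar> \<le> 1" for t
  proof -
    have "t * t \<le> 1" using that by (metis abs_square_le_1 power2_eq_square)
    then have "1 / ev * ((1 - t * t) * (poly (pderiv C) t * poly (pderiv C) t)) \<ge> 0"
      using ev by (intro mult_nonneg_nonneg[OF _ mult_nonneg_nonneg]) auto
    moreover have "poly E t = (poly C t)\<^sup>2 + 1 / ev * ((1 - t * t) * (poly (pderiv C) t * poly (pderiv C) t))"
      by (simp add: E_def w_def power2_eq_square algebra_simps)
    ultimately show ?thesis by simp
  qed
  ultimately have Cs: "(poly C s)\<^sup>2 \<le> poly E \<bar>s\<bar>" using s by simp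
  have mono: "poly E \<bar>s\<bar> \<le> poly E t" if "\<bar>s\<bar> \<le> t" for t
    using gegenbauer_poly_energy_mono[OF pos l _ that] by (simp add: E_def C_def w_def ev_def)
  have meas: "{z :: real^'n. z $ undefined > \<bar>s\<bar>} \<in> sets sphere_measure" by simp measurable
  have "(poly C s)\<^sup>2 * prob {z. z $ undefined > \<bar>s\<bar>} = mean (\<lambda>z. (poly C s)\<^sup>2 * indicator {z :: real^'n. z $ undefined > \<bar>s\<bar>} z)"
    using meas by simp
  also have "\<dots> \<le> mean (\<lambda>z :: real^'n. poly E (z $ undefined))"
  proof (rule integral_mono_AE)
    show "integrable sphere_measure (\<lambda>z. (poly C s)\<^sup>2 * indicator {z :: real^'n. z $ undefined > \<bar>s\<bar>} z)"
      using meas by (intro integrable_mult_right integrable_real_indicator) (auto simp: emeasure_eq_measure)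
    show "integrable sphere_measure (\<lambda>z :: real^'n. poly E (z $ undefined))"
      by (intro integrable_sphere_measure continuous_intros)
    show "AE z in sphere_measure. (poly C s)\<^sup>2 * indicator {z :: real^'n. z $ undefined > \<bar>s\<bar>} z \<le> poly E (z $ undefined)"
      using AE_sphere_measure_norm
    proof eventually_elim
      case (elim z)
      have "\<bar>z $ undefined\<bar> \<le> 1" using component_le_norm_cart[of z undefined] elim by simp
      then have "0 \<le> poly E (z $ undefined)" using E_ge order_trans zero_le_power2 by blast
      then show ?case
        using Cs mono[of "z $ undefined"] by (auto simp: indicator_def)
    qed
  qed
  also have "\<dots> = zonal_mean TYPE('n) E" by (simp add: zonal_mean_def)
  also have "\<dots> = 2 * \<alpha> / (real l + \<alpha>) * poly C 1"
    using LE zonal_mean_gegenbauer_square[OF \<alpha>(1) pos, of l] pos by (simp add: C_def field_simps)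
  finally show ?thesis by (simp add: C_def)
qed

text \<open>Dividing the square bound by the squared value at 1 leaves one spare factor, which is
  only bounded below by 1. Already 1 / (l + \<alpha>) gives the decay, which matters for \<alpha> =
  1/2, where the value at 1 stays 1.\<close>

theorem gegenbauer_ratio_tendsto_0:
  assumes \<alpha>: "2 * \<alpha> = real CARD('n::finite) - 2" "2 * \<alpha> \<ge> 1" and s: "\<bar>s\<bar> < 1"
  shows "(\<lambda>l. poly (gegenbauer_poly \<alpha> l) s / poly (gegenbauer_poly \<alpha> l) 1) \<longlonglongrightarrow> 0"
proof -
  define P where "P = measure (sphere_measure :: (real^'n) measure) {z. z $ undefined > \<bar>s\<bar>}"
  have P: "P > 0" unfolding P_def using s by (rule measure_cap_pos)
  define r where "r l = poly (gegenbauer_poly \<alpha> l) s / poly (gegenbauer_poly \<alpha> l) 1" for l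
  have "(r l)\<^sup>2 \<le> 2 * \<alpha> / P * inverse (real l + \<alpha>)" if l: "l \<ge> 1" for l
  proof -
    define D where "D = poly (gegenbauer_poly \<alpha> l) 1"
    have D: "D \<ge> 1" using gegenbauer_poly_pos[of \<alpha> l] \<alpha> by (simp add: D_def)
    have "(r l)\<^sup>2 * P = (poly (gegenbauer_poly \<alpha> l) s)\<^sup>2 * P / D\<^sup>2" by (simp add: r_def D_def power_divide)
    also have "\<dots> \<le> (2 * \<alpha> / (real l + \<alpha>) * D) / D\<^sup>2"
      using gegenbauer_square_bound[OF \<alpha> s l] by (intro divide_right_mono) (auto simp: P_def D_def)
    also have "\<dots> = 2 * \<alpha> / (real l + \<alpha>) / D" using D by (simp add: power2_eq_square)
    also have "\<dots> \<le> 2 * \<alpha> / (real l + \<alpha>) / 1" using D \<alpha> by (intro divide_left_mono) auto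
    finally have "(r l)\<^sup>2 * P \<le> 2 * \<alpha> / (real l + \<alpha>)" by simp
    then have "(r l)\<^sup>2 \<le> 2 * \<alpha> / (real l + \<alpha>) / P" by (rule mult_imp_le_div_pos[OF P])
    then show ?thesis by (simp add: divide_inverse mult_ac)
  qed
  then have "\<forall>\<^sub>F l in sequentially. (r l)\<^sup>2 \<le> 2 * \<alpha> / P * inverse (real l + \<alpha>)"
    by (rule eventually_sequentiallyI)
  moreover have "(\<lambda>l. 2 * \<alpha> / P * inverse (real l + \<alpha>)) \<longlonglongrightarrow> 0"
    using tendsto_mult[OF tendsto_const tendsto_inverse_0_at_top[OF filterlim_tendsto_add_at_top[OF tendsto_const filterlim_real_sequentially]], of "2 * \<alpha> / P" \<alpha>]
    by (simp add: add.commute)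
  ultimately have "(\<lambda>l. (r l)\<^sup>2) \<longlonglongrightarrow> 0"
    by (rule tendsto_sandwich[OF _ _ tendsto_const, rotated]) auto
  then have "r \<longlonglongrightarrow> 0" using tendsto_real_sqrt[of "\<lambda>l. (r l)\<^sup>2" 0] by (simp add: tendsto_rabs_zero_iff)
  then show ?thesis by (simp add: r_def[abs_def])
qed

section \<open>Trigonometric sums and quadratic forms\<close>

lemma sum_roots_of_unity_angles:
  assumes "N \<ge> 1" "\<not> int N dvd r"
  shows "(\<Sum>p<N. cos (real_of_int r * (2 * pi * real p / real N))) = 0"
    and "(\<Sum>p<N. sin (real_of_int r * (2 * pi * real p / real N))) = 0"
proof -
  define \<omega> where "\<omega> = cis (2 * pi * real_of_int r / real N)"
  have "\<omega> ^ N = cis (real N * (2 * pi * real_of_int r / real N))" unfolding \<omega>_def by (rule Complex.DeMoivre)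
  also have "real N * (2 * pi * real_of_int r / real N) = 2 * pi * real_of_int r" using assms(1) by simp
  finally have "\<omega> ^ N = 1" by simp
  moreover have "\<omega> \<noteq> 1"
  proof
    assume "\<omega> = 1"
    then have "cos (2 * pi * real_of_int r / real N) = 1" by (simp add: \<omega>_def complex_eq_iff)
    then obtain x :: int where "2 * pi * real_of_int r / real N = real_of_int x * 2 * pi"
      unfolding cos_one_2pi_int by blast
    then have "real_of_int r = real_of_int (x * int N)" using assms(1) by (simp add: field_simps)
    then have "r = x * int N" by (simp only: of_int_eq_iff)
    then show False using assms(2) by simp
  qed
  ultimately have "(\<Sum>p<N. \<omega> ^ p) = 0" by (simp add: geometric_sum)
  moreover have "\<omega> ^ p = cis (real_of_int r * (2 * pi * real p / real N))" for p
    by (simp add: \<omega>_def Complex.DeMoivre mult_ac)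
  ultimately have "(\<Sum>p<N. cis (real_of_int r * (2 * pi * real p / real N))) = 0" by simp
  from arg_cong[OF this, of Re] arg_cong[OF this, of Im]
  show "(\<Sum>p<N. cos (real_of_int r * (2 * pi * real p / real N))) = 0"
    and "(\<Sum>p<N. sin (real_of_int r * (2 * pi * real p / real N))) = 0" by simp_all
qed

text \<open>The form is the square of a cosine sum plus the square of a sine sum, and product
  formulas reduce both to sums over roots of unity with frequencies \<open>k - q\<close> and
  \<open>k + q\<close>.\<close>

lemma cosine_form_vanishes:
  assumes N: "N \<ge> 1" "\<not> int N dvd k - q" "\<not> int N dvd k + q"
  defines "\<phi> \<equiv> \<lambda>p::nat. 2 * pi * real p / real N"
  shows "(\<Sum>p<N. \<Sum>p'<N. cos (real_of_int q * \<phi> p) * cos (real_of_int q * \<phi> p') * cos (real_of_int k * (\<phi> p - \<phi> p'))) = 0"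
proof -
  have "(\<Sum>p<N. cos (real_of_int q * \<phi> p) * cos (real_of_int k * \<phi> p)) =
     (\<Sum>p<N. cos (real_of_int (k - q) * \<phi> p)) / 2 + (\<Sum>p<N. cos (real_of_int (k + q) * \<phi> p)) / 2"
    unfolding sum_divide_distrib sum.distrib[symmetric]
    by (intro sum.cong refl) (simp add: left_diff_distrib distrib_right cos_add cos_diff field_simps)
  then have c: "(\<Sum>p<N. cos (real_of_int q * \<phi> p) * cos (real_of_int k * \<phi> p)) = 0"
    unfolding \<phi>_def using sum_roots_of_unity_angles(1)[OF N(1,2)] sum_roots_of_unity_angles(1)[OF N(1,3)] by simp
  have "(\<Sum>p<N. cos (real_of_int q * \<phi> p) * sin (real_of_int k * \<phi> p)) =
     (\<Sum>p<N. sin (real_of_int (k - q) * \<phi> p)) / 2 + (\<Sum>p<N. sin (real_of_int (k + q) * \<phi> p)) / 2"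
    unfolding sum_divide_distrib sum.distrib[symmetric]
    by (intro sum.cong refl) (simp add: left_diff_distrib distrib_right sin_add sin_diff field_simps)
  then have s: "(\<Sum>p<N. cos (real_of_int q * \<phi> p) * sin (real_of_int k * \<phi> p)) = 0"
    unfolding \<phi>_def using sum_roots_of_unity_angles(2)[OF N(1,2)] sum_roots_of_unity_angles(2)[OF N(1,3)] by simp
  have "(\<Sum>p<N. \<Sum>p'<N. cos (real_of_int q * \<phi> p) * cos (real_of_int q * \<phi> p') * cos (real_of_int k * (\<phi> p - \<phi> p'))) =
     (\<Sum>p<N. cos (real_of_int q * \<phi> p) * cos (real_of_int k * \<phi> p)) * (\<Sum>p<N. cos (real_of_int q * \<phi> p) * cos (real_of_int k * \<phi> p)) +
     (\<Sum>p<N. cos (real_of_int q * \<phi> p) * sin (real_of_int k * \<phi> p)) * (\<Sum>p<N. cos (real_of_int q * \<phi> p) * sin (real_of_int k * \<phi> p))"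
    unfolding sum_product sum.distrib[symmetric]
    by (intro sum.cong refl) (simp add: right_diff_distrib cos_diff algebra_simps)
  then show ?thesis using c s by simp
qed

lemma cosine_sum_form_vanishes:
  assumes "cosine_sum n g"
    and "\<And>r. r \<le> n \<Longrightarrow> even (n - r) \<Longrightarrow> (\<Sum>i\<in>I. \<Sum>j\<in>I. w i * w j * cos (real r * (\<phi> i - \<phi> j))) = 0"
  shows "(\<Sum>i\<in>I. \<Sum>j\<in>I. w i * w j * g (\<phi> i - \<phi> j :: real)) = (0 :: real)"
  using assms(1)
proof induction
  case (add g r c)
  have "(\<Sum>i\<in>I. \<Sum>j\<in>I. w i * w j * (g (\<phi> i - \<phi> j) + c * cos (real r * (\<phi> i - \<phi> j)))) =
     (\<Sum>i\<in>I. \<Sum>j\<in>I. w i * w j * g (\<phi> i - \<phi> j)) + c * (\<Sum>i\<in>I. \<Sum>j\<in>I. w i * w j * cos (real r * (\<phi> i - \<phi> j)))"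
    by (simp add: distrib_left sum.distrib sum_distrib_left mult_ac)
  then show ?case using add assms(2) by simp
qed simp

text \<open>Absorbs the angles into two families of real weights, so that each term of the series
  becomes two forms in the sphere variable alone.\<close>

lemma cos_sum_form_split:
  fixes c \<theta> :: "'i \<Rightarrow> real"
  shows "(\<Sum>i\<in>I. \<Sum>j\<in>I. c i * c j * cos (k * (\<theta> i - \<theta> j)) * G i j) =
    (\<Sum>i\<in>I. \<Sum>j\<in>I. (c i * cos (k * \<theta> i)) * (c j * cos (k * \<theta> j)) * G i j) +
    (\<Sum>i\<in>I. \<Sum>j\<in>I. (c i * sin (k * \<theta> i)) * (c j * sin (k * \<theta> j)) * G i j)"
  unfolding sum.distrib[symmetric]
  by (intro sum.cong refl) (simp add: right_diff_distrib cos_diff algebra_simps)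

section \<open>Linear independence and diagonal dominance\<close>

lemma unit_exponential_sums_independent:
  fixes \<zeta> :: "'i \<Rightarrow> complex"
  assumes "finite S" "inj_on \<zeta> S" "\<And>k::nat. (\<Sum>i\<in>S. c i * \<zeta> i ^ k) = 0" "i \<in> S"
  shows "c i = 0"
proof -
  have p: "(\<Sum>i\<in>S. c i * poly p (\<zeta> i)) = 0" for p
  proof -
    have "(\<Sum>i\<in>S. c i * poly p (\<zeta> i)) = (\<Sum>k\<le>degree p. coeff p k * (\<Sum>i\<in>S. c i * \<zeta> i ^ k))"
      unfolding poly_altdef sum_distrib_left by (subst sum.swap) (simp add: mult_ac)
    then show ?thesis using assms(3) by simp
  qed
  \<comment> \<open>Vanishing power sums annihilate every polynomial, in particular this one, which
    vanishes at all nodes except \<open>\<zeta> i\<close>.\<close>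
  define q where "q = (\<Prod>j\<in>S - {i}. [:- \<zeta> j, 1:])"
  have "poly q (\<zeta> j) = 0" if "j \<in> S" "j \<noteq> i" for j
    using that assms(1) by (auto simp: q_def poly_prod)
  then have "(\<Sum>j\<in>S. c j * poly q (\<zeta> j)) = c i * poly q (\<zeta> i)"
    using assms by (subst sum.remove[of _ i]) (auto intro!: sum.neutral)
  moreover have "poly q (\<zeta> i) \<noteq> 0"
    using assms by (auto simp: q_def poly_prod inj_on_def)
  ultimately show ?thesis using p[of q] by simp
qed

lemma diagonal_dominance:
  fixes v :: "'w \<Rightarrow> real"
  assumes W: "finite W" and d: "d > 0" and G: "\<And>w. w \<in> W \<Longrightarrow> G w w = d"
    and off: "\<And>w w'. w \<in> W \<Longrightarrow> w' \<in> W \<Longrightarrow> w \<noteq> w' \<Longrightarrow> real (card W) * \<bar>G w w'\<bar> \<le> d / 2"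
    and form: "(\<Sum>w\<in>W. \<Sum>w'\<in>W. v w * v w' * G w w') \<le> 0" and w: "w \<in> W"
  shows "v w = 0"
proof -
  define S where "S = (\<Sum>w\<in>W. (v w)\<^sup>2)"
  define n where "n = real (card W)"
  have n: "n > 0" using w W by (auto simp: n_def card_gt_0_iff)
  \<comment> \<open>The off-diagonal loss is charged to diagonal pairs as well. This weakens the
    bound but makes the total loss exactly \<open>d * S / 2\<close>, half of the gain
    \<open>d * S\<close>.\<close>
  have summand: "v x * v y * G x y \<ge> (if x = y then d * (v x)\<^sup>2 else 0) - d / (4 * n) * ((v x)\<^sup>2 + (v y)\<^sup>2)"
    if "x \<in> W" "y \<in> W" for x y
  proof (cases "x = y")
    case True
    then show ?thesis using G that d n by (auto simp: power2_eq_square intro!: mult_nonneg_nonneg)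
  next
    case False
    have "\<bar>v x * v y\<bar> \<le> ((v x)\<^sup>2 + (v y)\<^sup>2) / 2"
      using sum_squares_bound[of "\<bar>v x\<bar>" "\<bar>v y\<bar>"] by (simp add: abs_mult)
    moreover have "\<bar>G x y\<bar> \<le> d / (2 * n)" using off[OF that False] n by (simp add: n_def field_simps)
    ultimately have "\<bar>v x * v y\<bar> * \<bar>G x y\<bar> \<le> ((v x)\<^sup>2 + (v y)\<^sup>2) / 2 * (d / (2 * n))"
      by (intro mult_mono) auto
    then have "\<bar>v x * v y * G x y\<bar> \<le> d / (4 * n) * ((v x)\<^sup>2 + (v y)\<^sup>2)"
      by (simp add: abs_mult mult_ac)
    then show ?thesis using False by auto
  qed
  have "(\<Sum>x\<in>W. \<Sum>y\<in>W. (if x = y then d * (v x)\<^sup>2 else 0) - d / (4 * n) * ((v x)\<^sup>2 + (v y)\<^sup>2)) \<le> 0"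
    by (rule order_trans[OF sum_mono[OF sum_mono[OF summand]] form])
  moreover have "(\<Sum>x\<in>W. \<Sum>y\<in>W. (if x = y then d * (v x)\<^sup>2 else 0) - d / (4 * n) * ((v x)\<^sup>2 + (v y)\<^sup>2)) =
      d * S - d / (4 * n) * (n * S + n * S)"
  proof -
    have "(\<Sum>x\<in>W. \<Sum>y\<in>W. if x = y then d * (v x)\<^sup>2 else 0) = d * S"
      using W by (simp add: S_def sum_distrib_left)
    moreover have "(\<Sum>x\<in>W. \<Sum>y\<in>W. (v x)\<^sup>2 + (v y)\<^sup>2) = n * S + n * S"
      by (simp add: sum.distrib S_def n_def sum_distrib_left)
    ultimately show ?thesis by (simp only: sum_subtractf sum_distrib_left[symmetric])
  qed
  ultimately have "d * S / 2 \<le> 0" using n by (simp add: field_simps)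
  then have "S \<le> 0" using d by (simp add: mult_le_0_iff)
  moreover have "(v w)\<^sup>2 \<le> S" unfolding S_def using w W by (intro member_le_sum) auto
  ultimately show ?thesis by (metis order_trans power2_less_eq_zero_iff)
qed

section \<open>Strict positive definiteness\<close>

definition circle_point :: "real \<Rightarrow> real^2" where
  "circle_point \<theta> = vector [cos \<theta>, sin \<theta>]"

lemma inner_circle_point: "circle_point a \<bullet> circle_point b = cos (a - b)"
  by (simp add: circle_point_def inner_vec_def sum_2 cos_diff)

lemma circle_point_in_sphere: "circle_point a \<in> sphere 0 1"
  using inner_circle_point[of a a] by (simp add: norm_eq_1)

lemma sphere_eq_circle_point:
  assumes "v \<in> sphere (0 :: real^2) 1"
  shows "\<exists>\<theta>. v = circle_point \<theta>"
proof -
  have "v \<bullet> v = 1" using assms by (simp add: norm_eq_1)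
  then have "(v $ 1)\<^sup>2 + (v $ 2)\<^sup>2 = 1" by (simp add: inner_vec_def sum_2 power2_eq_square)
  then obtain \<theta> where "v $ 1 = cos \<theta>" "v $ 2 = sin \<theta>" using sincos_total_2pi by blast
  then show ?thesis by (intro exI[of _ \<theta>]) (simp add: circle_point_def vec_eq_iff forall_2)
qed

lemma cos_eq_one_imp_eq:
  assumes "cos (a - b) = 1" "0 \<le> a" "a < 2 * pi" "0 \<le> b" "b < 2 * pi"
  shows "a = b"
proof -
  obtain x :: int where x: "a - b = real_of_int x * 2 * pi" using assms(1) unfolding cos_one_2pi_int by blast
  have "\<bar>a - b\<bar> < 2 * pi" using assms by (auto simp: abs_if)
  then have "\<bar>real_of_int x\<bar> * (2 * pi) < 1 * (2 * pi)" unfolding x by (simp add: abs_mult)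
  then have "\<bar>real_of_int x\<bar> < 1" by (simp only: mult_less_cancel_right) auto
  then have "x = 0" by linarith
  then show ?thesis using x by simp
qed

lemma has_sum_sum:
  fixes F :: "'i \<Rightarrow> 'b \<Rightarrow> 'c::topological_comm_monoid_add"
  assumes "\<And>i. i \<in> I \<Longrightarrow> (F i has_sum s i) A"
  shows "((\<lambda>x. \<Sum>i\<in>I. F i x) has_sum (\<Sum>i\<in>I. s i)) A"
  using assms
  by (induction I rule: infinite_finite_induct) (auto intro!: has_sum_add has_sum_0)

lemma sphere_poly_gegenbauer: "m \<ge> 2 \<Longrightarrow> sphere_poly m l t = poly (gegenbauer_poly ((real m - 1) / 2) l) t"
  by (simp add: sphere_poly_def poly_gegenbauer_poly)

text \<open>A finite double sum passes through the infinite one. The factor depending on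
  \<open>k\<close> is the value at 1 of the circle polynomial; being positive, it leaves the sign of
  each term to the form.\<close>

lemma kernel_form_has_sum:
  fixes z :: "'i \<Rightarrow> real^'n"
  assumes "m \<ge> 2" and series: "series_coeffs m f a" and z: "\<And>i. i \<in> I \<Longrightarrow> norm (z i) = 1"
  shows "((\<lambda>(k, l). a k l * (if k = 0 then 1 else 2 / real k) *
       (\<Sum>i\<in>I. \<Sum>j\<in>I. c i * c j * cos (real k * (\<theta> i - \<theta> j)) * poly (gegenbauer_poly ((real m - 1) / 2) l) (z i \<bullet> z j)))
     has_sum (\<Sum>i\<in>I. \<Sum>j\<in>I. c i * c j * inner_kernel f (circle_point (\<theta> i), z i) (circle_point (\<theta> j), z j))) UNIV"
proof -
  let ?C = "\<lambda>l. poly (gegenbauer_poly ((real m - 1) / 2) l)"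
  let ?w = "\<lambda>k. if k = 0 then 1 else 2 / real k"
  have "((\<lambda>(k, l). c i * c j * (a k l * (?w k * cos (real k * (\<theta> i - \<theta> j))) * ?C l (z i \<bullet> z j))) has_sum
     c i * c j * inner_kernel f (circle_point (\<theta> i), z i) (circle_point (\<theta> j), z j)) UNIV" if "i \<in> I" "j \<in> I" for i j
  proof -
    have "cos (\<theta> i - \<theta> j) \<in> {-1..1}" "z i \<bullet> z j \<in> {-1..1}"
      using Cauchy_Schwarz_ineq2[of "z i" "z j"] z that by (auto simp: abs_le_iff)
    then have "((\<lambda>(k, l). a k l * sphere_poly 1 k (cos (\<theta> i - \<theta> j)) * sphere_poly m l (z i \<bullet> z j)) has_sum
        f (cos (\<theta> i - \<theta> j), z i \<bullet> z j)) UNIV"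
      using series unfolding series_coeffs_def by blast
    moreover have "sphere_poly 1 k (cos \<phi>) = ?w k * cos (real k * \<phi>)" for k \<phi>
      using sphere_poly_circle[of k \<phi>] by (cases "k = 0") (auto simp: sphere_poly_def)
    ultimately have "((\<lambda>(k, l). a k l * (?w k * cos (real k * (\<theta> i - \<theta> j))) * ?C l (z i \<bullet> z j)) has_sum
        f (cos (\<theta> i - \<theta> j), z i \<bullet> z j)) UNIV"
      by (simp only: sphere_poly_gegenbauer[OF assms(1)])
    from has_sum_cmult_right[OF this, of "c i * c j"] show ?thesis
      by (simp add: inner_kernel_def inner_circle_point case_prod_unfold)
  qed
  then have "((\<lambda>x. \<Sum>i\<in>I. \<Sum>j\<in>I. (\<lambda>(k, l). c i * c j * (a k l * (?w k * cos (real k * (\<theta> i - \<theta> j))) * ?C l (z i \<bullet> z j))) x) has_sum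
     (\<Sum>i\<in>I. \<Sum>j\<in>I. c i * c j * inner_kernel f (circle_point (\<theta> i), z i) (circle_point (\<theta> j), z j))) UNIV"
    by (intro has_sum_sum)
  moreover have "(\<lambda>x. \<Sum>i\<in>I. \<Sum>j\<in>I. (\<lambda>(k, l). c i * c j * (a k l * (?w k * cos (real k * (\<theta> i - \<theta> j))) * ?C l (z i \<bullet> z j))) x) =
    (\<lambda>(k, l). a k l * ?w k * (\<Sum>i\<in>I. \<Sum>j\<in>I. c i * c j * cos (real k * (\<theta> i - \<theta> j)) * ?C l (z i \<bullet> z j)))"
    by (simp only: fun_eq_iff case_prod_unfold sum_distrib_left mult_ac simp_thms)
  ultimately show ?thesis by simp
qed

text \<open>Passes from indices \<open>{1..n}\<close> to arbitrary finite index sets, because the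
  points of the converse form a grid indexed by pairs.\<close>

lemma strictly_pd_kernel_on_finite:
  assumes K: "strictly_pd_kernel_on X K" and I: "finite I" and u: "u ` I \<subseteq> X" "inj_on u I"
    and i: "i \<in> I" "c i \<noteq> 0"
  shows "(\<Sum>i\<in>I. \<Sum>j\<in>I. c i * c j * K (u i) (u j)) > 0"
proof -
  obtain h where h: "bij_betw h {1..card I} I" using ex_bij_betw_nat_finite_1[OF I] by blast
  have "card I \<ge> 1" using I i(1) by (metis One_nat_def Suc_leI card_gt_0_iff empty_iff)
  moreover have "(u \<circ> h) ` {1..card I} \<subseteq> X" "inj_on (u \<circ> h) {1..card I}"
    using h u by (auto simp: bij_betw_def intro!: comp_inj_on)
  moreover have "\<exists>\<mu>\<in>{1..card I}. (c \<circ> h) \<mu> \<noteq> 0"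
  proof -
    have "i \<in> h ` {1..card I}" using h i by (simp add: bij_betw_def)
    then show ?thesis using i by auto
  qed
  ultimately have "(\<Sum>\<mu>=1..card I. \<Sum>\<nu>=1..card I. (c \<circ> h) \<mu> * (c \<circ> h) \<nu> * K ((u \<circ> h) \<mu>) ((u \<circ> h) \<nu>)) > 0"
    using K unfolding strictly_pd_kernel_on_def by blast
  moreover have "(\<Sum>\<nu>=1..card I. c i * c (h \<nu>) * K (u i) (u (h \<nu>))) = (\<Sum>j\<in>I. c i * c j * K (u i) (u j))" for i
    by (rule sum.reindex_bij_betw[OF h])
  moreover have "(\<Sum>\<mu>=1..card I. \<Sum>j\<in>I. c (h \<mu>) * c j * K (u (h \<mu>)) (u j)) = (\<Sum>i\<in>I. \<Sum>j\<in>I. c i * c j * K (u i) (u j))"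
    by (rule sum.reindex_bij_betw[OF h])
  ultimately show ?thesis by (simp only: o_def)
qed

section \<open>Necessity: a vanishing form from a missed progression\<close>

lemma sum_product_form:
  fixes X :: "'p \<Rightarrow> 'p \<Rightarrow> 'c::comm_semiring_0"
  shows "(\<Sum>x\<in>P \<times> R. \<Sum>y\<in>P \<times> R. X (fst x) (fst y) * Y (snd x) (snd y)) =
    (\<Sum>p\<in>P. \<Sum>p'\<in>P. X p p') * (\<Sum>r\<in>R. \<Sum>r'\<in>R. Y r r')"
  by (simp add: sum.cartesian_product' sum_product)

text \<open>The form of each term factors. The circle factor vanishes unless \<open>k\<close> is
  congruent to \<open>j\<close> or \<open>- j\<close> modulo \<open>n\<close>, the great circle
  factor unless the degree is at least \<open>\<gamma>\<close> and has the given parity. For the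
  pairs left over, the missed progression makes the coefficient zero.\<close>

lemma strictly_pd_imp_meets:
  fixes f :: "real \<times> real \<Rightarrow> real"
  assumes m: "m \<ge> 2" and card: "CARD('n::finite) = m + 1"
    and strict: "strictly_pd_kernel_on (sphere (0 :: real^2) 1 \<times> sphere (0 :: real^'n) 1) (inner_kernel f)"
    and series: "series_coeffs m f a"
  shows "meets_every_progression {k. pos_indices a (nat \<bar>k\<bar>) \<inter> {\<gamma>..} \<inter> {l. even l \<longleftrightarrow> e} \<noteq> {}}"
  unfolding meets_every_progression_def
proof (intro allI impI ballI notI)
  fix n j :: int
  assume n: "n \<ge> 1" and j: "j \<in> {0..n - 1}"
  assume empty: "{k. pos_indices a (nat \<bar>k\<bar>) \<inter> {\<gamma>..} \<inter> {l. even l \<longleftrightarrow> e} \<noteq> {}} \<inter> {n * i + j | i. True} = {}"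
  define C where "C l = poly (gegenbauer_poly ((real m - 1) / 2) l)" for l
  define N where "N = nat n"
  have N: "N \<ge> 1" "int N = n" using n by (auto simp: N_def)
  \<comment> \<open>The least frequency from \<open>\<gamma>\<close> on that has the given
    parity.\<close>
  define q where "q = (if even \<gamma> = e then \<gamma> else Suc \<gamma>)"
  have q: "even q = e" "\<gamma> \<le> q" by (auto simp: q_def)
  \<comment> \<open>Even, so that residues modulo \<open>M\<close> remember parity, and larger than
    \<open>r + q\<close> for all \<open>r < q\<close>, so that no such frequency is aliased to
    \<open>q\<close> or \<open>- q\<close>.\<close>
  define M where "M = 2 * (q + 1)"
  have M: "M \<ge> 1" by (simp add: M_def)
  define \<phi> where "\<phi> p = 2 * pi * real p / real N" for p :: nat
  define \<psi> where "\<psi> i = 2 * pi * real i / real M" for i :: nat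
  obtain k1 k2 :: 'n where k12: "k1 \<noteq> k2"
  proof (rule ccontr)
    assume "\<not> thesis"
    then have "UNIV = {undefined :: 'n}" using that by blast
    then have "CARD('n) = card {undefined :: 'n}" by (rule arg_cong)
    then show False using card m by simp
  qed
  define pt :: "real \<Rightarrow> real^'n" where "pt t = cos t *\<^sub>R axis k1 1 + sin t *\<^sub>R axis k2 1" for t
  have inner_pt: "pt s \<bullet> pt t = cos (s - t)" for s t
  proof -
    have ax: "axis k1 (1::real) \<bullet> axis k1 1 = 1" "axis k2 (1::real) \<bullet> axis k2 1 = 1"
      "axis k1 (1::real) \<bullet> axis k2 1 = 0" "axis k2 (1::real) \<bullet> axis k1 1 = 0"
      using k12 by (auto simp: inner_axis_axis)
    show ?thesis
      unfolding pt_def cos_diff inner_add_left inner_add_right inner_scaleR_left inner_scaleR_right ax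
      by algebra
  qed
  have norm_pt: "norm (pt t) = 1" for t using inner_pt[of t t] by (simp only: norm_eq_1) simp
  define I where "I = {..<N} \<times> {..<M}"
  define u where "u x = (circle_point (\<phi> (fst x)), pt (\<psi> (snd x)))" for x
  define c where "c x = cos (real_of_int j * \<phi> (fst x)) * cos (real q * \<psi> (snd x))" for x
  have angle_inj: "p = p'" if "cos (2 * pi * real p / real D - 2 * pi * real p' / real D) = 1" "p < D" "p' < D" for p p' D
  proof -
    have bounds: "0 \<le> 2 * pi * real x / real D \<and> 2 * pi * real x / real D < 2 * pi" if "x < D" for x
      using that by (simp add: pos_divide_less_eq)
    have "2 * pi * real p / real D = 2 * pi * real p' / real D"
      using bounds[OF that(2)] bounds[OF that(3)] by (intro cos_eq_one_imp_eq[OF that(1)]) blast+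
    then show ?thesis using that(2) by simp
  qed
  have "inj_on u I"
  proof (rule inj_onI)
    fix x y assume xy: "x \<in> I" "y \<in> I" "u x = u y"
    have "circle_point (\<phi> (fst x)) \<bullet> circle_point (\<phi> (fst y)) = 1" "pt (\<psi> (snd x)) \<bullet> pt (\<psi> (snd y)) = 1"
      using xy(3) norm_pt circle_point_in_sphere by (auto simp: u_def norm_eq_1)
    then show "x = y"
      using xy(1,2) angle_inj unfolding inner_circle_point inner_pt \<phi>_def \<psi>_def I_def by (auto intro!: prod_eqI)
  qed
  moreover have "u ` I \<subseteq> sphere 0 1 \<times> sphere 0 1"
    using norm_pt circle_point_in_sphere by (auto simp: u_def)
  moreover have "(0, 0) \<in> I" "c (0, 0) \<noteq> 0" using N M by (auto simp: I_def c_def \<phi>_def \<psi>_def)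
  ultimately have pos: "(\<Sum>x\<in>I. \<Sum>y\<in>I. c x * c y * inner_kernel f (u x) (u y)) > 0"
    by (intro strictly_pd_kernel_on_finite[OF strict]) (auto simp: I_def)
  have "a k l * (if k = 0 then 1 else 2 / real k) *
     (\<Sum>x\<in>I. \<Sum>y\<in>I. c x * c y * cos (real k * (\<phi> (fst x) - \<phi> (fst y))) * C l (pt (\<psi> (snd x)) \<bullet> pt (\<psi> (snd y)))) = 0" for k l
  proof -
    define A where "A = (\<Sum>p<N. \<Sum>p'<N. cos (real_of_int j * \<phi> p) * cos (real_of_int j * \<phi> p') * cos (real_of_int (int k) * (\<phi> p - \<phi> p')))"
    define B where "B = (\<Sum>i<M. \<Sum>i'<M. cos (real q * \<psi> i) * cos (real q * \<psi> i') * C l (cos (\<psi> i - \<psi> i')))"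
    have "(\<Sum>x\<in>I. \<Sum>y\<in>I. c x * c y * cos (real k * (\<phi> (fst x) - \<phi> (fst y))) * C l (pt (\<psi> (snd x)) \<bullet> pt (\<psi> (snd y)))) =
       (\<Sum>x\<in>I. \<Sum>y\<in>I. cos (real_of_int j * \<phi> (fst x)) * cos (real_of_int j * \<phi> (fst y)) * cos (real_of_int (int k) * (\<phi> (fst x) - \<phi> (fst y))) *
         (cos (real q * \<psi> (snd x)) * cos (real q * \<psi> (snd y)) * C l (cos (\<psi> (snd x) - \<psi> (snd y)))))"
      by (simp only: c_def inner_pt of_int_of_nat_eq mult_ac)
    also have "\<dots> = A * B" unfolding I_def A_def B_def by (rule sum_product_form)
    finally have form: "(\<Sum>x\<in>I. \<Sum>y\<in>I. c x * c y * cos (real k * (\<phi> (fst x) - \<phi> (fst y))) * C l (pt (\<psi> (snd x)) \<bullet> pt (\<psi> (snd y)))) = A * B" .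
    have "A = 0 \<or> a k l = 0 \<or> B = 0"
    proof (cases "int N dvd int k - j \<or> int N dvd int k + j")
      case False
      then show ?thesis unfolding A_def \<phi>_def using cosine_form_vanishes[OF N(1), of "int k" j] by blast
    next
      case True
      \<comment> \<open>The index sets depend only on \<open>\<bar>k\<bar>\<close>, so it suffices
        that one of \<open>k\<close> and \<open>- k\<close> lies in the progression.\<close>
      then obtain k' where k': "nat \<bar>k'\<bar> = k" "k' \<in> {n * i + j | i. True}"
      proof
        assume "int N dvd int k - j"
        then obtain x where "int k = n * x + j" using N by (auto elim!: dvdE simp: algebra_simps)
        then show ?thesis using that[of "int k"] by auto
      next
        assume "int N dvd int k + j"
        then obtain x where "int k + j = n * x" using N by (auto elim!: dvdE)
        then have "- int k = n * (- x) + j" by (simp add: algebra_simps)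
        then show ?thesis using that[of "- int k"] by (metis (mono_tags, lifting) abs_minus_cancel abs_of_nat mem_Collect_eq nat_int)
      qed
      have "k' \<notin> {k. pos_indices a (nat \<bar>k\<bar>) \<inter> {\<gamma>..} \<inter> {l. even l \<longleftrightarrow> e} \<noteq> {}}" using empty k'(2) by blast
      then have "pos_indices a k \<inter> {\<gamma>..} \<inter> {l. even l \<longleftrightarrow> e} = {}" using k'(1) by simp
      then have l: "\<not> (a k l > 0 \<and> \<gamma> \<le> l \<and> even l = e)" by (auto simp: pos_indices_def)
      have a0: "a k l \<ge> 0" using series unfolding series_coeffs_def by blast
      have "B = 0" if "\<not> (\<gamma> \<le> l \<and> even l = e)"
        unfolding B_def C_def
      proof (rule cosine_sum_form_vanishes[OF cosine_sum_gegenbauer_poly])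
        fix r assume r: "r \<le> l" "even (l - r)"
        \<comment> \<open>Different parities are never congruent modulo the even \<open>M\<close>.
          With equal parities the excluded case must be \<open>l < \<gamma>\<close>, hence
          \<open>r < q\<close>.\<close>
        have "\<not> int M dvd int r - int q \<and> \<not> int M dvd int r + int q"
        proof (cases "even r = even q")
          case True
          then have "even l = e" using r q by auto
          then have "r < q" using that r q by auto
          then have "0 < int r + int q" "int r + int q < int M" "0 < int q - int r" "int q - int r < int M"
            by (auto simp: M_def)
          then show ?thesis by (metis dvd_diff_commute zdvd_not_zless)
        next
          case False
          then have "odd (int r - int q)" "odd (int r + int q)" by auto
          moreover have "even (int M)" by (simp add: M_def)
          ultimately show ?thesis using dvd_trans by blast
        qed
        then show "(\<Sum>i<M. \<Sum>i'<M. cos (real q * \<psi> i) * cos (real q * \<psi> i') * cos (real r * (\<psi> i - \<psi> i'))) = 0"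
          using cosine_form_vanishes[OF M, of "int r" "int q"] by (simp add: \<psi>_def)
      qed
      then show ?thesis using l a0 by fastforce
    qed
    then show ?thesis unfolding form by auto
  qed
  then have "(\<lambda>(k, l). a k l * (if k = 0 then 1 else 2 / real k) *
       (\<Sum>i\<in>I. \<Sum>j\<in>I. c i * c j * cos (real k * (\<phi> (fst i) - \<phi> (fst j))) * C l (pt (\<psi> (snd i)) \<bullet> pt (\<psi> (snd j))))) = (\<lambda>_. 0)"
    by auto
  moreover have "((\<lambda>(k, l). a k l * (if k = 0 then 1 else 2 / real k) *
       (\<Sum>i\<in>I. \<Sum>j\<in>I. c i * c j * cos (real k * (\<phi> (fst i) - \<phi> (fst j))) * C l (pt (\<psi> (snd i)) \<bullet> pt (\<psi> (snd j)))))
     has_sum (\<Sum>x\<in>I. \<Sum>y\<in>I. c x * c y * inner_kernel f (u x) (u y))) UNIV"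
    using kernel_form_has_sum[OF m series, of I "\<lambda>x. pt (\<psi> (snd x))" c "\<lambda>x. \<phi> (fst x)"]
    unfolding C_def u_def by (simp add: norm_pt)
  ultimately have "((\<lambda>_. 0) has_sum (\<Sum>x\<in>I. \<Sum>y\<in>I. c x * c y * inner_kernel f (u x) (u y))) (UNIV :: (nat \<times> nat) set)" by simp
  then have "(\<Sum>x\<in>I. \<Sum>y\<in>I. c x * c y * inner_kernel f (u x) (u y)) = 0"
    using has_sum_unique has_sum_0 by (metis (mono_tags, lifting))
  then show False using pos by simp
qed

section \<open>Sufficiency: antipodal classes and parities\<close>

lemma sum_grouped_form:
  fixes b :: "'i \<Rightarrow> 'c::comm_semiring_0"
  assumes "finite I"
  shows "(\<Sum>i\<in>I. \<Sum>j\<in>I. b i * b j * G (r i) (r j)) =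
    (\<Sum>w\<in>r ` I. \<Sum>w'\<in>r ` I. (\<Sum>i\<in>{i \<in> I. r i = w}. b i) * (\<Sum>j\<in>{j \<in> I. r j = w'}. b j) * G w w')"
proof -
  have group: "(\<Sum>i\<in>I. h i) = (\<Sum>w\<in>r ` I. \<Sum>i\<in>{i \<in> I. r i = w}. h i)" for h :: "'i \<Rightarrow> 'c"
    using assms by (simp add: sum.group)
  have "(\<Sum>i\<in>I. \<Sum>j\<in>I. b i * b j * G (r i) (r j)) =
     (\<Sum>w\<in>r ` I. \<Sum>i\<in>{i \<in> I. r i = w}. \<Sum>w'\<in>r ` I. \<Sum>j\<in>{j \<in> I. r j = w'}. b i * b j * G (r i) (r j))"
    by (simp only: group[of "\<lambda>j. b _ * b j * G (r _) (r j)"] group[of "\<lambda>i. \<Sum>w'\<in>r ` I. \<Sum>j\<in>{j \<in> I. r j = w'}. b i * b j * G (r i) (r j)"])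
  also have "\<dots> = (\<Sum>w\<in>r ` I. \<Sum>w'\<in>r ` I. \<Sum>i\<in>{i \<in> I. r i = w}. \<Sum>j\<in>{j \<in> I. r j = w'}. b i * b j * G w w')"
    by (intro sum.cong refl, subst sum.swap, intro sum.cong refl) auto
  also have "\<dots> = (\<Sum>w\<in>r ` I. \<Sum>w'\<in>r ` I. (\<Sum>i\<in>{i \<in> I. r i = w}. b i) * (\<Sum>j\<in>{j \<in> I. r j = w'}. b j) * G w w')"
    by (simp only: sum_product) (simp only: sum_distrib_right)
  finally show ?thesis .
qed

text \<open>The choice depends only on the set \<open>{z, - z}\<close>, so antipodal points receive
  the same representative.\<close>

definition axis_rep :: "'a::ab_group_add \<Rightarrow> 'a" where
  "axis_rep z = (SOME w. w \<in> {z, - z})"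

lemma axis_rep_cases: "axis_rep z = z \<or> axis_rep z = - z"
  using someI[of "\<lambda>w. w \<in> {z, - z}" z] by (simp add: axis_rep_def)

lemma axis_rep_uminus: "axis_rep (- z) = axis_rep z"
  by (simp add: axis_rep_def insert_commute)

lemma axis_rep_idem: "axis_rep (axis_rep z) = axis_rep z"
  using axis_rep_cases[of z] axis_rep_uminus[of z] by auto

text \<open>Equality in Cauchy-Schwarz would make the representatives equal or opposite, and
  opposite representatives coincide.\<close>

lemma abs_inner_axis_rep_less_1:
  fixes z z' :: "'a::real_inner"
  assumes "norm z = 1" "norm z' = 1" "axis_rep z \<noteq> axis_rep z'"
  shows "\<bar>axis_rep z \<bullet> axis_rep z'\<bar> < 1"
proof -
  let ?w = "axis_rep z" and ?w' = "axis_rep z'"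
  have n: "norm ?w = 1" "norm ?w' = 1"
    using axis_rep_cases[of z] axis_rep_cases[of z'] assms by auto
  have "?w \<noteq> - ?w'"
  proof
    assume "?w = - ?w'"
    then have "axis_rep ?w = axis_rep (- ?w')" by (rule arg_cong)
    then show False using assms(3) by (simp only: axis_rep_uminus axis_rep_idem)
  qed
  moreover have "\<bar>?w \<bullet> ?w'\<bar> \<le> 1" using Cauchy_Schwarz_ineq2[of ?w ?w'] n by simp
  moreover have "?w = ?w'" if "?w \<bullet> ?w' = 1"
    using norm_cauchy_schwarz_eq[of ?w ?w'] n that by simp
  moreover have "?w = - ?w'" if "?w \<bullet> ?w' = - 1"
    using norm_cauchy_schwarz_eq[of ?w "- ?w'"] n that by simp
  ultimately show ?thesis using assms(3) by linarith
qed

lemma gegenbauer_offdiagonal_small: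
  assumes \<alpha>: "2 * \<alpha> = real CARD('n::finite) - 2" "2 * \<alpha> \<ge> 1" and T: "finite T" "\<And>s. s \<in> T \<Longrightarrow> \<bar>s\<bar> < 1"
    and e: "e > 0"
  shows "\<exists>l0. \<forall>l\<ge>l0. \<forall>s\<in>T. \<bar>poly (gegenbauer_poly \<alpha> l) s\<bar> \<le> e * poly (gegenbauer_poly \<alpha> l) 1"
proof -
  have "\<forall>\<^sub>F l in sequentially. \<bar>poly (gegenbauer_poly \<alpha> l) s\<bar> \<le> e * poly (gegenbauer_poly \<alpha> l) 1" if "s \<in> T" for s
  proof -
    have "\<forall>\<^sub>F l in sequentially. dist (poly (gegenbauer_poly \<alpha> l) s / poly (gegenbauer_poly \<alpha> l) 1) 0 < e"
      by (rule tendstoD[OF gegenbauer_ratio_tendsto_0[OF \<alpha> T(2)[OF that]] e])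
    then show ?thesis
    proof eventually_elim
      case (elim l)
      have "poly (gegenbauer_poly \<alpha> l) 1 > 0" using gegenbauer_poly_pos[of \<alpha> l] \<alpha> by simp
      then show ?case using elim by (simp add: dist_real_def abs_divide pos_divide_less_eq)
    qed
  qed
  then have "\<forall>\<^sub>F l in sequentially. \<forall>s\<in>T. \<bar>poly (gegenbauer_poly \<alpha> l) s\<bar> \<le> e * poly (gegenbauer_poly \<alpha> l) 1"
    using T(1) by (simp add: eventually_ball_finite)
  then show ?thesis unfolding eventually_sequentially .
qed

text \<open>A nonzero value would persist along a whole progression through \<open>k\<close>, and
  \<open>A\<close> meets that progression.\<close>

lemma exponential_sum_vanishing_on_dense_set:
  fixes c \<zeta> :: "'i \<Rightarrow> complex"
  assumes S: "finite S" "\<And>i. i \<in> S \<Longrightarrow> \<zeta> i \<noteq> 0" and A: "meets_every_progression A"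
    and z: "\<And>k. k \<in> A \<Longrightarrow> (\<Sum>i\<in>S. c i * \<zeta> i powi k) = 0"
  shows "(\<Sum>i\<in>S. c i * \<zeta> i powi k) = 0"
proof (rule ccontr)
  assume "(\<Sum>i\<in>S. c i * \<zeta> i powi k) \<noteq> 0"
  with S have "\<exists>n\<ge>1::nat. \<forall>j. (\<Sum>i\<in>S. c i * \<zeta> i powi (k + int n * j)) \<noteq> 0"
    by (rule exponential_sum_nonzero_on_progression)
  then obtain n :: nat where n: "n \<ge> 1" "\<And>j. (\<Sum>i\<in>S. c i * \<zeta> i powi (k + int n * j)) \<noteq> 0"
    by blast
  have "k mod int n \<in> {0..int n - 1}" using n by simp
  moreover have "int n \<ge> 1" using n(1) by simp
  ultimately have "A \<inter> {int n * i + k mod int n | i. True} \<noteq> {}"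
    using A unfolding meets_every_progression_def by blast
  then obtain x where "int n * x + k mod int n \<in> A" by blast
  moreover have "int n * x + k mod int n = k + int n * (x - k div int n)"
    using mult_div_mod_eq[of "int n" k] unfolding right_diff_distrib by linarith
  ultimately show False using z n(2) by metis
qed

lemma meets_imp_strictly_pd:
  fixes f :: "real \<times> real \<Rightarrow> real"
  assumes m: "m \<ge> 2" and card: "CARD('n::finite) = m + 1"
    and pd: "pd_kernel_on (sphere (0 :: real^2) 1 \<times> sphere (0 :: real^'n) 1) (inner_kernel f)"
    and series: "series_coeffs m f a"
    and meets: "\<And>\<gamma> e. meets_every_progression {k. pos_indices a (nat \<bar>k\<bar>) \<inter> {\<gamma>..} \<inter> {l. even l \<longleftrightarrow> e} \<noteq> {}}"
  shows "strictly_pd_kernel_on (sphere (0 :: real^2) 1 \<times> sphere (0 :: real^'n) 1) (inner_kernel f)"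
  unfolding strictly_pd_kernel_on_def
proof (intro conjI pd allI impI)
  fix n :: nat and u :: "nat \<Rightarrow> (real^2) \<times> (real^'n)" and c :: "nat \<Rightarrow> real"
  define I where "I = {1..n}"
  assume n: "n \<ge> 1" and u: "u ` {1..n} \<subseteq> sphere 0 1 \<times> sphere 0 1" "inj_on u {1..n}"
    and c: "\<exists>\<mu>\<in>{1..n}. c \<mu> \<noteq> 0"
  let ?Q = "\<Sum>\<mu>\<in>I. \<Sum>\<nu>\<in>I. c \<mu> * c \<nu> * inner_kernel f (u \<mu>) (u \<nu>)"
  have fin: "finite I" by (simp add: I_def)
  have Q_nonneg: "?Q \<ge> 0" using pd n u unfolding pd_kernel_on_def I_def by blast
  have "?Q \<noteq> 0"
  proof
    assume Q0: "?Q = 0"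
    define \<alpha> where "\<alpha> = (real m - 1) / 2"
    have \<alpha>: "2 * \<alpha> = real CARD('n) - 2" "2 * \<alpha> \<ge> 1" using m card by (auto simp: \<alpha>_def)
    define C where "C l = poly (gegenbauer_poly \<alpha> l)" for l
    have C1: "C l 1 > 0" for l using gegenbauer_poly_pos[of \<alpha> l] \<alpha> by (simp add: C_def)
    have "\<forall>\<mu>\<in>I. \<exists>t. fst (u \<mu>) = circle_point t"
      using u(1) sphere_eq_circle_point unfolding I_def by (metis image_subset_iff mem_Times_iff)
    then obtain \<theta> where \<theta>: "\<And>\<mu>. \<mu> \<in> I \<Longrightarrow> fst (u \<mu>) = circle_point (\<theta> \<mu>)" by metis
    define z where "z \<mu> = snd (u \<mu>)" for \<mu>
    have z: "norm (z \<mu>) = 1" if "\<mu> \<in> I" for \<mu>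
      using u(1) that by (auto simp: I_def z_def image_subset_iff mem_Times_iff)
    have u_eq: "u \<mu> = (circle_point (\<theta> \<mu>), z \<mu>)" if "\<mu> \<in> I" for \<mu>
      using \<theta>[OF that] by (simp add: z_def prod_eq_iff)
    define r where "r \<mu> = axis_rep (z \<mu>)" for \<mu>
    define \<sigma> :: "nat \<Rightarrow> real" where "\<sigma> \<mu> = (if r \<mu> = z \<mu> then 1 else - 1)" for \<mu>
    have \<sigma>: "\<sigma> \<mu> = 1 \<or> \<sigma> \<mu> = - 1" for \<mu> by (simp add: \<sigma>_def)
    have z_eq: "z \<mu> = \<sigma> \<mu> *\<^sub>R r \<mu>" for \<mu>
      using axis_rep_cases[of "z \<mu>"] by (auto simp: \<sigma>_def r_def)
    have norm_r: "norm (r \<mu>) = 1" if "\<mu> \<in> I" for \<mu>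
      using z[OF that] axis_rep_cases[of "z \<mu>"] by (auto simp: r_def)
    have C_uminus: "C l (- t) = (- 1) ^ l * C l t" for l t unfolding C_def by (rule gegenbauer_poly_uminus)
    \<comment> \<open>Parity moves the signs from the points to the coefficients, so points on the
      same axis merge into one weight.\<close>
    have C_z: "C l (z \<mu> \<bullet> z \<nu>) = \<sigma> \<mu> ^ l * \<sigma> \<nu> ^ l * C l (r \<mu> \<bullet> r \<nu>)" for l \<mu> \<nu>
      using \<sigma>[of \<mu>] \<sigma>[of \<nu>] unfolding z_eq[of \<mu>] z_eq[of \<nu>]
      by (auto simp: C_uminus simp flip: power_mult_distrib)
    define form where "form b l = (\<Sum>\<mu>\<in>I. \<Sum>\<nu>\<in>I. b \<mu> * b \<nu> * C l (z \<mu> \<bullet> z \<nu>))" for b :: "nat \<Rightarrow> real" and l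
    have form_nonneg: "form b l \<ge> 0" for b l
      unfolding form_def C_def using gegenbauer_positive_definite[OF \<alpha>] z by blast
    have forms: "form (\<lambda>\<mu>. c \<mu> * cos (real k * \<theta> \<mu>)) l = 0 \<and> form (\<lambda>\<mu>. c \<mu> * sin (real k * \<theta> \<mu>)) l = 0"
      if kl: "l \<in> pos_indices a k" for k l
    proof -
      define F where "F = (\<lambda>(k, l). a k l * (if k = 0 then 1 else 2 / real k) *
         (form (\<lambda>\<mu>. c \<mu> * cos (real k * \<theta> \<mu>)) l + form (\<lambda>\<mu>. c \<mu> * sin (real k * \<theta> \<mu>)) l))"
      have "?Q = (\<Sum>i\<in>I. \<Sum>j\<in>I. c i * c j * inner_kernel f (circle_point (\<theta> i), z i) (circle_point (\<theta> j), z j))"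
        by (intro sum.cong refl) (simp add: u_eq)
      then have "(F has_sum ?Q) UNIV"
        using kernel_form_has_sum[OF m series z, where c = c and \<theta> = \<theta>]
        unfolding F_def form_def C_def \<alpha>_def by (simp only: cos_sum_form_split)
      moreover have "F x \<ge> 0" for x
      proof -
        have "a k l \<ge> 0" for k l using series unfolding series_coeffs_def by blast
        then show ?thesis unfolding F_def using form_nonneg
          by (auto simp: case_prod_unfold intro!: mult_nonneg_nonneg add_nonneg_nonneg)
      qed
      \<comment> \<open>Nonnegative terms with sum 0 vanish one by one; as the cosine and sine forms
        are nonnegative too, both vanish whenever the coefficient is positive.\<close>
      ultimately have "F (k, l) = 0" using Q0 by (intro nonneg_has_sum_le_0D[where f = F and A = UNIV and a = ?Q]) auto
      moreover have "a k l > 0" using kl by (simp add: pos_indices_def)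
      ultimately show ?thesis
        using form_nonneg by (auto simp: F_def add_nonneg_eq_0_iff split: if_splits)
    qed
    define W where "W = r ` I"
    have finW: "finite W" using fin by (simp add: W_def)
    define T where "T = (\<lambda>(w, w'). w \<bullet> w') ` {(w, w'). w \<in> W \<and> w' \<in> W \<and> w \<noteq> w'}"
    have "finite {(w, w'). w \<in> W \<and> w' \<in> W \<and> w \<noteq> w'}"
      by (rule finite_subset[of _ "W \<times> W"]) (auto simp: finW)
    then have "finite T" by (simp add: T_def)
    moreover have "\<bar>s\<bar> < 1" if "s \<in> T" for s
      using that abs_inner_axis_rep_less_1 z unfolding T_def W_def r_def by fastforce
    \<comment> \<open>Chosen so that \<open>real (card W) * e\<close> is at most 1/2, as diagonal
      dominance demands.\<close>
    moreover define e where "e = 1 / (2 * (real (card W) + 1))"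
    moreover have "e > 0" by (simp add: e_def)
    ultimately obtain l0 where l0: "\<And>l s. l \<ge> l0 \<Longrightarrow> s \<in> T \<Longrightarrow> \<bar>C l s\<bar> \<le> e * C l 1"
      using gegenbauer_offdiagonal_small[OF \<alpha>, of T e] unfolding C_def by meson
    have group_zero: "(\<Sum>\<mu>\<in>{\<mu> \<in> I. r \<mu> = w}. \<sigma> \<mu> ^ l * b \<mu>) = 0"
      if l: "l \<ge> l0" and form0: "form b l = 0" and w: "w \<in> W" for w b l
    proof (rule diagonal_dominance[where W = W and G = "\<lambda>w w'. C l (w \<bullet> w')" and d = "C l 1"
          and v = "\<lambda>w. \<Sum>\<mu>\<in>{\<mu> \<in> I. r \<mu> = w}. \<sigma> \<mu> ^ l * b \<mu>"])
      show "C l (w \<bullet> w) = C l 1" if "w \<in> W" for w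
        using that norm_r by (auto simp: W_def norm_eq_1)
      show "real (card W) * \<bar>C l (w \<bullet> w')\<bar> \<le> C l 1 / 2" if "w \<in> W" "w' \<in> W" "w \<noteq> w'" for w w'
      proof -
        have "w \<bullet> w' \<in> T" using that by (auto simp: T_def)
        then have "real (card W) * \<bar>C l (w \<bullet> w')\<bar> \<le> real (card W) * (e * C l 1)"
          using l0[OF l] by (intro mult_left_mono) auto
        also have "\<dots> = (real (card W) * e) * C l 1" by simp
        also have "\<dots> \<le> (1 / 2) * C l 1"
          using C1[of l] by (intro mult_right_mono) (auto simp: e_def field_simps)
        finally show ?thesis by simp
      qed
      have "form b l = (\<Sum>\<mu>\<in>I. \<Sum>\<nu>\<in>I. (\<sigma> \<mu> ^ l * b \<mu>) * (\<sigma> \<nu> ^ l * b \<nu>) * C l (r \<mu> \<bullet> r \<nu>))"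
        unfolding form_def C_z by (simp only: mult_ac)
      also have "\<dots> = (\<Sum>w\<in>W. \<Sum>w'\<in>W. (\<Sum>\<mu>\<in>{\<mu> \<in> I. r \<mu> = w}. \<sigma> \<mu> ^ l * b \<mu>) *
          (\<Sum>\<mu>\<in>{\<mu> \<in> I. r \<mu> = w'}. \<sigma> \<mu> ^ l * b \<mu>) * C l (w \<bullet> w'))"
        unfolding W_def by (rule sum_grouped_form[OF fin])
      finally show "\<dots> \<le> 0" using form0 by simp
    qed (use C1 finW w in auto)
    \<comment> \<open>Here \<open>e\<close> selects the parity of the degrees and thereby whether
      the signs \<open>\<sigma>\<close> appear. Taking \<open>l0\<close> as the threshold restricts
      the indices to degrees where dominance holds.\<close>
    have exp_zero: "(\<Sum>\<mu>\<in>{\<mu> \<in> I. r \<mu> = w}. of_real ((if e then 1 else \<sigma> \<mu>) * c \<mu>) * cis (\<theta> \<mu>) powi k) = 0"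
      if w: "w \<in> W" for w k e
    proof (rule exponential_sum_vanishing_on_dense_set[OF _ _ meets[of l0 e]])
      fix k assume "k \<in> {k. pos_indices a (nat \<bar>k\<bar>) \<inter> {l0..} \<inter> {l. even l \<longleftrightarrow> e} \<noteq> {}}"
      then obtain l where l: "l \<in> pos_indices a (nat \<bar>k\<bar>)" "l \<ge> l0" "even l = e" by auto
      have \<sigma>l: "\<sigma> \<mu> ^ l = (if e then 1 else \<sigma> \<mu>)" for \<mu> using \<sigma>[of \<mu>] l(3) by auto
      have cos_abs: "cos (real (nat \<bar>k\<bar>) * t) = cos (real_of_int k * t)" for t
        by (cases "k \<ge> 0") auto
      \<comment> \<open>The coefficients see only \<open>\<bar>k\<bar>\<close>, but the exponential
        sum must vanish for signed \<open>k\<close>. The sign is divided out below, and at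
        \<open>k = 0\<close> the sines are zero anyway.\<close>
      have sin_abs: "sin (real (nat \<bar>k\<bar>) * t) = sgn (real_of_int k) * sin (real_of_int k * t)" for t
        by (cases "k > 0"; cases "k = 0") auto
      have c0: "(\<Sum>\<mu>\<in>{\<mu> \<in> I. r \<mu> = w}. (if e then 1 else \<sigma> \<mu>) * (c \<mu> * cos (real_of_int k * \<theta> \<mu>))) = 0"
        using group_zero[OF l(2) _ w] forms[OF l(1)] unfolding \<sigma>l cos_abs by blast
      have "(\<Sum>\<mu>\<in>{\<mu> \<in> I. r \<mu> = w}. (if e then 1 else \<sigma> \<mu>) * (c \<mu> * (sgn (real_of_int k) * sin (real_of_int k * \<theta> \<mu>)))) = 0"
        using group_zero[OF l(2) _ w] forms[OF l(1)] unfolding \<sigma>l sin_abs by blast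
      then have "sgn (real_of_int k) * (\<Sum>\<mu>\<in>{\<mu> \<in> I. r \<mu> = w}. (if e then 1 else \<sigma> \<mu>) * (c \<mu> * sin (real_of_int k * \<theta> \<mu>))) = 0"
        unfolding sum_distrib_left by (simp only: mult_ac)
      then have s0: "(\<Sum>\<mu>\<in>{\<mu> \<in> I. r \<mu> = w}. (if e then 1 else \<sigma> \<mu>) * (c \<mu> * sin (real_of_int k * \<theta> \<mu>))) = 0"
        by (cases "k = 0") (simp_all add: sgn_zero_iff)
      show "(\<Sum>\<mu>\<in>{\<mu> \<in> I. r \<mu> = w}. of_real ((if e then 1 else \<sigma> \<mu>) * c \<mu>) * cis (\<theta> \<mu>) powi k) = 0"
      proof (rule complex_eqI)
        have pow: "cis t powi k = cis (real_of_int k * t)" for t by (rule cis_power_int)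
        show "Re (\<Sum>\<mu>\<in>{\<mu> \<in> I. r \<mu> = w}. of_real ((if e then 1 else \<sigma> \<mu>) * c \<mu>) * cis (\<theta> \<mu>) powi k) = Re 0"
          using c0 unfolding pow by (simp add: mult.assoc)
        show "Im (\<Sum>\<mu>\<in>{\<mu> \<in> I. r \<mu> = w}. of_real ((if e then 1 else \<sigma> \<mu>) * c \<mu>) * cis (\<theta> \<mu>) powi k) = Im 0"
          using s0 unfolding pow by (simp add: mult.assoc)
      qed
    qed (auto simp: fin)
    obtain \<mu>0 where \<mu>0: "\<mu>0 \<in> I" "c \<mu>0 \<noteq> 0" using c by (auto simp: I_def)
    \<comment> \<open>The points sharing both axis and sign with \<open>\<mu>0\<close> are those
      with the same component on the large sphere.\<close>
    define S where "S = {\<mu> \<in> I. r \<mu> = r \<mu>0 \<and> \<sigma> \<mu> = \<sigma> \<mu>0}"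
    have "of_real (c \<mu>0) = (0 :: complex)"
    proof (rule unit_exponential_sums_independent[where S = S and \<zeta> = "\<lambda>\<mu>. cis (\<theta> \<mu>)" and c = "\<lambda>\<mu>. of_real (c \<mu>)"])
      show "finite S" "\<mu>0 \<in> S" using fin \<mu>0 by (auto simp: S_def)
      show "inj_on (\<lambda>\<mu>. cis (\<theta> \<mu>)) S"
      proof (rule inj_onI)
        \<comment> \<open>Distinct points of \<open>S\<close> can differ only on the circle, so
          their unit complex numbers are distinct.\<close>
        fix \<mu> \<nu> assume *: "\<mu> \<in> S" "\<nu> \<in> S" "cis (\<theta> \<mu>) = cis (\<theta> \<nu>)"
        have eqs: "r \<mu> = r \<nu>" "\<sigma> \<mu> = \<sigma> \<nu>" and I: "\<mu> \<in> I" "\<nu> \<in> I" using *(1,2) by (auto simp: S_def)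
        have "cos (\<theta> \<mu>) = cos (\<theta> \<nu>)" "sin (\<theta> \<mu>) = sin (\<theta> \<nu>)"
          using arg_cong[OF *(3), of Re] arg_cong[OF *(3), of Im] by simp_all
        then have "u \<mu> = u \<nu>"
          unfolding u_eq[OF I(1)] u_eq[OF I(2)] z_eq[of \<mu>] z_eq[of \<nu>] eqs circle_point_def by (simp only:)
        then show "\<mu> = \<nu>" using inj_onD[OF u(2)] I unfolding I_def by blast
      qed
      show "(\<Sum>\<mu>\<in>S. of_real (c \<mu>) * cis (\<theta> \<mu>) ^ k) = 0" for k
      proof -
        define A where "A = {\<mu> \<in> I. r \<mu> = r \<mu>0}"
        have w: "r \<mu>0 \<in> W" using \<mu>0 by (simp add: W_def)
        \<comment> \<open>Half of the even sum plus \<open>\<sigma> \<mu>0\<close> times half of the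
          odd sum: points with the sign of \<open>\<mu>0\<close> survive, those with the opposite
          sign cancel.\<close>
        have "(\<Sum>\<mu>\<in>A. (of_real ((if True then 1 else \<sigma> \<mu>) * c \<mu>) * cis (\<theta> \<mu>) powi (int k) +
              of_real (\<sigma> \<mu>0) * (of_real ((if False then 1 else \<sigma> \<mu>) * c \<mu>) * cis (\<theta> \<mu>) powi (int k))) / 2) =
            (\<Sum>\<mu>\<in>S. of_real (c \<mu>) * cis (\<theta> \<mu>) ^ k)"
        proof (rule sum.mono_neutral_cong_right)
          show "finite A" "S \<subseteq> A" using fin by (auto simp: A_def S_def)
          show "\<forall>\<mu>\<in>A - S. (of_real ((if True then 1 else \<sigma> \<mu>) * c \<mu>) * cis (\<theta> \<mu>) powi (int k) +
              of_real (\<sigma> \<mu>0) * (of_real ((if False then 1 else \<sigma> \<mu>) * c \<mu>) * cis (\<theta> \<mu>) powi (int k))) / 2 = 0"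
          proof
            fix \<mu> assume "\<mu> \<in> A - S"
            then have "\<sigma> \<mu> \<noteq> \<sigma> \<mu>0" by (simp add: A_def S_def)
            then have "\<sigma> \<mu> = - \<sigma> \<mu>0" "\<sigma> \<mu>0 * \<sigma> \<mu>0 = 1" using \<sigma>[of \<mu>] \<sigma>[of \<mu>0] by auto
            then have "complex_of_real (\<sigma> \<mu>0) * of_real (\<sigma> \<mu> * c \<mu>) = - of_real (c \<mu>)"
              by (simp flip: of_real_mult mult.assoc)
            then show "(of_real ((if True then 1 else \<sigma> \<mu>) * c \<mu>) * cis (\<theta> \<mu>) powi (int k) +
                of_real (\<sigma> \<mu>0) * (of_real ((if False then 1 else \<sigma> \<mu>) * c \<mu>) * cis (\<theta> \<mu>) powi (int k))) / 2 = 0"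
              by (simp flip: mult.assoc)
          qed
          fix \<mu> assume "\<mu> \<in> S"
          then have "\<sigma> \<mu> = \<sigma> \<mu>0" by (simp add: S_def)
          moreover have "\<sigma> \<mu>0 * \<sigma> \<mu>0 = 1" using \<sigma>[of \<mu>0] by auto
          ultimately have "complex_of_real (\<sigma> \<mu>0) * of_real (\<sigma> \<mu> * c \<mu>) = of_real (c \<mu>)"
            by (simp flip: of_real_mult mult.assoc)
          then show "(of_real ((if True then 1 else \<sigma> \<mu>) * c \<mu>) * cis (\<theta> \<mu>) powi (int k) +
              of_real (\<sigma> \<mu>0) * (of_real ((if False then 1 else \<sigma> \<mu>) * c \<mu>) * cis (\<theta> \<mu>) powi (int k))) / 2 =
              of_real (c \<mu>) * cis (\<theta> \<mu>) ^ k"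
            by (simp flip: mult.assoc)
        qed
        moreover have "(\<Sum>\<mu>\<in>A. (of_real ((if True then 1 else \<sigma> \<mu>) * c \<mu>) * cis (\<theta> \<mu>) powi (int k) +
              of_real (\<sigma> \<mu>0) * (of_real ((if False then 1 else \<sigma> \<mu>) * c \<mu>) * cis (\<theta> \<mu>) powi (int k))) / 2) =
           ((\<Sum>\<mu>\<in>A. of_real ((if True then 1 else \<sigma> \<mu>) * c \<mu>) * cis (\<theta> \<mu>) powi (int k)) +
            of_real (\<sigma> \<mu>0) * (\<Sum>\<mu>\<in>A. of_real ((if False then 1 else \<sigma> \<mu>) * c \<mu>) * cis (\<theta> \<mu>) powi (int k))) / 2"
          by (simp only: sum_divide_distrib[symmetric] sum.distrib sum_distrib_left)
        ultimately show ?thesis using exp_zero[OF w, of True k] exp_zero[OF w, of False k] unfolding A_def by simp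
      qed
    qed
    then show False using \<mu>0 by simp
  qed
  then show "(\<Sum>\<mu>=1..n. \<Sum>\<nu>=1..n. c \<mu> * c \<nu> * inner_kernel f (u \<mu>) (u \<nu>)) > 0"
    using Q_nonneg unfolding I_def by linarith
qed

theorem theorem3p11:
  fixes m :: nat
    and f :: "real \<times> real \<Rightarrow> real"
    and a :: "nat \<Rightarrow> nat \<Rightarrow> real"
  assumes "m \<ge> 2"
    and "CARD('n) = m + 1"
    and "continuous_on ({-1..1} \<times> {-1..1}) f"
    and "pd_kernel_on (sphere (0 :: real ^ 2) 1 \<times> sphere (0 :: real ^ 'n) 1) (inner_kernel f)"
    and "series_coeffs m f a"
  shows "strictly_pd_kernel_on (sphere (0 :: real ^ 2) 1 \<times> sphere (0 :: real ^ 'n) 1) (inner_kernel f) \<longleftrightarrow>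
    (\<forall>\<gamma>::nat.
       meets_every_progression {k. pos_indices a (nat \<bar>k\<bar>) \<inter> {\<gamma>..} \<inter> {l. odd l} \<noteq> {}} \<and>
       meets_every_progression {k. pos_indices a (nat \<bar>k\<bar>) \<inter> {\<gamma>..} \<inter> {l. even l} \<noteq> {}})"
  (is "?strict \<longleftrightarrow> (\<forall>\<gamma>. ?odd \<gamma> \<and> ?even \<gamma>)")
proof
  assume ?strict
  then have "meets_every_progression {k. pos_indices a (nat \<bar>k\<bar>) \<inter> {\<gamma>..} \<inter> {l. even l \<longleftrightarrow> e} \<noteq> {}}" for \<gamma> e
    by (rule strictly_pd_imp_meets[OF assms(1,2) _ assms(5)])
  from this[of _ False] this[of _ True] show "\<forall>\<gamma>. ?odd \<gamma> \<and> ?even \<gamma>" by simp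
next
  assume *: "\<forall>\<gamma>. ?odd \<gamma> \<and> ?even \<gamma>"
  have "meets_every_progression {k. pos_indices a (nat \<bar>k\<bar>) \<inter> {\<gamma>..} \<inter> {l. even l \<longleftrightarrow> e} \<noteq> {}}" for \<gamma> e
    using * by (cases e) simp_all
  then show ?strict by (rule meets_imp_strictly_pd[OF assms(1,2,4,5)])
qed

end
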